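(* The collection of isomorphisms $D_{\mathcal A,\mathcal B,\mathcal C}:[\mathcal A,[\mathcal B,\mathcal C]]\cong[\mathcal B,[\mathcal A,\mathcal C]]$, $F\mapsto F^*$, $\theta\mapsto\theta^*$, for symmetric monoidal categories $\mathcal A,\mathcal B,\mathcal C$, defines a 2-natural transformation between 2-functors $\mathrm{SMC}^{op}\times\mathrm{SMC}^{op}\times\mathrm{SMC}\to\mathrm{SMC}$: $$[\mathcal A,[\mathcal B,\mathcal C]]\cong[\mathcal B,[\mathcal A,\mathcal C]].$$
   Context: All symmetric monoidal categories are small, with tensor $\otimes$, unit $I$ and natural isomorphisms $ass_{a,b,c}:a\otimes(b\otimes c)\to(a\otimes b)\otimes c$, $r_a:a\otimes I\to a$, $l_a:I\otimes a\to a$, $s_{a,b}:a\otimes b\to b\otimes a$ satisfying the usual coherence axioms. A symmetric monoidal functor $F:\mathcal A\to\mathcal B$ is a lax one: a functor with an arrow $F^0:I\to F(I)$ and a natural family $F^2_{x,y}:Fx\otimes Fy\to F(x\otimes y)$ satisfying the usual associativity, unit and symmetry axioms; it is strict if $F^0$ and all $F^2_{x,y}$ are identities. $\mathrm{SMC}$ is the 2-category of symmetric monoidal categories, symmetric monoidal functors and monoidal natural transformations; $\mathrm{SMC}^{op}$ reverses 1-cells only. $[\mathcal A,\mathcal B]$ is the category $\mathrm{SMC}(\mathcal A,\mathcal B)$ with the pointwise symmetric monoidal structure: $(F\Box G)(a)=Fa\otimes Ga$, $(F\Box G)^0$ is $I\cong I\otimes I\xrightarrow{F^0\otimes G^0}F(I)\otimes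 G(I)$, $(F\Box G)^2_{a,b}$ is the canonical interchange $(Fa\otimes Ga)\otimes(Fb\otimes Gb)\cong(Fa\otimes Fb)\otimes(Ga\otimes Gb)$ followed by $F^2_{a,b}\otimes G^2_{a,b}$; $(\sigma\Box\tau)_a=\sigma_a\otimes\tau_a$; the unit is the constant functor at $I_{\mathcal B}$ (with $I\to I$ the identity and $I\otimes I\to I$ the canonical arrow); $ass,r,l,s$ are pointwise. The assignment $(\mathcal A,\mathcal B)\mapsto[\mathcal A,\mathcal B]$ is a 2-functor $\mathrm{SMC}^{op}\times\mathrm{SMC}\to\mathrm{SMC}$: for $F:\mathcal C\to\mathcal A$ and $G:\mathcal B\to\mathcal D$, $[F,G]:[\mathcal A,\mathcal B]\to[\mathcal C,\mathcal D]$ is $H\mapsto GHF$, $\theta\mapsto G*\theta*F$, with $[F,G]^0$ having all components $G^0$ and $[F,G]^2_{H,K}$ having component $G^2_{HFc,KFc}$ at $c$; for 2-cells $\sigma,\tau$, $[\sigma,\tau]_H=\tau*H*\sigma$. The two 2-functors of the claim are obtained by iterating this one. For $F:\mathcal A\to[\mathcal B,\mathcal C]$ in $\mathrm{SMC}$, its dual $F^*:\mathcal B\to[\mathcal A,\mathcal C]$ is given by $F^*(b)(a)=F(a)(b)$, $F^*(b)(f)=F(f)_b$, $(F^*b)^0=(F^0)_b$, $(F^*b)^2_{a,a'}=(F^2_{a,a'})_b$, $F^*(g)_a=F(a)(g)$, $((F^* )^0)_a=(Fa)^0$, $((F^* )^2_{b,b'})_a=(Fa)^2_{b,b'}$; for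 a 2-cell $\theta:F\to G$, $(\theta^*_b)_a=(\theta_a)_b$. The resulting functor $D_{\mathcal A,\mathcal B,\mathcal C}$ is a strict symmetric monoidal functor with inverse $D_{\mathcal B,\mathcal A,\mathcal C}$. *)

theory Defs
  imports Main "HOL-Library.FuncSet"
begin

section \<open>Categories and symmetric monoidal categories\<close>

record ('o, 'm) cat =
  Ob  :: "'o set"
  Ar  :: "'m set"
  Dom :: "'m \<Rightarrow> 'o"
  Cod :: "'m \<Rightarrow> 'o"
  Idn :: "'o \<Rightarrow> 'm"
  Cmp :: "'m \<Rightarrow> 'm \<Rightarrow> 'm" (infixr "\<cdot>\<index>" 65)

definition Hom :: "('o, 'm, 'x) cat_scheme \<Rightarrow> 'o \<Rightarrow> 'o \<Rightarrow> 'm set" where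
  "Hom C a b = {f \<in> Ar C. Dom C f = a \<and> Cod C f = b}"

locale category =
  fixes C :: "('o, 'm, 'x) cat_scheme" (structure)
  assumes Dom_Ob: "f \<in> Ar C \<Longrightarrow> Dom C f \<in> Ob C"
    and Cod_Ob: "f \<in> Ar C \<Longrightarrow> Cod C f \<in> Ob C"
    and Idn_Hom: "a \<in> Ob C \<Longrightarrow> Idn C a \<in> Hom C a a"
    and Cmp_Hom: "\<lbrakk>f \<in> Hom C a b; g \<in> Hom C b c\<rbrakk> \<Longrightarrow> g \<cdot> f \<in> Hom C a c"
    and Cmp_Idn: "f \<in> Hom C a b \<Longrightarrow> f \<cdot> Idn C a = f"
    and Idn_Cmp: "f \<in> Hom C a b \<Longrightarrow> Idn C b \<cdot> f = f"
    and Cmp_assoc: "\<lbrakk>f \<in> Hom C a b; g \<in> Hom C b c; h \<in> Hom C c d\<rbrakk>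
      \<Longrightarrow> (h \<cdot> g) \<cdot> f = h \<cdot> (g \<cdot> f)"

definition inverse_arrows :: "('o, 'm, 'x) cat_scheme \<Rightarrow> 'm \<Rightarrow> 'm \<Rightarrow> bool" where
  "inverse_arrows C f g \<longleftrightarrow>
     f \<in> Ar C \<and> g \<in> Hom C (Cod C f) (Dom C f) \<and>
     g \<cdot>\<^bsub>C\<^esub> f = Idn C (Dom C f) \<and> f \<cdot>\<^bsub>C\<^esub> g = Idn C (Cod C f)"

definition is_iso :: "('o, 'm, 'x) cat_scheme \<Rightarrow> 'm \<Rightarrow> bool" where
  "is_iso C f \<longleftrightarrow> (\<exists>g. inverse_arrows C f g)"

definition inverse_of :: "('o, 'm, 'x) cat_scheme \<Rightarrow> 'm \<Rightarrow> 'm" where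
  "inverse_of C f = (THE g. inverse_arrows C f g)"

text \<open>\<open>\<otimes>\<close> is the tensor on objects and \<open>\<odot>\<close> the tensor on arrows.\<close>

record ('o, 'm) smc = "('o, 'm) cat" +
  TOb :: "'o \<Rightarrow> 'o \<Rightarrow> 'o" (infixr "\<otimes>\<index>" 70)
  TAr :: "'m \<Rightarrow> 'm \<Rightarrow> 'm" (infixr "\<odot>\<index>" 70)
  Unt :: "'o"
  Ass :: "'o \<Rightarrow> 'o \<Rightarrow> 'o \<Rightarrow> 'm"
  Rgt :: "'o \<Rightarrow> 'm"
  Lft :: "'o \<Rightarrow> 'm"
  Sym :: "'o \<Rightarrow> 'o \<Rightarrow> 'm"

locale sym_mon_category = category C
  for C :: "('o, 'm) smc" (structure) +
  assumes TOb_Ob: "\<lbrakk>a \<in> Ob C; b \<in> Ob C\<rbrakk> \<Longrightarrow> a \<otimes> b \<in> Ob C"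
    and TAr_Hom: "\<lbrakk>f \<in> Hom C a b; g \<in> Hom C c d\<rbrakk> \<Longrightarrow> f \<odot> g \<in> Hom C (a \<otimes> c) (b \<otimes> d)"
    and TAr_Idn: "\<lbrakk>a \<in> Ob C; b \<in> Ob C\<rbrakk> \<Longrightarrow> Idn C a \<odot> Idn C b = Idn C (a \<otimes> b)"
    and TAr_Cmp: "\<lbrakk>f \<in> Hom C a b; f' \<in> Hom C b c; g \<in> Hom C x y; g' \<in> Hom C y z\<rbrakk>
      \<Longrightarrow> (f' \<cdot> f) \<odot> (g' \<cdot> g) = (f' \<odot> g') \<cdot> (f \<odot> g)"
    and Unt_Ob: "Unt C \<in> Ob C"
    and Ass_Hom: "\<lbrakk>a \<in> Ob C; b \<in> Ob C; c \<in> Ob C\<rbrakk>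
      \<Longrightarrow> Ass C a b c \<in> Hom C (a \<otimes> (b \<otimes> c)) ((a \<otimes> b) \<otimes> c)"
    and Ass_iso: "\<lbrakk>a \<in> Ob C; b \<in> Ob C; c \<in> Ob C\<rbrakk> \<Longrightarrow> is_iso C (Ass C a b c)"
    and Ass_nat: "\<lbrakk>f \<in> Hom C a a'; g \<in> Hom C b b'; h \<in> Hom C c c'\<rbrakk>
      \<Longrightarrow> Ass C a' b' c' \<cdot> (f \<odot> (g \<odot> h)) = ((f \<odot> g) \<odot> h) \<cdot> Ass C a b c"
    and Rgt_Hom: "a \<in> Ob C \<Longrightarrow> Rgt C a \<in> Hom C (a \<otimes> Unt C) a"
    and Rgt_iso: "a \<in> Ob C \<Longrightarrow> is_iso C (Rgt C a)"
    and Rgt_nat: "f \<in> Hom C a b \<Longrightarrow> Rgt C b \<cdot> (f \<odot> Idn C (Unt C)) = f \<cdot> Rgt C a"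
    and Lft_Hom: "a \<in> Ob C \<Longrightarrow> Lft C a \<in> Hom C (Unt C \<otimes> a) a"
    and Lft_iso: "a \<in> Ob C \<Longrightarrow> is_iso C (Lft C a)"
    and Lft_nat: "f \<in> Hom C a b \<Longrightarrow> Lft C b \<cdot> (Idn C (Unt C) \<odot> f) = f \<cdot> Lft C a"
    and Sym_Hom: "\<lbrakk>a \<in> Ob C; b \<in> Ob C\<rbrakk> \<Longrightarrow> Sym C a b \<in> Hom C (a \<otimes> b) (b \<otimes> a)"
    and Sym_nat: "\<lbrakk>f \<in> Hom C a a'; g \<in> Hom C b b'\<rbrakk>
      \<Longrightarrow> Sym C a' b' \<cdot> (f \<odot> g) = (g \<odot> f) \<cdot> Sym C a b"
    and pentagon: "\<lbrakk>a \<in> Ob C; b \<in> Ob C; c \<in> Ob C; d \<in> Ob C\<rbrakk>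
      \<Longrightarrow> Ass C (a \<otimes> b) c d \<cdot> Ass C a b (c \<otimes> d)
        = (Ass C a b c \<odot> Idn C d) \<cdot> Ass C a (b \<otimes> c) d \<cdot> (Idn C a \<odot> Ass C b c d)"
    and triangle: "\<lbrakk>a \<in> Ob C; b \<in> Ob C\<rbrakk>
      \<Longrightarrow> (Rgt C a \<odot> Idn C b) \<cdot> Ass C a (Unt C) b = Idn C a \<odot> Lft C b"
    and Sym_Sym: "\<lbrakk>a \<in> Ob C; b \<in> Ob C\<rbrakk> \<Longrightarrow> Sym C b a \<cdot> Sym C a b = Idn C (a \<otimes> b)"
    and Lft_Sym: "a \<in> Ob C \<Longrightarrow> Lft C a \<cdot> Sym C a (Unt C) = Rgt C a"
    and hexagon: "\<lbrakk>a \<in> Ob C; b \<in> Ob C; c \<in> Ob C\<rbrakk>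
      \<Longrightarrow> Ass C c a b \<cdot> Sym C (a \<otimes> b) c \<cdot> Ass C a b c
        = (Sym C a c \<odot> Idn C b) \<cdot> Ass C a c b \<cdot> (Idn C a \<odot> Sym C b c)"

section \<open>Symmetric monoidal functors and monoidal natural transformations\<close>

text \<open>
  Functors and transformations carry their domain and codomain, and their components are
  required to be \<open>undefined\<close> outside the carriers, so that equality in HOL is equality of
  functors, respectively of transformations.
\<close>

record ('oa, 'ma, 'ob, 'mb) smf =
  fdom :: "('oa, 'ma) smc"
  fcod :: "('ob, 'mb) smc"
  fob  :: "'oa \<Rightarrow> 'ob"
  far  :: "'ma \<Rightarrow> 'mb"
  fun0 :: "'mb"
  fun2 :: "'oa \<Rightarrow> 'oa \<Rightarrow> 'mb"

locale sym_mon_functor =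
  fixes F :: "('oa, 'ma, 'ob, 'mb) smf"
    and A :: "('oa, 'ma) smc" and B :: "('ob, 'mb) smc"
  defines "A \<equiv> fdom F" and "B \<equiv> fcod F"
  assumes fdom_smc: "sym_mon_category A"
    and fcod_smc: "sym_mon_category B"
    and fob_ext: "fob F \<in> extensional (Ob A)"
    and far_ext: "far F \<in> extensional (Ar A)"
    and fun2_ext: "fun2 F \<in> extensional (Ob A)"
    and fun2_ext': "x \<in> Ob A \<Longrightarrow> fun2 F x \<in> extensional (Ob A)"
    and fob_Ob: "x \<in> Ob A \<Longrightarrow> fob F x \<in> Ob B"
    and far_Hom: "f \<in> Hom A x y \<Longrightarrow> far F f \<in> Hom B (fob F x) (fob F y)"
    and far_Idn: "x \<in> Ob A \<Longrightarrow> far F (Idn A x) = Idn B (fob F x)"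
    and far_Cmp: "\<lbrakk>f \<in> Hom A x y; g \<in> Hom A y z\<rbrakk>
      \<Longrightarrow> far F (g \<cdot>\<^bsub>A\<^esub> f) = far F g \<cdot>\<^bsub>B\<^esub> far F f"
    and fun0_Hom: "fun0 F \<in> Hom B (Unt B) (fob F (Unt A))"
    and fun2_Hom: "\<lbrakk>x \<in> Ob A; y \<in> Ob A\<rbrakk>
      \<Longrightarrow> fun2 F x y \<in> Hom B (fob F x \<otimes>\<^bsub>B\<^esub> fob F y) (fob F (x \<otimes>\<^bsub>A\<^esub> y))"
    and fun2_nat: "\<lbrakk>f \<in> Hom A x x'; g \<in> Hom A y y'\<rbrakk>
      \<Longrightarrow> far F (f \<odot>\<^bsub>A\<^esub> g) \<cdot>\<^bsub>B\<^esub> fun2 F x y = fun2 F x' y' \<cdot>\<^bsub>B\<^esub> (far F f \<odot>\<^bsub>B\<^esub> far F g)"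
    and fun2_Ass: "\<lbrakk>x \<in> Ob A; y \<in> Ob A; z \<in> Ob A\<rbrakk>
      \<Longrightarrow> far F (Ass A x y z) \<cdot>\<^bsub>B\<^esub> fun2 F x (y \<otimes>\<^bsub>A\<^esub> z) \<cdot>\<^bsub>B\<^esub> (Idn B (fob F x) \<odot>\<^bsub>B\<^esub> fun2 F y z)
        = fun2 F (x \<otimes>\<^bsub>A\<^esub> y) z \<cdot>\<^bsub>B\<^esub> (fun2 F x y \<odot>\<^bsub>B\<^esub> Idn B (fob F z))
            \<cdot>\<^bsub>B\<^esub> Ass B (fob F x) (fob F y) (fob F z)"
    and fun_Rgt: "x \<in> Ob A
      \<Longrightarrow> far F (Rgt A x) \<cdot>\<^bsub>B\<^esub> fun2 F x (Unt A) \<cdot>\<^bsub>B\<^esub> (Idn B (fob F x) \<odot>\<^bsub>B\<^esub> fun0 F) = Rgt B (fob F x)"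
    and fun_Lft: "x \<in> Ob A
      \<Longrightarrow> far F (Lft A x) \<cdot>\<^bsub>B\<^esub> fun2 F (Unt A) x \<cdot>\<^bsub>B\<^esub> (fun0 F \<odot>\<^bsub>B\<^esub> Idn B (fob F x)) = Lft B (fob F x)"
    and fun2_Sym: "\<lbrakk>x \<in> Ob A; y \<in> Ob A\<rbrakk>
      \<Longrightarrow> far F (Sym A x y) \<cdot>\<^bsub>B\<^esub> fun2 F x y = fun2 F y x \<cdot>\<^bsub>B\<^esub> Sym B (fob F x) (fob F y)"

record ('oa, 'ma, 'ob, 'mb) mnt =
  ndom  :: "('oa, 'ma, 'ob, 'mb) smf"
  ncod  :: "('oa, 'ma, 'ob, 'mb) smf"
  ncomp :: "'oa \<Rightarrow> 'mb"

locale mon_nat_trans =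
  fixes \<sigma> :: "('oa, 'ma, 'ob, 'mb) mnt"
    and F :: "('oa, 'ma, 'ob, 'mb) smf" and G :: "('oa, 'ma, 'ob, 'mb) smf"
    and A :: "('oa, 'ma) smc" and B :: "('ob, 'mb) smc"
  defines "F \<equiv> ndom \<sigma>" and "G \<equiv> ncod \<sigma>" and "A \<equiv> fdom (ndom \<sigma>)" and "B \<equiv> fcod (ndom \<sigma>)"
  assumes ndom_smf: "sym_mon_functor F"
    and ncod_smf: "sym_mon_functor G"
    and fdom_ncod: "fdom G = A"
    and fcod_ncod: "fcod G = B"
    and ncomp_ext: "ncomp \<sigma> \<in> extensional (Ob A)"
    and ncomp_Hom: "x \<in> Ob A \<Longrightarrow> ncomp \<sigma> x \<in> Hom B (fob F x) (fob G x)"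
    and ncomp_nat: "f \<in> Hom A x y
      \<Longrightarrow> ncomp \<sigma> y \<cdot>\<^bsub>B\<^esub> far F f = far G f \<cdot>\<^bsub>B\<^esub> ncomp \<sigma> x"
    and ncomp_fun0: "ncomp \<sigma> (Unt A) \<cdot>\<^bsub>B\<^esub> fun0 F = fun0 G"
    and ncomp_fun2: "\<lbrakk>x \<in> Ob A; y \<in> Ob A\<rbrakk>
      \<Longrightarrow> ncomp \<sigma> (x \<otimes>\<^bsub>A\<^esub> y) \<cdot>\<^bsub>B\<^esub> fun2 F x y = fun2 G x y \<cdot>\<^bsub>B\<^esub> (ncomp \<sigma> x \<odot>\<^bsub>B\<^esub> ncomp \<sigma> y)"

section \<open>2-categories and 2-functors\<close>

record ('o, 'f, 's) two_cat =
  cells0 :: "'o set"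
  cells1 :: "'f set"
  cells2 :: "'s set"
  src1 :: "'f \<Rightarrow> 'o"
  tgt1 :: "'f \<Rightarrow> 'o"
  src2 :: "'s \<Rightarrow> 'f"
  tgt2 :: "'s \<Rightarrow> 'f"
  unit1 :: "'o \<Rightarrow> 'f"
  unit2 :: "'f \<Rightarrow> 's"
  comp1 :: "'f \<Rightarrow> 'f \<Rightarrow> 'f"
  vcomp :: "'s \<Rightarrow> 's \<Rightarrow> 's"
  hcomp :: "'s \<Rightarrow> 's \<Rightarrow> 's"

definition Cells1 :: "('o, 'f, 's) two_cat \<Rightarrow> 'o \<Rightarrow> 'o \<Rightarrow> 'f set" where
  "Cells1 K a b = {f \<in> cells1 K. src1 K f = a \<and> tgt1 K f = b}"

definition Cells2 :: "('o, 'f, 's) two_cat \<Rightarrow> 'f \<Rightarrow> 'f \<Rightarrow> 's set" where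
  "Cells2 K f g = {s \<in> cells2 K. src2 K s = f \<and> tgt2 K s = g}"

locale two_category =
  fixes K :: "('o, 'f, 's) two_cat"
  assumes src1_cells0: "f \<in> cells1 K \<Longrightarrow> src1 K f \<in> cells0 K"
    and tgt1_cells0: "f \<in> cells1 K \<Longrightarrow> tgt1 K f \<in> cells0 K"
    and src2_cells1: "s \<in> cells2 K \<Longrightarrow> src2 K s \<in> cells1 K"
    and tgt2_cells1: "s \<in> cells2 K \<Longrightarrow> tgt2 K s \<in> cells1 K"
    and parallel_src: "s \<in> cells2 K \<Longrightarrow> src1 K (tgt2 K s) = src1 K (src2 K s)"
    and parallel_tgt: "s \<in> cells2 K \<Longrightarrow> tgt1 K (tgt2 K s) = tgt1 K (src2 K s)"
    and unit1_Cells1: "a \<in> cells0 K \<Longrightarrow> unit1 K a \<in> Cells1 K a a"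
    and comp1_Cells1: "\<lbrakk>f \<in> Cells1 K a b; g \<in> Cells1 K b c\<rbrakk> \<Longrightarrow> comp1 K g f \<in> Cells1 K a c"
    and comp1_unit1: "f \<in> Cells1 K a b \<Longrightarrow> comp1 K f (unit1 K a) = f"
    and unit1_comp1: "f \<in> Cells1 K a b \<Longrightarrow> comp1 K (unit1 K b) f = f"
    and comp1_assoc: "\<lbrakk>f \<in> Cells1 K a b; g \<in> Cells1 K b c; h \<in> Cells1 K c d\<rbrakk>
      \<Longrightarrow> comp1 K (comp1 K h g) f = comp1 K h (comp1 K g f)"
    and unit2_Cells2: "f \<in> cells1 K \<Longrightarrow> unit2 K f \<in> Cells2 K f f"
    and vcomp_Cells2: "\<lbrakk>s \<in> Cells2 K f g; t \<in> Cells2 K g h\<rbrakk> \<Longrightarrow> vcomp K t s \<in> Cells2 K f h"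
    and vcomp_unit2: "s \<in> Cells2 K f g \<Longrightarrow> vcomp K s (unit2 K f) = s"
    and unit2_vcomp: "s \<in> Cells2 K f g \<Longrightarrow> vcomp K (unit2 K g) s = s"
    and vcomp_assoc: "\<lbrakk>s \<in> Cells2 K f g; t \<in> Cells2 K g h; u \<in> Cells2 K h k\<rbrakk>
      \<Longrightarrow> vcomp K (vcomp K u t) s = vcomp K u (vcomp K t s)"
    and hcomp_Cells2: "\<lbrakk>f \<in> Cells1 K a b; s \<in> Cells2 K f f'; g \<in> Cells1 K b c; t \<in> Cells2 K g g'\<rbrakk>
      \<Longrightarrow> hcomp K t s \<in> Cells2 K (comp1 K g f) (comp1 K g' f')"
    and hcomp_unit2: "\<lbrakk>f \<in> Cells1 K a b; g \<in> Cells1 K b c\<rbrakk>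
      \<Longrightarrow> hcomp K (unit2 K g) (unit2 K f) = unit2 K (comp1 K g f)"
    and interchange: "\<lbrakk>f \<in> Cells1 K a b; s \<in> Cells2 K f f'; s' \<in> Cells2 K f' f'';
        g \<in> Cells1 K b c; t \<in> Cells2 K g g'; t' \<in> Cells2 K g' g''\<rbrakk>
      \<Longrightarrow> hcomp K (vcomp K t' t) (vcomp K s' s) = vcomp K (hcomp K t' s') (hcomp K t s)"
    and hcomp_unit1: "\<lbrakk>f \<in> Cells1 K a b; s \<in> Cells2 K f f'\<rbrakk>
      \<Longrightarrow> hcomp K s (unit2 K (unit1 K a)) = s"
    and unit1_hcomp: "\<lbrakk>f \<in> Cells1 K a b; s \<in> Cells2 K f f'\<rbrakk>
      \<Longrightarrow> hcomp K (unit2 K (unit1 K b)) s = s"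
    and hcomp_assoc: "\<lbrakk>f \<in> Cells1 K a b; s \<in> Cells2 K f f'; g \<in> Cells1 K b c; t \<in> Cells2 K g g';
        h \<in> Cells1 K c d; u \<in> Cells2 K h h'\<rbrakk>
      \<Longrightarrow> hcomp K (hcomp K u t) s = hcomp K u (hcomp K t s)"

definition op1 :: "('o, 'f, 's) two_cat \<Rightarrow> ('o, 'f, 's) two_cat" where
  "op1 K = K\<lparr>src1 := tgt1 K, tgt1 := src1 K,
             comp1 := (\<lambda>g f. comp1 K f g), hcomp := (\<lambda>t s. hcomp K s t)\<rparr>"

definition prod_two_cat :: "('o, 'f, 's) two_cat \<Rightarrow> ('o', 'f', 's') two_cat
    \<Rightarrow> ('o \<times> 'o', 'f \<times> 'f', 's \<times> 's') two_cat" (infixr "\<times>\<^sub>2" 75) where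
  "K \<times>\<^sub>2 L =
    \<lparr>cells0 = cells0 K \<times> cells0 L,
     cells1 = cells1 K \<times> cells1 L,
     cells2 = cells2 K \<times> cells2 L,
     src1 = map_prod (src1 K) (src1 L),
     tgt1 = map_prod (tgt1 K) (tgt1 L),
     src2 = map_prod (src2 K) (src2 L),
     tgt2 = map_prod (tgt2 K) (tgt2 L),
     unit1 = map_prod (unit1 K) (unit1 L),
     unit2 = map_prod (unit2 K) (unit2 L),
     comp1 = (\<lambda>(g, g') (f, f'). (comp1 K g f, comp1 L g' f')),
     vcomp = (\<lambda>(t, t') (s, s'). (vcomp K t s, vcomp L t' s')),
     hcomp = (\<lambda>(t, t') (s, s'). (hcomp K t s, hcomp L t' s'))\<rparr>"

record ('o, 'f, 's, 'o', 'f', 's') two_fun =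
  on0 :: "'o \<Rightarrow> 'o'"
  on1 :: "'f \<Rightarrow> 'f'"
  on2 :: "'s \<Rightarrow> 's'"

locale two_functor =
  fixes K :: "('o, 'f, 's) two_cat" and L :: "('o', 'f', 's') two_cat"
    and P :: "('o, 'f, 's, 'o', 'f', 's') two_fun"
  assumes dom_two_category: "two_category K"
    and cod_two_category: "two_category L"
    and on0_cells0: "a \<in> cells0 K \<Longrightarrow> on0 P a \<in> cells0 L"
    and on1_Cells1: "f \<in> Cells1 K a b \<Longrightarrow> on1 P f \<in> Cells1 L (on0 P a) (on0 P b)"
    and on2_Cells2: "s \<in> Cells2 K f g \<Longrightarrow> on2 P s \<in> Cells2 L (on1 P f) (on1 P g)"
    and on1_unit1: "a \<in> cells0 K \<Longrightarrow> on1 P (unit1 K a) = unit1 L (on0 P a)"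
    and on1_comp1: "\<lbrakk>f \<in> Cells1 K a b; g \<in> Cells1 K b c\<rbrakk>
      \<Longrightarrow> on1 P (comp1 K g f) = comp1 L (on1 P g) (on1 P f)"
    and on2_unit2: "f \<in> cells1 K \<Longrightarrow> on2 P (unit2 K f) = unit2 L (on1 P f)"
    and on2_vcomp: "\<lbrakk>s \<in> Cells2 K f g; t \<in> Cells2 K g h\<rbrakk>
      \<Longrightarrow> on2 P (vcomp K t s) = vcomp L (on2 P t) (on2 P s)"
    and on2_hcomp: "\<lbrakk>f \<in> Cells1 K a b; s \<in> Cells2 K f f'; g \<in> Cells1 K b c; t \<in> Cells2 K g g'\<rbrakk>
      \<Longrightarrow> on2 P (hcomp K t s) = hcomp L (on2 P t) (on2 P s)"

section \<open>The 2-category of symmetric monoidal categories\<close>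

definition smf_id :: "('o, 'm) smc \<Rightarrow> ('o, 'm, 'o, 'm) smf" where
  "smf_id A = \<lparr>fdom = A, fcod = A, fob = (\<lambda>x\<in>Ob A. x), far = (\<lambda>f\<in>Ar A. f),
     fun0 = Idn A (Unt A), fun2 = (\<lambda>x\<in>Ob A. \<lambda>y\<in>Ob A. Idn A (x \<otimes>\<^bsub>A\<^esub> y))\<rparr>"

definition smf_comp :: "('ob, 'mb, 'oc, 'mc) smf \<Rightarrow> ('oa, 'ma, 'ob, 'mb) smf
    \<Rightarrow> ('oa, 'ma, 'oc, 'mc) smf" (infixr "\<circ>\<^sub>F" 65) where
  "G \<circ>\<^sub>F F = \<lparr>fdom = fdom F, fcod = fcod G,
     fob = (\<lambda>x\<in>Ob (fdom F). fob G (fob F x)),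
     far = (\<lambda>f\<in>Ar (fdom F). far G (far F f)),
     fun0 = far G (fun0 F) \<cdot>\<^bsub>fcod G\<^esub> fun0 G,
     fun2 = (\<lambda>x\<in>Ob (fdom F). \<lambda>y\<in>Ob (fdom F).
               far G (fun2 F x y) \<cdot>\<^bsub>fcod G\<^esub> fun2 G (fob F x) (fob F y))\<rparr>"

definition mnt_id :: "('oa, 'ma, 'ob, 'mb) smf \<Rightarrow> ('oa, 'ma, 'ob, 'mb) mnt" where
  "mnt_id F = \<lparr>ndom = F, ncod = F, ncomp = (\<lambda>x\<in>Ob (fdom F). Idn (fcod F) (fob F x))\<rparr>"

definition mnt_vcomp :: "('oa, 'ma, 'ob, 'mb) mnt \<Rightarrow> ('oa, 'ma, 'ob, 'mb) mnt
    \<Rightarrow> ('oa, 'ma, 'ob, 'mb) mnt" where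
  "mnt_vcomp \<tau> \<sigma> = \<lparr>ndom = ndom \<sigma>, ncod = ncod \<tau>,
     ncomp = (\<lambda>x\<in>Ob (fdom (ndom \<sigma>)). ncomp \<tau> x \<cdot>\<^bsub>fcod (ndom \<sigma>)\<^esub> ncomp \<sigma> x)\<rparr>"

definition mnt_hcomp :: "('ob, 'mb, 'oc, 'mc) mnt \<Rightarrow> ('oa, 'ma, 'ob, 'mb) mnt
    \<Rightarrow> ('oa, 'ma, 'oc, 'mc) mnt" (infixr "*\<^sub>h" 65) where
  "\<tau> *\<^sub>h \<sigma> = \<lparr>ndom = ndom \<tau> \<circ>\<^sub>F ndom \<sigma>, ncod = ncod \<tau> \<circ>\<^sub>F ncod \<sigma>,
     ncomp = (\<lambda>x\<in>Ob (fdom (ndom \<sigma>)).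
       ncomp \<tau> (fob (ncod \<sigma>) x) \<cdot>\<^bsub>fcod (ndom \<tau>)\<^esub> far (ndom \<tau>) (ncomp \<sigma> x))\<rparr>"

type_synonym ('o, 'm) smc_two_cat =
  "(('o, 'm) smc, ('o, 'm, 'o, 'm) smf, ('o, 'm, 'o, 'm) mnt) two_cat"

text \<open>
  The HOL types \<open>'o\<close> and \<open>'m\<close> are arbitrary and play the role of the universe of small sets.
\<close>

definition SMC :: "('o, 'm) smc_two_cat" where
  "SMC =
    \<lparr>cells0 = {A. sym_mon_category A},
     cells1 = {F. sym_mon_functor F},
     cells2 = {\<sigma>. mon_nat_trans \<sigma>},
     src1 = fdom, tgt1 = fcod, src2 = ndom, tgt2 = ncod,
     unit1 = smf_id, unit2 = mnt_id,
     comp1 = smf_comp, vcomp = mnt_vcomp, hcomp = mnt_hcomp\<rparr>"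

definition inverse_smf :: "('oa, 'ma, 'ob, 'mb) smf \<Rightarrow> ('ob, 'mb, 'oa, 'ma) smf \<Rightarrow> bool" where
  "inverse_smf F G \<longleftrightarrow> sym_mon_functor F \<and> sym_mon_functor G \<and>
     fdom G = fcod F \<and> fcod G = fdom F \<and>
     G \<circ>\<^sub>F F = smf_id (fdom F) \<and> F \<circ>\<^sub>F G = smf_id (fcod F)"

text \<open>
  A 2-natural transformation \<open>\<alpha> : P \<Rightarrow> Q\<close> between 2-functors with values in symmetric monoidal
  categories.  The categories \<open>[\<A>,[\<B>,\<C>]]\<close> and \<open>[\<B>,[\<A>,\<C>]]\<close> have objects and arrows of
  different HOL types, so \<open>P\<close> and \<open>Q\<close> are valued in two instances of the polymorphic constant
  \<open>SMC\<close>; the components of \<open>\<alpha>\<close> are symmetric monoidal functors between categories over these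
  types.
\<close>

locale two_natural =
  fixes K :: "('o, 'f, 's) two_cat"
    and P :: "('o, 'f, 's, ('op, 'mp) smc, ('op, 'mp, 'op, 'mp) smf, ('op, 'mp, 'op, 'mp) mnt) two_fun"
    and Q :: "('o, 'f, 's, ('oq, 'mq) smc, ('oq, 'mq, 'oq, 'mq) smf, ('oq, 'mq, 'oq, 'mq) mnt) two_fun"
    and \<alpha> :: "'o \<Rightarrow> ('op, 'mp, 'oq, 'mq) smf"
  assumes dom_two_functor: "two_functor K SMC P"
    and cod_two_functor: "two_functor K SMC Q"
    and comp_smf: "a \<in> cells0 K \<Longrightarrow> sym_mon_functor (\<alpha> a)"
    and comp_fdom: "a \<in> cells0 K \<Longrightarrow> fdom (\<alpha> a) = on0 P a"
    and comp_fcod: "a \<in> cells0 K \<Longrightarrow> fcod (\<alpha> a) = on0 Q a"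
    and natural1: "f \<in> Cells1 K a b \<Longrightarrow> \<alpha> b \<circ>\<^sub>F on1 P f = on1 Q f \<circ>\<^sub>F \<alpha> a"
    and natural2: "\<lbrakk>f \<in> Cells1 K a b; s \<in> Cells2 K f g\<rbrakk>
      \<Longrightarrow> mnt_id (\<alpha> b) *\<^sub>h on2 P s = on2 Q s *\<^sub>h mnt_id (\<alpha> a)"

section \<open>The internal hom\<close>

text \<open>The canonical arrow \<open>(a \<otimes> b) \<otimes> (c \<otimes> d) \<rightarrow> (a \<otimes> c) \<otimes> (b \<otimes> d)\<close>.\<close>

definition middle4 :: "('o, 'm) smc \<Rightarrow> 'o \<Rightarrow> 'o \<Rightarrow> 'o \<Rightarrow> 'o \<Rightarrow> 'm" where
  "middle4 B a b c d =
     Ass B a c (b \<otimes>\<^bsub>B\<^esub> d)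
     \<cdot>\<^bsub>B\<^esub> (Idn B a \<odot>\<^bsub>B\<^esub> inverse_of B (Ass B c b d))
     \<cdot>\<^bsub>B\<^esub> (Idn B a \<odot>\<^bsub>B\<^esub> (Sym B b c \<odot>\<^bsub>B\<^esub> Idn B d))
     \<cdot>\<^bsub>B\<^esub> (Idn B a \<odot>\<^bsub>B\<^esub> Ass B b c d)
     \<cdot>\<^bsub>B\<^esub> inverse_of B (Ass B a b (c \<otimes>\<^bsub>B\<^esub> d))"

definition smf_tensor :: "('oa, 'ma, 'ob, 'mb) smf \<Rightarrow> ('oa, 'ma, 'ob, 'mb) smf
    \<Rightarrow> ('oa, 'ma, 'ob, 'mb) smf" where
  "smf_tensor F G = (let A = fdom F; B = fcod F in
    \<lparr>fdom = A, fcod = B,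
     fob = (\<lambda>a\<in>Ob A. fob F a \<otimes>\<^bsub>B\<^esub> fob G a),
     far = (\<lambda>f\<in>Ar A. far F f \<odot>\<^bsub>B\<^esub> far G f),
     fun0 = (fun0 F \<odot>\<^bsub>B\<^esub> fun0 G) \<cdot>\<^bsub>B\<^esub> inverse_of B (Rgt B (Unt B)),
     fun2 = (\<lambda>a\<in>Ob A. \<lambda>b\<in>Ob A.
       (fun2 F a b \<odot>\<^bsub>B\<^esub> fun2 G a b) \<cdot>\<^bsub>B\<^esub> middle4 B (fob F a) (fob G a) (fob F b) (fob G b))\<rparr>)"

definition mnt_tensor :: "('oa, 'ma, 'ob, 'mb) mnt \<Rightarrow> ('oa, 'ma, 'ob, 'mb) mnt
    \<Rightarrow> ('oa, 'ma, 'ob, 'mb) mnt" where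
  "mnt_tensor \<sigma> \<tau> =
    \<lparr>ndom = smf_tensor (ndom \<sigma>) (ndom \<tau>), ncod = smf_tensor (ncod \<sigma>) (ncod \<tau>),
     ncomp = (\<lambda>a\<in>Ob (fdom (ndom \<sigma>)). ncomp \<sigma> a \<odot>\<^bsub>fcod (ndom \<sigma>)\<^esub> ncomp \<tau> a)\<rparr>"

text \<open>The canonical arrow \<open>I \<otimes> I \<rightarrow> I\<close> is \<open>r\<^sub>I\<close>, which equals \<open>l\<^sub>I\<close>.\<close>

definition smf_const :: "('oa, 'ma) smc \<Rightarrow> ('ob, 'mb) smc \<Rightarrow> ('oa, 'ma, 'ob, 'mb) smf" where
  "smf_const A B =
    \<lparr>fdom = A, fcod = B, fob = (\<lambda>a\<in>Ob A. Unt B), far = (\<lambda>f\<in>Ar A. Idn B (Unt B)),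
     fun0 = Idn B (Unt B), fun2 = (\<lambda>a\<in>Ob A. \<lambda>b\<in>Ob A. Rgt B (Unt B))\<rparr>"

definition hom_smc :: "('oa, 'ma) smc \<Rightarrow> ('ob, 'mb) smc
    \<Rightarrow> (('oa, 'ma, 'ob, 'mb) smf, ('oa, 'ma, 'ob, 'mb) mnt) smc" ("\<lbrakk>_, _\<rbrakk>\<^sub>0") where
  "\<lbrakk>A, B\<rbrakk>\<^sub>0 =
    \<lparr>Ob = {F. sym_mon_functor F \<and> fdom F = A \<and> fcod F = B},
     Ar = {\<sigma>. mon_nat_trans \<sigma> \<and> fdom (ndom \<sigma>) = A \<and> fcod (ndom \<sigma>) = B},
     Dom = ndom,
     Cod = ncod,
     Idn = mnt_id,
     Cmp = mnt_vcomp,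
     TOb = smf_tensor,
     TAr = mnt_tensor,
     Unt = smf_const A B,
     Ass = (\<lambda>F G H. \<lparr>ndom = smf_tensor F (smf_tensor G H), ncod = smf_tensor (smf_tensor F G) H,
                      ncomp = (\<lambda>a\<in>Ob A. Ass B (fob F a) (fob G a) (fob H a))\<rparr>),
     Rgt = (\<lambda>F. \<lparr>ndom = smf_tensor F (smf_const A B), ncod = F,
                  ncomp = (\<lambda>a\<in>Ob A. Rgt B (fob F a))\<rparr>),
     Lft = (\<lambda>F. \<lparr>ndom = smf_tensor (smf_const A B) F, ncod = F,
                  ncomp = (\<lambda>a\<in>Ob A. Lft B (fob F a))\<rparr>),
     Sym = (\<lambda>F G. \<lparr>ndom = smf_tensor F G, ncod = smf_tensor G F,
                    ncomp = (\<lambda>a\<in>Ob A. Sym B (fob F a) (fob G a))\<rparr>)\<rparr>"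

text \<open>\<open>\<lbrakk>F, G\<rbrakk>\<^sub>1 : [\<A>,\<B>] \<rightarrow> [\<C>,\<D>]\<close> for \<open>F : \<C> \<rightarrow> \<A>\<close> and \<open>G : \<B> \<rightarrow> \<D>\<close>.\<close>

definition hom_smf :: "('oc, 'mc, 'oa, 'ma) smf \<Rightarrow> ('ob, 'mb, 'od, 'md) smf
    \<Rightarrow> (('oa, 'ma, 'ob, 'mb) smf, ('oa, 'ma, 'ob, 'mb) mnt,
        ('oc, 'mc, 'od, 'md) smf, ('oc, 'mc, 'od, 'md) mnt) smf" ("\<lbrakk>_, _\<rbrakk>\<^sub>1") where
  "\<lbrakk>F, G\<rbrakk>\<^sub>1 = (let A = fcod F; B = fdom G; C = fdom F; D = fcod G in
    \<lparr>fdom = \<lbrakk>A, B\<rbrakk>\<^sub>0, fcod = \<lbrakk>C, D\<rbrakk>\<^sub>0,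
     fob = (\<lambda>H\<in>Ob \<lbrakk>A, B\<rbrakk>\<^sub>0. G \<circ>\<^sub>F H \<circ>\<^sub>F F),
     far = (\<lambda>\<theta>\<in>Ar \<lbrakk>A, B\<rbrakk>\<^sub>0. mnt_id G *\<^sub>h \<theta> *\<^sub>h mnt_id F),
     fun0 = \<lparr>ndom = smf_const C D, ncod = G \<circ>\<^sub>F smf_const A B \<circ>\<^sub>F F,
             ncomp = (\<lambda>c\<in>Ob C. fun0 G)\<rparr>,
     fun2 = (\<lambda>H\<in>Ob \<lbrakk>A, B\<rbrakk>\<^sub>0. \<lambda>K\<in>Ob \<lbrakk>A, B\<rbrakk>\<^sub>0.
       \<lparr>ndom = smf_tensor (G \<circ>\<^sub>F H \<circ>\<^sub>F F) (G \<circ>\<^sub>F K \<circ>\<^sub>F F), ncod = G \<circ>\<^sub>F smf_tensor H K \<circ>\<^sub>F F,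
        ncomp = (\<lambda>c\<in>Ob C. fun2 G (fob H (fob F c)) (fob K (fob F c)))\<rparr>)\<rparr>)"

definition hom_mnt :: "('oc, 'mc, 'oa, 'ma) mnt \<Rightarrow> ('ob, 'mb, 'od, 'md) mnt
    \<Rightarrow> (('oa, 'ma, 'ob, 'mb) smf, ('oa, 'ma, 'ob, 'mb) mnt,
        ('oc, 'mc, 'od, 'md) smf, ('oc, 'mc, 'od, 'md) mnt) mnt" ("\<lbrakk>_, _\<rbrakk>\<^sub>2") where
  "\<lbrakk>\<sigma>, \<tau>\<rbrakk>\<^sub>2 =
    \<lparr>ndom = \<lbrakk>ndom \<sigma>, ndom \<tau>\<rbrakk>\<^sub>1, ncod = \<lbrakk>ncod \<sigma>, ncod \<tau>\<rbrakk>\<^sub>1,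
     ncomp = (\<lambda>H\<in>Ob \<lbrakk>fcod (ndom \<sigma>), fdom (ndom \<tau>)\<rbrakk>\<^sub>0. \<tau> *\<^sub>h mnt_id H *\<^sub>h \<sigma>)\<rparr>"

text \<open>The 2-functors \<open>(\<A>,\<B>,\<C>) \<mapsto> [\<A>,[\<B>,\<C>]]\<close> and \<open>(\<A>,\<B>,\<C>) \<mapsto> [\<B>,[\<A>,\<C>]]\<close>.\<close>

definition hom_ABC where
  "hom_ABC =
    \<lparr>on0 = (\<lambda>(A, B, C). \<lbrakk>A, \<lbrakk>B, C\<rbrakk>\<^sub>0\<rbrakk>\<^sub>0),
     on1 = (\<lambda>(F, G, H). \<lbrakk>F, \<lbrakk>G, H\<rbrakk>\<^sub>1\<rbrakk>\<^sub>1),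
     on2 = (\<lambda>(\<rho>, \<sigma>, \<tau>). \<lbrakk>\<rho>, \<lbrakk>\<sigma>, \<tau>\<rbrakk>\<^sub>2\<rbrakk>\<^sub>2)\<rparr>"

definition hom_BAC where
  "hom_BAC =
    \<lparr>on0 = (\<lambda>(A, B, C). \<lbrakk>B, \<lbrakk>A, C\<rbrakk>\<^sub>0\<rbrakk>\<^sub>0),
     on1 = (\<lambda>(F, G, H). \<lbrakk>G, \<lbrakk>F, H\<rbrakk>\<^sub>1\<rbrakk>\<^sub>1),
     on2 = (\<lambda>(\<rho>, \<sigma>, \<tau>). \<lbrakk>\<sigma>, \<lbrakk>\<rho>, \<tau>\<rbrakk>\<^sub>2\<rbrakk>\<^sub>2)\<rparr>"

section \<open>Duality\<close>

definition dual_ob :: "('oa, 'ma) smc \<Rightarrow> ('oc, 'mc) smc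
    \<Rightarrow> ('oa, 'ma, ('ob, 'mb, 'oc, 'mc) smf, ('ob, 'mb, 'oc, 'mc) mnt) smf
    \<Rightarrow> 'ob \<Rightarrow> ('oa, 'ma, 'oc, 'mc) smf" where
  "dual_ob A C F b =
    \<lparr>fdom = A, fcod = C,
     fob = (\<lambda>a\<in>Ob A. fob (fob F a) b),
     far = (\<lambda>f\<in>Ar A. ncomp (far F f) b),
     fun0 = ncomp (fun0 F) b,
     fun2 = (\<lambda>a\<in>Ob A. \<lambda>a'\<in>Ob A. ncomp (fun2 F a a') b)\<rparr>"

definition dual_smf :: "('oa, 'ma) smc \<Rightarrow> ('ob, 'mb) smc \<Rightarrow> ('oc, 'mc) smc
    \<Rightarrow> ('oa, 'ma, ('ob, 'mb, 'oc, 'mc) smf, ('ob, 'mb, 'oc, 'mc) mnt) smf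
    \<Rightarrow> ('ob, 'mb, ('oa, 'ma, 'oc, 'mc) smf, ('oa, 'ma, 'oc, 'mc) mnt) smf" where
  "dual_smf A B C F =
    \<lparr>fdom = B, fcod = \<lbrakk>A, C\<rbrakk>\<^sub>0,
     fob = (\<lambda>b\<in>Ob B. dual_ob A C F b),
     far = (\<lambda>g\<in>Ar B. \<lparr>ndom = dual_ob A C F (Dom B g), ncod = dual_ob A C F (Cod B g),
                       ncomp = (\<lambda>a\<in>Ob A. far (fob F a) g)\<rparr>),
     fun0 = \<lparr>ndom = smf_const A C, ncod = dual_ob A C F (Unt B),
             ncomp = (\<lambda>a\<in>Ob A. fun0 (fob F a))\<rparr>,
     fun2 = (\<lambda>b\<in>Ob B. \<lambda>b'\<in>Ob B.
       \<lparr>ndom = smf_tensor (dual_ob A C F b) (dual_ob A C F b'), ncod = dual_ob A C F (b \<otimes>\<^bsub>B\<^esub> b'),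
        ncomp = (\<lambda>a\<in>Ob A. fun2 (fob F a) b b')\<rparr>)\<rparr>"

definition dual_mnt :: "('oa, 'ma) smc \<Rightarrow> ('ob, 'mb) smc \<Rightarrow> ('oc, 'mc) smc
    \<Rightarrow> ('oa, 'ma, ('ob, 'mb, 'oc, 'mc) smf, ('ob, 'mb, 'oc, 'mc) mnt) mnt
    \<Rightarrow> ('ob, 'mb, ('oa, 'ma, 'oc, 'mc) smf, ('oa, 'ma, 'oc, 'mc) mnt) mnt" where
  "dual_mnt A B C \<theta> =
    \<lparr>ndom = dual_smf A B C (ndom \<theta>), ncod = dual_smf A B C (ncod \<theta>),
     ncomp = (\<lambda>b\<in>Ob B.
       \<lparr>ndom = dual_ob A C (ndom \<theta>) b, ncod = dual_ob A C (ncod \<theta>) b,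
        ncomp = (\<lambda>a\<in>Ob A. ncomp (ncomp \<theta> a) b)\<rparr>)\<rparr>"

text \<open>\<open>D\<close> is strict: \<open>F\<^sup>0\<close> and \<open>F\<^sup>2\<close> are identities.\<close>

definition D :: "('oa, 'ma) smc \<Rightarrow> ('ob, 'mb) smc \<Rightarrow> ('oc, 'mc) smc
    \<Rightarrow> (('oa, 'ma, ('ob, 'mb, 'oc, 'mc) smf, ('ob, 'mb, 'oc, 'mc) mnt) smf,
        ('oa, 'ma, ('ob, 'mb, 'oc, 'mc) smf, ('ob, 'mb, 'oc, 'mc) mnt) mnt,
        ('ob, 'mb, ('oa, 'ma, 'oc, 'mc) smf, ('oa, 'ma, 'oc, 'mc) mnt) smf,
        ('ob, 'mb, ('oa, 'ma, 'oc, 'mc) smf, ('oa, 'ma, 'oc, 'mc) mnt) mnt) smf" where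
  "D A B C =
    \<lparr>fdom = \<lbrakk>A, \<lbrakk>B, C\<rbrakk>\<^sub>0\<rbrakk>\<^sub>0, fcod = \<lbrakk>B, \<lbrakk>A, C\<rbrakk>\<^sub>0\<rbrakk>\<^sub>0,
     fob = (\<lambda>F\<in>Ob \<lbrakk>A, \<lbrakk>B, C\<rbrakk>\<^sub>0\<rbrakk>\<^sub>0. dual_smf A B C F),
     far = (\<lambda>\<theta>\<in>Ar \<lbrakk>A, \<lbrakk>B, C\<rbrakk>\<^sub>0\<rbrakk>\<^sub>0. dual_mnt A B C \<theta>),
     fun0 = mnt_id (smf_const B \<lbrakk>A, C\<rbrakk>\<^sub>0),
     fun2 = (\<lambda>F\<in>Ob \<lbrakk>A, \<lbrakk>B, C\<rbrakk>\<^sub>0\<rbrakk>\<^sub>0. \<lambda>G\<in>Ob \<lbrakk>A, \<lbrakk>B, C\<rbrakk>\<^sub>0\<rbrakk>\<^sub>0.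
       mnt_id (smf_tensor (dual_smf A B C F) (dual_smf A B C G)))\<rparr>"

end

theory Submission
  imports Defs
begin

text \<open>
  A functor \<open>F : A \<rightarrow> [B, C]\<close> is a functor of two variables that is symmetric monoidal in each of
  them.  Its data are \<open>F a b\<close>, its values on arrows of either variable, and two families of unit
  and multiplication arrows, \<open>(F\<^sup>0)\<^sub>b\<close>, \<open>(F\<^sup>2)\<^sub>b\<close> in the first variable and \<open>(F a)\<^sup>0\<close>, \<open>(F a)\<^sup>2\<close> in
  the second.  The axioms say that each variable satisfies the functor axioms while the other is
  fixed, and that the arrows belonging to one variable are natural and monoidal in the other.
  This list of axioms is symmetric in the two variables, with one subtlety: the axiom relating the
  two multiplications contains a middle-four interchange
  \<open>(a \<otimes> b) \<otimes> (c \<otimes> d) \<rightarrow> (a \<otimes> c) \<otimes> (b \<otimes> d)\<close> on one side, and exchanging the variables moves it to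
  the other side.  The interchange is an involution, so this changes nothing (\<open>dual_fun2_in\<close>).
  Hence \<open>F\<^sup>*\<close> is well defined and dualising is involutive.  It is strict since the structure of
  both iterated homs is pointwise in both variables (\<open>dual_const\<close>, \<open>dual_tensor\<close>), and natural
  since \<open>[F, [G, H]]\<close> acts on the three arguments separately.  At 2-cells, naturality is the
  naturality of the transformation \<open>K \<rho>\<^sub>a\<close> (\<open>D_natural2\<close>).

  The greater part of the work is to see that the internal hom is a symmetric monoidal category
  and a 2-functor at all.  Everything there is computed pointwise, and the axioms that are not
  immediate say that the tensor product of the codomain is itself a symmetric monoidal functor,
  with associativity, units and symmetry as monoidal transformations.  These are the coherence
  laws of the middle-four interchange (\<open>mid_assoc\<close>, \<open>mid_Sym\<close>, \<open>mid_Rgt\<close>, \<open>mid_Lft\<close> and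
  their inverted forms).  They are proved by writing the interchange as a transposition
  \<open>b \<otimes> (c \<otimes> d) \<rightarrow> c \<otimes> (b \<otimes> d)\<close> on right-bracketed products, where pentagon and hexagon become rules
  for moving one factor past a product.  The action \<open>[F, G]\<close> of a pair of functors requires in
  addition that a lax symmetric monoidal functor preserves the interchange (\<open>fun2_mid\<close>).
\<close>

section \<open>Calculating in a symmetric monoidal category\<close>

lemma Hom_iff: "f \<in> Hom C a b \<longleftrightarrow> f \<in> Ar C \<and> Dom C f = a \<and> Cod C f = b"
  by (auto simp: Hom_def)

context category
begin

lemma Dom_in [simp]: "f \<in> Ar C \<Longrightarrow> Dom C f \<in> Ob C"
  and Cod_in [simp]: "f \<in> Ar C \<Longrightarrow> Cod C f \<in> Ob C"
  by (simp_all add: Dom_Ob Cod_Ob)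

lemma Idn_typing [simp]:
  assumes "a \<in> Ob C"
  shows "Idn C a \<in> Ar C" "Dom C (Idn C a) = a" "Cod C (Idn C a) = a"
  using Idn_Hom[OF assms] by (simp_all add: Hom_iff)

lemma Cmp_typing [simp]:
  assumes "g \<in> Ar C" "f \<in> Ar C" "Dom C g = Cod C f"
  shows "g \<cdot> f \<in> Ar C" "Dom C (g \<cdot> f) = Dom C f" "Cod C (g \<cdot> f) = Cod C g"
  using Cmp_Hom[of f "Dom C f" "Cod C f" g "Cod C g"] assms by (simp_all add: Hom_iff)

lemma Cmp_Idn' [simp]: "\<lbrakk>f \<in> Ar C; Dom C f = a\<rbrakk> \<Longrightarrow> f \<cdot> Idn C a = f"
  and Idn_Cmp' [simp]: "\<lbrakk>f \<in> Ar C; Cod C f = b\<rbrakk> \<Longrightarrow> Idn C b \<cdot> f = f"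
  by (auto intro!: Cmp_Idn Idn_Cmp simp: Hom_iff)

lemma assoc [simp]:
  "\<lbrakk>h \<in> Ar C; g \<in> Ar C; f \<in> Ar C; Dom C h = Cod C g; Dom C g = Cod C f\<rbrakk>
   \<Longrightarrow> (h \<cdot> g) \<cdot> f = h \<cdot> (g \<cdot> f)"
  by (rule Cmp_assoc[of f "Dom C f" "Cod C f" g "Cod C g" h "Cod C h"]) (simp_all add: Hom_iff)

text \<open>Composites are kept bracketed to the right, so an equation between two-fold composites is
  applied inside a longer composite in this form.\<close>

lemma reassoc:
  assumes "u \<cdot> v = w" "u \<in> Ar C" "v \<in> Ar C" "x \<in> Ar C" "Dom C u = Cod C v" "Dom C v = Cod C x"
  shows "u \<cdot> (v \<cdot> x) = w \<cdot> x"
  using assoc[of u v x] assms by simp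

lemma reassoc2:
  assumes "u \<cdot> v = w \<cdot> z" "u \<in> Ar C" "v \<in> Ar C" "w \<in> Ar C" "z \<in> Ar C" "x \<in> Ar C"
    "Dom C u = Cod C v" "Dom C w = Cod C z" "Dom C v = Cod C x" "Dom C z = Cod C x"
  shows "u \<cdot> (v \<cdot> x) = w \<cdot> (z \<cdot> x)"
  using assoc[of u v x] assoc[of w z x] assms by simp

lemma inverse_arrows_unique:
  assumes "inverse_arrows C f g" "inverse_arrows C f h"
  shows "g = h"
proof -
  have "(g \<cdot> f) \<cdot> h = g \<cdot> (f \<cdot> h)"
    using assms by (intro assoc) (simp_all add: inverse_arrows_def Hom_iff)
  then show ?thesis using assms by (simp add: inverse_arrows_def Hom_iff)
qed

lemma inverse_of_eq: "inverse_arrows C f g \<Longrightarrow> inverse_of C f = g"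
  unfolding inverse_of_def by (rule the_equality) (auto intro: inverse_arrows_unique)

lemma inverse_of_inverse_arrows: "is_iso C f \<Longrightarrow> inverse_arrows C f (inverse_of C f)"
  unfolding is_iso_def using inverse_of_eq by auto

lemma inverse_of [simp]:
  assumes "is_iso C f"
  shows "inverse_of C f \<in> Ar C" "Dom C (inverse_of C f) = Cod C f"
    "Cod C (inverse_of C f) = Dom C f" "inverse_of C f \<cdot> f = Idn C (Dom C f)"
    "f \<cdot> inverse_of C f = Idn C (Cod C f)"
  using inverse_of_inverse_arrows[OF assms] by (simp_all add: inverse_arrows_def Hom_iff)

lemma iso_Ar: "is_iso C f \<Longrightarrow> f \<in> Ar C"
  by (auto simp: is_iso_def inverse_arrows_def)

lemma inverse_of_cancel [simp]:
  assumes "is_iso C f" "x \<in> Ar C"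
  shows "Cod C x = Dom C f \<Longrightarrow> inverse_of C f \<cdot> (f \<cdot> x) = x"
    and "Cod C x = Cod C f \<Longrightarrow> f \<cdot> (inverse_of C f \<cdot> x) = x"
  using assms iso_Ar[OF assms(1)]
    reassoc[OF inverse_of(4)[OF assms(1)], of x] reassoc[OF inverse_of(5)[OF assms(1)], of x]
  by simp_all

lemma iso_epi:
  assumes "is_iso C e" "g \<cdot> e = h \<cdot> e" "g \<in> Ar C" "h \<in> Ar C" "Dom C g = Cod C e" "Dom C h = Cod C e"
  shows "g = h"
proof -
  have "(g \<cdot> e) \<cdot> inverse_of C e = (h \<cdot> e) \<cdot> inverse_of C e" using assms(2) by simp
  then show ?thesis using assms(1,3-) iso_Ar[OF assms(1)] by simp
qed

lemma iso_mono:
  assumes "is_iso C e" "e \<cdot> g = e \<cdot> h" "g \<in> Ar C" "h \<in> Ar C" "Cod C g = Dom C e" "Cod C h = Dom C e"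
  shows "g = h"
proof -
  have "inverse_of C e \<cdot> (e \<cdot> g) = inverse_of C e \<cdot> (e \<cdot> h)" using assms(2) by simp
  then show ?thesis using assms(1,3-) iso_Ar[OF assms(1)] by simp
qed

lemma isoI:
  assumes "f \<in> Ar C" "g \<in> Ar C" "Dom C g = Cod C f" "Cod C g = Dom C f"
    "g \<cdot> f = Idn C (Dom C f)" "f \<cdot> g = Idn C (Cod C f)"
  shows "is_iso C f" "inverse_of C f = g"
proof -
  have "inverse_arrows C f g" using assms by (simp add: inverse_arrows_def Hom_iff)
  then show "is_iso C f" "inverse_of C f = g" by (auto simp: is_iso_def intro: inverse_of_eq)
qed

lemma iso_Cmp:
  assumes "is_iso C f" "is_iso C g" "Dom C g = Cod C f"
  shows "is_iso C (g \<cdot> f)"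
  using assms iso_Ar[OF assms(1)] iso_Ar[OF assms(2)]
  by (intro isoI(1)[of _ "inverse_of C f \<cdot> inverse_of C g"]) simp_all

text \<open>Applied to a naturality square, this is naturality of the componentwise inverse; applied to a
  coherence law, it moves the interchanges to the other side.\<close>

lemma move_inverses:
  assumes "u \<cdot> p = q \<cdot> v" "is_iso C p" "is_iso C q"
    "u \<in> Ar C" "v \<in> Ar C" "Dom C u = Cod C p" "Cod C v = Dom C q"
    "Dom C v = Dom C p" "Cod C u = Cod C q"
  shows "inverse_of C q \<cdot> u = v \<cdot> inverse_of C p"
proof -
  have pq: "p \<in> Ar C" "q \<in> Ar C" using assms iso_Ar by auto
  have "inverse_of C q \<cdot> u = inverse_of C q \<cdot> (u \<cdot> p) \<cdot> inverse_of C p"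
    using assms(2-) pq by simp
  also have "\<dots> = inverse_of C q \<cdot> (q \<cdot> v) \<cdot> inverse_of C p" by (simp only: assms(1))
  also have "\<dots> = v \<cdot> inverse_of C p" using assms(2-) pq by simp
  finally show ?thesis .
qed

end

context sym_mon_category
begin

lemma TOb_in [simp]: "\<lbrakk>a \<in> Ob C; b \<in> Ob C\<rbrakk> \<Longrightarrow> a \<otimes> b \<in> Ob C"
  and Unt_in [simp]: "Unt C \<in> Ob C"
  by (simp_all add: TOb_Ob Unt_Ob)

lemma TAr_typing [simp]:
  assumes "f \<in> Ar C" "g \<in> Ar C"
  shows "f \<odot> g \<in> Ar C" "Dom C (f \<odot> g) = Dom C f \<otimes> Dom C g" "Cod C (f \<odot> g) = Cod C f \<otimes> Cod C g"
  using TAr_Hom[of f "Dom C f" "Cod C f" g "Dom C g" "Cod C g"] assms by (simp_all add: Hom_iff)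

lemma TAr_Idn' [simp]: "\<lbrakk>a \<in> Ob C; b \<in> Ob C\<rbrakk> \<Longrightarrow> Idn C a \<odot> Idn C b = Idn C (a \<otimes> b)"
  by (rule TAr_Idn)

lemma interchange:
  assumes "f' \<in> Ar C" "f \<in> Ar C" "g' \<in> Ar C" "g \<in> Ar C" "Dom C f' = Cod C f" "Dom C g' = Cod C g"
  shows "(f' \<odot> g') \<cdot> (f \<odot> g) = (f' \<cdot> f) \<odot> (g' \<cdot> g)"
  using TAr_Cmp[of f "Dom C f" "Cod C f" f' "Cod C f'" g "Dom C g" "Cod C g" g' "Cod C g'"] assms
  by (simp add: Hom_iff)

lemmas interchange' = interchange[THEN reassoc]

lemma Ass_typing [simp]:
  assumes "a \<in> Ob C" "b \<in> Ob C" "c \<in> Ob C"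
  shows "Ass C a b c \<in> Ar C" "Dom C (Ass C a b c) = a \<otimes> (b \<otimes> c)" "Cod C (Ass C a b c) = (a \<otimes> b) \<otimes> c"
    "is_iso C (Ass C a b c)"
  using Ass_Hom[OF assms] Ass_iso[OF assms] by (simp_all add: Hom_iff)

lemma Rgt_typing [simp]:
  assumes "a \<in> Ob C"
  shows "Rgt C a \<in> Ar C" "Dom C (Rgt C a) = a \<otimes> Unt C" "Cod C (Rgt C a) = a" "is_iso C (Rgt C a)"
  using Rgt_Hom[OF assms] Rgt_iso[OF assms] by (simp_all add: Hom_iff)

lemma Lft_typing [simp]:
  assumes "a \<in> Ob C"
  shows "Lft C a \<in> Ar C" "Dom C (Lft C a) = Unt C \<otimes> a" "Cod C (Lft C a) = a" "is_iso C (Lft C a)"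
  using Lft_Hom[OF assms] Lft_iso[OF assms] by (simp_all add: Hom_iff)

lemma Sym_typing [simp]:
  assumes "a \<in> Ob C" "b \<in> Ob C"
  shows "Sym C a b \<in> Ar C" "Dom C (Sym C a b) = a \<otimes> b" "Cod C (Sym C a b) = b \<otimes> a"
  using Sym_Hom[OF assms] by (simp_all add: Hom_iff)

lemma Ass_natural:
  assumes "f \<in> Ar C" "g \<in> Ar C" "h \<in> Ar C" "Cod C f = a" "Cod C g = b" "Cod C h = c"
  shows "Ass C a b c \<cdot> (f \<odot> (g \<odot> h)) = ((f \<odot> g) \<odot> h) \<cdot> Ass C (Dom C f) (Dom C g) (Dom C h)"
  using Ass_nat[of f "Dom C f" a g "Dom C g" b h "Dom C h" c] assms by (simp add: Hom_iff)

lemma Rgt_natural: "\<lbrakk>f \<in> Ar C; Cod C f = b\<rbrakk> \<Longrightarrow> Rgt C b \<cdot> (f \<odot> Idn C (Unt C)) = f \<cdot> Rgt C (Dom C f)"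
  and Lft_natural: "\<lbrakk>f \<in> Ar C; Cod C f = b\<rbrakk> \<Longrightarrow> Lft C b \<cdot> (Idn C (Unt C) \<odot> f) = f \<cdot> Lft C (Dom C f)"
  by (auto intro!: Rgt_nat Lft_nat simp: Hom_iff)

lemma Sym_natural:
  assumes "f \<in> Ar C" "g \<in> Ar C" "Cod C f = a" "Cod C g = b"
  shows "Sym C a b \<cdot> (f \<odot> g) = (g \<odot> f) \<cdot> Sym C (Dom C f) (Dom C g)"
  using Sym_nat[of f "Dom C f" a g "Dom C g" b] assms by (simp add: Hom_iff)

lemmas Sym_Sym' [simp] = Sym_Sym Sym_Sym[THEN reassoc]

lemma iso_TAr [simp]:
  assumes "is_iso C f" "is_iso C g"
  shows "is_iso C (f \<odot> g)"
    and inverse_of_TAr: "inverse_of C (f \<odot> g) = inverse_of C f \<odot> inverse_of C g"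
  using isoI[of "f \<odot> g" "inverse_of C f \<odot> inverse_of C g"] assms iso_Ar[OF assms(1)] iso_Ar[OF assms(2)]
  by (simp_all add: interchange)

lemma iso_Idn [simp]: "a \<in> Ob C \<Longrightarrow> is_iso C (Idn C a)"
  by (rule isoI(1)[of _ "Idn C a"]) simp_all

lemma whisker_left:
  "\<lbrakk>a \<in> Ob C; g \<in> Ar C; f \<in> Ar C; Dom C g = Cod C f\<rbrakk>
   \<Longrightarrow> (Idn C a \<odot> g) \<cdot> (Idn C a \<odot> f) = Idn C a \<odot> (g \<cdot> f)"
  and whisker_right:
  "\<lbrakk>a \<in> Ob C; g \<in> Ar C; f \<in> Ar C; Dom C g = Cod C f\<rbrakk>
   \<Longrightarrow> (g \<odot> Idn C a) \<cdot> (f \<odot> Idn C a) = (g \<cdot> f) \<odot> Idn C a"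
  by (simp_all add: interchange)

lemmas whiskers = whisker_left whisker_right whisker_left[THEN reassoc] whisker_right[THEN reassoc]

text \<open>Naturality of associativity in one variable at a time, with the identities on the other
  two variables merged.\<close>

lemma Ass_natural1:
  "\<lbrakk>f \<in> Ar C; b \<in> Ob C; c \<in> Ob C; Cod C f = a\<rbrakk>
   \<Longrightarrow> Ass C a b c \<cdot> (f \<odot> Idn C (b \<otimes> c)) = ((f \<odot> Idn C b) \<odot> Idn C c) \<cdot> Ass C (Dom C f) b c"
  using Ass_natural[of f "Idn C b" "Idn C c" a b c] by simp

lemma Ass_natural3:
  "\<lbrakk>f \<in> Ar C; a \<in> Ob C; b \<in> Ob C; Cod C f = c\<rbrakk>
   \<Longrightarrow> Ass C a b c \<cdot> (Idn C a \<odot> (Idn C b \<odot> f)) = (Idn C (a \<otimes> b) \<odot> f) \<cdot> Ass C a b (Dom C f)"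
  using Ass_natural[of "Idn C a" "Idn C b" f a b c] by simp

lemma Ass_natural2:
  "\<lbrakk>f \<in> Ar C; a \<in> Ob C; c \<in> Ob C; Cod C f = b\<rbrakk>
   \<Longrightarrow> Ass C a b c \<cdot> (Idn C a \<odot> (f \<odot> Idn C c)) = ((Idn C a \<odot> f) \<odot> Idn C c) \<cdot> Ass C a (Dom C f) c"
  using Ass_natural[of "Idn C a" f "Idn C c" a b c] by simp

section \<open>Exchanging neighbouring factors\<close>

text \<open>The transposition \<open>b \<otimes> (c \<otimes> d) \<rightarrow> c \<otimes> (b \<otimes> d)\<close> in front of a further factor: the symmetry as
  a transformation between the composites of \<open>b \<otimes> -\<close> and \<open>c \<otimes> -\<close>.  Endofunctors compose strictly,
  so calculations with transpositions avoid most of the bracketing.\<close>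

definition exch where
  "exch b c d = inverse_of C (Ass C c b d) \<cdot> (Sym C b c \<odot> Idn C d) \<cdot> Ass C b c d"

lemma exch_typing [simp]:
  assumes "b \<in> Ob C" "c \<in> Ob C" "d \<in> Ob C"
  shows "exch b c d \<in> Ar C" "Dom C (exch b c d) = b \<otimes> (c \<otimes> d)" "Cod C (exch b c d) = c \<otimes> (b \<otimes> d)"
  using assms by (simp_all add: exch_def)

lemma Ass_exch:
  assumes "b \<in> Ob C" "c \<in> Ob C" "d \<in> Ob C"
  shows "Ass C c b d \<cdot> exch b c d = (Sym C b c \<odot> Idn C d) \<cdot> Ass C b c d"
  using assms by (simp add: exch_def)

lemma exch_exch:
  assumes "b \<in> Ob C" "c \<in> Ob C" "d \<in> Ob C"
  shows "exch c b d \<cdot> exch b c d = Idn C (b \<otimes> (c \<otimes> d))"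
  using assms by (simp add: exch_def whiskers)

lemma exch_natural:
  assumes "f \<in> Ar C" "g \<in> Ar C" "h \<in> Ar C" "Cod C f = b" "Cod C g = c" "Cod C h = d"
  shows "exch b c d \<cdot> (f \<odot> (g \<odot> h)) = (g \<odot> (f \<odot> h)) \<cdot> exch (Dom C f) (Dom C g) (Dom C h)"
proof (rule iso_mono[of "Ass C c b d"])
  have ob: "b \<in> Ob C" "c \<in> Ob C" "d \<in> Ob C" using assms Cod_in by auto
  have "Ass C c b d \<cdot> exch b c d \<cdot> (f \<odot> (g \<odot> h))
      = (Sym C b c \<odot> Idn C d) \<cdot> ((f \<odot> g) \<odot> h) \<cdot> Ass C (Dom C f) (Dom C g) (Dom C h)"
    using assms ob by (simp add: Ass_natural exch_def)
  also have "\<dots> = ((g \<odot> f) \<odot> h) \<cdot> (Sym C (Dom C f) (Dom C g) \<odot> Idn C (Dom C h))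
      \<cdot> Ass C (Dom C f) (Dom C g) (Dom C h)"
    using assms ob by (simp add: interchange interchange' Sym_natural)
  also have "\<dots> = Ass C c b d \<cdot> (g \<odot> (f \<odot> h)) \<cdot> exch (Dom C f) (Dom C g) (Dom C h)"
    using assms ob by (simp add: Ass_natural[THEN reassoc] exch_def)
  finally show "Ass C c b d \<cdot> exch b c d \<cdot> (f \<odot> (g \<odot> h))
      = Ass C c b d \<cdot> (g \<odot> (f \<odot> h)) \<cdot> exch (Dom C f) (Dom C g) (Dom C h)" .
qed (use assms Cod_in in auto)

text \<open>By two pentagons, a transposition is insensitive to the bracketing of the factors behind it.\<close>

lemma exch_Ass:
  assumes "b \<in> Ob C" "c \<in> Ob C" "d \<in> Ob C" "e \<in> Ob C"
  shows "(exch b c d \<odot> Idn C e) \<cdot> Ass C b (c \<otimes> d) e \<cdot> (Idn C b \<odot> Ass C c d e)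
       = Ass C c (b \<otimes> d) e \<cdot> (Idn C c \<odot> Ass C b d e) \<cdot> exch b c (d \<otimes> e)"
proof (rule iso_mono[of "Ass C c b d \<odot> Idn C e"])
  have "(Ass C c b d \<odot> Idn C e) \<cdot> (exch b c d \<odot> Idn C e) \<cdot> Ass C b (c \<otimes> d) e \<cdot> (Idn C b \<odot> Ass C c d e)
      = ((Sym C b c \<odot> Idn C d) \<odot> Idn C e) \<cdot> (Ass C b c d \<odot> Idn C e) \<cdot> Ass C b (c \<otimes> d) e \<cdot> (Idn C b \<odot> Ass C c d e)"
    using assms by (simp add: whiskers Ass_exch)
  also have "\<dots> = ((Sym C b c \<odot> Idn C d) \<odot> Idn C e) \<cdot> Ass C (b \<otimes> c) d e \<cdot> Ass C b c (d \<otimes> e)"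
    using assms by (simp add: pentagon)
  also have "\<dots> = Ass C (c \<otimes> b) d e \<cdot> Ass C c b (d \<otimes> e) \<cdot> exch b c (d \<otimes> e)"
    using assms by (simp add: Ass_exch Ass_natural1[THEN reassoc])
  also have "\<dots> = (Ass C c b d \<odot> Idn C e) \<cdot> Ass C c (b \<otimes> d) e \<cdot> (Idn C c \<odot> Ass C b d e) \<cdot> exch b c (d \<otimes> e)"
    using assms by (simp add: pentagon[THEN reassoc])
  finally show "(Ass C c b d \<odot> Idn C e) \<cdot> (exch b c d \<odot> Idn C e) \<cdot> Ass C b (c \<otimes> d) e \<cdot> (Idn C b \<odot> Ass C c d e)
      = (Ass C c b d \<odot> Idn C e) \<cdot> Ass C c (b \<otimes> d) e \<cdot> (Idn C c \<odot> Ass C b d e) \<cdot> exch b c (d \<otimes> e)" .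
qed (use assms in simp_all)

text \<open>The hexagon, read as the rule for moving a tensor product past one factor.\<close>

lemma exch_TOb_left:
  assumes "a \<in> Ob C" "b \<in> Ob C" "c \<in> Ob C" "d \<in> Ob C"
  shows "exch (a \<otimes> b) c d \<cdot> Ass C a b (c \<otimes> d)
       = (Idn C c \<odot> Ass C a b d) \<cdot> exch a c (b \<otimes> d) \<cdot> (Idn C a \<odot> exch b c d)"
proof (rule iso_mono[of "(Ass C c a b \<odot> Idn C d) \<cdot> Ass C c (a \<otimes> b) d"])
  have "((Ass C c a b \<odot> Idn C d) \<cdot> Ass C c (a \<otimes> b) d) \<cdot> exch (a \<otimes> b) c d \<cdot> Ass C a b (c \<otimes> d)
      = (Ass C c a b \<odot> Idn C d) \<cdot> (Sym C (a \<otimes> b) c \<odot> Idn C d) \<cdot> Ass C (a \<otimes> b) c d \<cdot> Ass C a b (c \<otimes> d)"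
    using assms by (simp add: exch_def)
  also have "\<dots> = ((Ass C c a b \<cdot> Sym C (a \<otimes> b) c \<cdot> Ass C a b c) \<odot> Idn C d)
      \<cdot> Ass C a (b \<otimes> c) d \<cdot> (Idn C a \<odot> Ass C b c d)"
    using assms by (simp add: pentagon whiskers)
  also have "\<dots> = ((Sym C a c \<odot> Idn C b) \<odot> Idn C d) \<cdot> (Ass C a c b \<odot> Idn C d)
      \<cdot> ((Idn C a \<odot> Sym C b c) \<odot> Idn C d) \<cdot> Ass C a (b \<otimes> c) d \<cdot> (Idn C a \<odot> Ass C b c d)"
    using assms by (simp add: hexagon whiskers)
  also have "\<dots> = ((Sym C a c \<odot> Idn C b) \<odot> Idn C d) \<cdot> (Ass C a c b \<odot> Idn C d)
      \<cdot> Ass C a (c \<otimes> b) d \<cdot> (Idn C a \<odot> Ass C c b d) \<cdot> (Idn C a \<odot> exch b c d)"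
    using assms Ass_natural2[of "Sym C b c" a d "c \<otimes> b", symmetric, THEN reassoc2, of "Idn C a \<odot> Ass C b c d"]
    by (simp add: whisker_left Ass_exch)
  also have "\<dots> = ((Sym C a c \<odot> Idn C b) \<odot> Idn C d) \<cdot> Ass C (a \<otimes> c) b d \<cdot> Ass C a c (b \<otimes> d) 
      \<cdot> (Idn C a \<odot> exch b c d)"
    using assms by (simp add: pentagon[THEN reassoc])
  also have "\<dots> = Ass C (c \<otimes> a) b d \<cdot> Ass C c a (b \<otimes> d) \<cdot> exch a c (b \<otimes> d) \<cdot> (Idn C a \<odot> exch b c d)"
    using assms by (simp add: Ass_exch[THEN reassoc] Ass_natural1[THEN reassoc])
  also have "\<dots> = ((Ass C c a b \<odot> Idn C d) \<cdot> Ass C c (a \<otimes> b) d)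
      \<cdot> (Idn C c \<odot> Ass C a b d) \<cdot> exch a c (b \<otimes> d) \<cdot> (Idn C a \<odot> exch b c d)"
    using assms by (simp add: pentagon[THEN reassoc])
  finally show "((Ass C c a b \<odot> Idn C d) \<cdot> Ass C c (a \<otimes> b) d) \<cdot> exch (a \<otimes> b) c d \<cdot> Ass C a b (c \<otimes> d)
      = ((Ass C c a b \<odot> Idn C d) \<cdot> Ass C c (a \<otimes> b) d)
      \<cdot> (Idn C c \<odot> Ass C a b d) \<cdot> exch a c (b \<otimes> d) \<cdot> (Idn C a \<odot> exch b c d)" .
qed (use assms in \<open>simp_all add: iso_Cmp\<close>)

text \<open>Transpositions are involutions, so inverting the previous rule moves one factor past a tensor
  product.\<close>

lemma exch_TOb_right:
  assumes "a \<in> Ob C" "b \<in> Ob C" "c \<in> Ob C" "d \<in> Ob C"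
  shows "exch a (b \<otimes> c) d \<cdot> (Idn C a \<odot> Ass C b c d)
       = Ass C b c (a \<otimes> d) \<cdot> (Idn C b \<odot> exch a c d) \<cdot> exch a b (c \<otimes> d)"
proof -
  have "Ass C b c (a \<otimes> d) \<cdot> (Idn C b \<odot> exch a c d) \<cdot> exch a b (c \<otimes> d)
      = exch a (b \<otimes> c) d \<cdot> (exch (b \<otimes> c) a d \<cdot> Ass C b c (a \<otimes> d)) \<cdot> (Idn C b \<odot> exch a c d) \<cdot> exch a b (c \<otimes> d)"
    using assms by (simp add: exch_exch[THEN reassoc])
  also have "\<dots> = exch a (b \<otimes> c) d \<cdot> (Idn C a \<odot> Ass C b c d)"
    unfolding exch_TOb_left[OF assms(2,3,1,4)]
    using assms by (simp add: exch_exch exch_exch[THEN reassoc] whiskers)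
  finally show ?thesis by simp
qed

text \<open>The same two rules when there is no further factor behind.\<close>

lemma Sym_TOb_left:
  assumes "a \<in> Ob C" "b \<in> Ob C" "c \<in> Ob C"
  shows "Sym C (a \<otimes> b) c \<cdot> Ass C a b c = exch a c b \<cdot> (Idn C a \<odot> Sym C b c)"
  by (rule iso_mono[of "Ass C c a b"]) (use assms in \<open>simp_all add: hexagon exch_def\<close>)

lemma Sym_TOb_right:
  assumes "a \<in> Ob C" "b \<in> Ob C" "c \<in> Ob C"
  shows "Sym C a (b \<otimes> c) = Ass C b c a \<cdot> (Idn C b \<odot> Sym C a c) \<cdot> exch a b c"
proof -
  have "Ass C b c a \<cdot> (Idn C b \<odot> Sym C a c) \<cdot> exch a b c
      = Sym C a (b \<otimes> c) \<cdot> (Sym C (b \<otimes> c) a \<cdot> Ass C b c a) \<cdot> (Idn C b \<odot> Sym C a c) \<cdot> exch a b c"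
    using assms by simp
  also have "\<dots> = Sym C a (b \<otimes> c)"
    unfolding Sym_TOb_left[OF assms(2,3,1)] using assms by (simp add: exch_exch whiskers)
  finally show ?thesis by simp
qed

section \<open>Unit coherence\<close>

lemma TAr_Unt_faithful:
  assumes "f \<in> Ar C" "g \<in> Ar C" "Dom C f = Dom C g" "Cod C f = Cod C g"
  shows "Idn C (Unt C) \<odot> f = Idn C (Unt C) \<odot> g \<Longrightarrow> f = g"
    and "f \<odot> Idn C (Unt C) = g \<odot> Idn C (Unt C) \<Longrightarrow> f = g"
proof -
  assume eq: "Idn C (Unt C) \<odot> f = Idn C (Unt C) \<odot> g"
  have "f \<cdot> Lft C (Dom C g) = g \<cdot> Lft C (Dom C g)"
    using Lft_natural[of f "Cod C g"] Lft_natural[of g "Cod C g"] eq assms by simp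
  then show "f = g" by (rule iso_epi[rotated]) (use assms in simp_all)
next
  assume eq: "f \<odot> Idn C (Unt C) = g \<odot> Idn C (Unt C)"
  have "f \<cdot> Rgt C (Dom C g) = g \<cdot> Rgt C (Dom C g)"
    using Rgt_natural[of f "Cod C g"] Rgt_natural[of g "Cod C g"] eq assms by simp
  then show "f = g" by (rule iso_epi[rotated]) (use assms in simp_all)
qed

text \<open>The two unit laws below are Kelly's: they follow from the pentagon and the triangle because
  tensoring with the unit is faithful.\<close>

lemma Lft_Ass:
  assumes "b \<in> Ob C" "c \<in> Ob C"
  shows "(Lft C b \<odot> Idn C c) \<cdot> Ass C (Unt C) b c = Lft C (b \<otimes> c)"
proof (rule TAr_Unt_faithful(1))
  let ?I = "Unt C"
  show "Idn C ?I \<odot> ((Lft C b \<odot> Idn C c) \<cdot> Ass C ?I b c) = Idn C ?I \<odot> Lft C (b \<otimes> c)"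
  proof (rule iso_mono[of "Ass C ?I b c"])
    have "Ass C ?I b c \<cdot> (Idn C ?I \<odot> ((Lft C b \<odot> Idn C c) \<cdot> Ass C ?I b c))
        = Ass C ?I b c \<cdot> (Idn C ?I \<odot> (Lft C b \<odot> Idn C c)) \<cdot> (Idn C ?I \<odot> Ass C ?I b c)"
      using assms by (simp add: whiskers)
    also have "\<dots> = (((Rgt C ?I \<odot> Idn C b) \<cdot> Ass C ?I ?I b) \<odot> Idn C c) \<cdot> Ass C ?I (?I \<otimes> b) c
        \<cdot> (Idn C ?I \<odot> Ass C ?I b c)"
      using assms by (simp add: triangle Ass_natural2[THEN reassoc])
    also have "\<dots> = ((Rgt C ?I \<odot> Idn C b) \<odot> Idn C c) \<cdot> Ass C (?I \<otimes> ?I) b c \<cdot> Ass C ?I ?I (b \<otimes> c)"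
      using assms by (simp add: pentagon whiskers)
    also have "\<dots> = Ass C ?I b c \<cdot> (Idn C ?I \<odot> Lft C (b \<otimes> c))"
      using assms Ass_natural1[of "Rgt C ?I" b c ?I, symmetric, THEN reassoc2, of "Ass C ?I ?I (b \<otimes> c)"]
      by (simp add: triangle)
    finally show "Ass C ?I b c \<cdot> (Idn C ?I \<odot> ((Lft C b \<odot> Idn C c) \<cdot> Ass C ?I b c))
        = Ass C ?I b c \<cdot> (Idn C ?I \<odot> Lft C (b \<otimes> c))" .
  qed (use assms in simp_all)
qed (use assms in simp_all)

lemma Rgt_Unt: "Rgt C (Unt C) = Lft C (Unt C)"
proof -
  let ?I = "Unt C"
  have "Lft C (?I \<otimes> ?I) = Idn C ?I \<odot> Lft C ?I"
    by (rule iso_mono[of "Lft C ?I"]) (use Lft_natural[of "Lft C ?I"] in simp_all)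
  then have "(Lft C ?I \<odot> Idn C ?I) \<cdot> Ass C ?I ?I ?I = (Rgt C ?I \<odot> Idn C ?I) \<cdot> Ass C ?I ?I ?I"
    by (simp add: triangle Lft_Ass)
  then have "Lft C ?I \<odot> Idn C ?I = Rgt C ?I \<odot> Idn C ?I"
    by (rule iso_epi[rotated]) simp_all
  from TAr_Unt_faithful(2)[OF _ _ _ _ this] show ?thesis by simp
qed

lemma Rgt_Sym: "a \<in> Ob C \<Longrightarrow> Rgt C a \<cdot> Sym C (Unt C) a = Lft C a"
  by (simp add: Lft_Sym[symmetric])

lemma Lft_exch:
  assumes "b \<in> Ob C" "c \<in> Ob C"
  shows "Lft C (b \<otimes> c) \<cdot> exch b (Unt C) c = Idn C b \<odot> Lft C c"
proof -
  have "Lft C (b \<otimes> c) \<cdot> exch b (Unt C) c = (Lft C b \<odot> Idn C c) \<cdot> (Sym C b (Unt C) \<odot> Idn C c) \<cdot> Ass C b (Unt C) c"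
    unfolding Lft_Ass[OF assms, symmetric] using assms by (simp add: exch_def)
  also have "\<dots> = Idn C b \<odot> Lft C c"
    using assms by (simp add: whiskers Lft_Sym triangle)
  finally show ?thesis .
qed

lemma Rgt_Ass:
  assumes "a \<in> Ob C" "b \<in> Ob C"
  shows "Rgt C (a \<otimes> b) \<cdot> Ass C a b (Unt C) = Idn C a \<odot> Rgt C b"
proof -
  have "Rgt C (a \<otimes> b) \<cdot> Ass C a b (Unt C) = Lft C (a \<otimes> b) \<cdot> Sym C (a \<otimes> b) (Unt C) \<cdot> Ass C a b (Unt C)"
    using assms by (simp add: Lft_Sym[symmetric])
  also have "\<dots> = Idn C a \<odot> Rgt C b"
    using assms by (simp add: Sym_TOb_left Lft_exch[THEN reassoc] whiskers Lft_Sym)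
  finally show ?thesis .
qed

section \<open>The middle-four interchange\<close>

abbreviation mid where "mid \<equiv> middle4 C"

lemma mid_def:
  assumes "a \<in> Ob C" "b \<in> Ob C" "c \<in> Ob C" "d \<in> Ob C"
  shows "mid a b c d = Ass C a c (b \<otimes> d) \<cdot> (Idn C a \<odot> exch b c d) \<cdot> inverse_of C (Ass C a b (c \<otimes> d))"
  using assms by (simp add: middle4_def exch_def whiskers)

lemma mid_typing [simp]:
  assumes "a \<in> Ob C" "b \<in> Ob C" "c \<in> Ob C" "d \<in> Ob C"
  shows "mid a b c d \<in> Ar C" "Dom C (mid a b c d) = (a \<otimes> b) \<otimes> (c \<otimes> d)"
    "Cod C (mid a b c d) = (a \<otimes> c) \<otimes> (b \<otimes> d)"
  using assms by (simp_all add: mid_def)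

lemma mid_Ass:
  assumes "a \<in> Ob C" "b \<in> Ob C" "c \<in> Ob C" "d \<in> Ob C"
  shows "mid a b c d \<cdot> Ass C a b (c \<otimes> d) = Ass C a c (b \<otimes> d) \<cdot> (Idn C a \<odot> exch b c d)"
  using assms by (simp add: mid_def)

lemma mid_mid:
  assumes "a \<in> Ob C" "b \<in> Ob C" "c \<in> Ob C" "d \<in> Ob C"
  shows "mid a c b d \<cdot> mid a b c d = Idn C ((a \<otimes> b) \<otimes> (c \<otimes> d))"
  using assms by (simp add: mid_def whiskers exch_exch)

lemma iso_mid: 
  assumes "a \<in> Ob C" "b \<in> Ob C" "c \<in> Ob C" "d \<in> Ob C"
  shows "is_iso C (mid a b c d)" "inverse_of C (mid a b c d) = mid a c b d"
  using isoI[of "mid a b c d" "mid a c b d"] assms by (simp_all add: mid_mid)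

lemma mid_natural:
  assumes "f \<in> Ar C" "g \<in> Ar C" "h \<in> Ar C" "k \<in> Ar C"
    "Cod C f = a" "Cod C g = b" "Cod C h = c" "Cod C k = d"
  shows "mid a b c d \<cdot> ((f \<odot> g) \<odot> (h \<odot> k))
       = ((f \<odot> h) \<odot> (g \<odot> k)) \<cdot> mid (Dom C f) (Dom C g) (Dom C h) (Dom C k)"
proof -
  have ob: "a \<in> Ob C" "b \<in> Ob C" "c \<in> Ob C" "d \<in> Ob C" using assms Cod_in by blast+
  have "(mid a b c d \<cdot> ((f \<odot> g) \<odot> (h \<odot> k))) \<cdot> Ass C (Dom C f) (Dom C g) (Dom C (h \<odot> k))
      = mid a b c d \<cdot> Ass C a b (c \<otimes> d) \<cdot> (f \<odot> (g \<odot> (h \<odot> k)))"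
    using assms ob by (simp add: Ass_natural)
  also have "\<dots> = Ass C a c (b \<otimes> d) \<cdot> (f \<odot> (exch b c d \<cdot> (g \<odot> (h \<odot> k))))"
    using assms ob by (simp add: mid_Ass[THEN reassoc] interchange)
  also have "\<dots> = Ass C a c (b \<otimes> d) \<cdot> (f \<odot> (h \<odot> (g \<odot> k))) \<cdot> (Idn C (Dom C f) \<odot> exch (Dom C g) (Dom C h) (Dom C k))"
    using assms ob by (simp add: exch_natural interchange)
  also have "\<dots> = (((f \<odot> h) \<odot> (g \<odot> k)) \<cdot> mid (Dom C f) (Dom C g) (Dom C h) (Dom C k))
      \<cdot> Ass C (Dom C f) (Dom C g) (Dom C (h \<odot> k))"
    using assms ob by (simp add: Ass_natural[THEN reassoc] mid_Ass)
  finally have *: "(mid a b c d \<cdot> ((f \<odot> g) \<odot> (h \<odot> k))) \<cdot> Ass C (Dom C f) (Dom C g) (Dom C (h \<odot> k))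
     = (((f \<odot> h) \<odot> (g \<odot> k)) \<cdot> mid (Dom C f) (Dom C g) (Dom C h) (Dom C k))
      \<cdot> Ass C (Dom C f) (Dom C g) (Dom C (h \<odot> k))" .
  show ?thesis by (rule iso_epi[OF _ *]) (use assms ob in simp_all)
qed

text \<open>Both sides reduce to the same word in transpositions: in either case \<open>p\<close> moves past
  \<open>b\<close>, and both \<open>p\<close> and \<open>q\<close> move past \<open>c\<close>.  The words differ only in the order of the
  transpositions of the disjoint pairs \<open>p, b\<close> and \<open>q, c\<close>.\<close>

lemma mid_assoc:
  assumes ob [simp]: "a \<in> Ob C" "b \<in> Ob C" "c \<in> Ob C" "p \<in> Ob C" "q \<in> Ob C" "r \<in> Ob C"
  shows "(Ass C a b c \<odot> Ass C p q r) \<cdot> mid a p (b \<otimes> c) (q \<otimes> r) \<cdot> (Idn C (a \<otimes> p) \<odot> mid b q c r)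
       = mid (a \<otimes> b) (p \<otimes> q) c r \<cdot> (mid a p b q \<odot> Idn C (c \<otimes> r)) \<cdot> Ass C (a \<otimes> p) (b \<otimes> q) (c \<otimes> r)"
    (is "?L = ?R")
proof -
  let ?x = "p \<otimes> (q \<otimes> r)" and ?y = "(p \<otimes> q) \<otimes> r" and ?z = "q \<otimes> (c \<otimes> r)"
  let ?E = "Ass C a p ((b \<otimes> q) \<otimes> (c \<otimes> r)) \<cdot> (Idn C a \<odot> (Idn C p \<odot> Ass C b q (c \<otimes> r)))"
  let ?N = "Ass C (a \<otimes> b) c ?y \<cdot> Ass C a b (c \<otimes> ?y)
      \<cdot> (Idn C a \<odot> (Idn C b \<odot> (exch (p \<otimes> q) c r \<cdot> Ass C p q (c \<otimes> r))))
      \<cdot> (Idn C a \<odot> exch p b ?z)"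
  have past_b: "exch p (b \<otimes> c) (q \<otimes> r) \<cdot> (Idn C p \<odot> Ass C b c (q \<otimes> r)) \<cdot> (Idn C p \<odot> (Idn C b \<odot> exch q c r))
      = Ass C b c ?x \<cdot> (Idn C b \<odot> (exch p c (q \<otimes> r) \<cdot> (Idn C p \<odot> exch q c r))) \<cdot> exch p b ?z"
  proof -
    have "exch p (b \<otimes> c) (q \<otimes> r) \<cdot> (Idn C p \<odot> Ass C b c (q \<otimes> r)) \<cdot> (Idn C p \<odot> (Idn C b \<odot> exch q c r))
        = Ass C b c ?x \<cdot> (Idn C b \<odot> exch p c (q \<otimes> r)) \<cdot> exch p b (c \<otimes> (q \<otimes> r)) \<cdot> (Idn C p \<odot> (Idn C b \<odot> exch q c r))"
      by (simp add: exch_TOb_right[THEN reassoc])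
    also have "\<dots> = Ass C b c ?x \<cdot> (Idn C b \<odot> (exch p c (q \<otimes> r) \<cdot> (Idn C p \<odot> exch q c r))) \<cdot> exch p b ?z"
      using exch_natural[of "Idn C p" "Idn C b" "exch q c r" p b "c \<otimes> (q \<otimes> r)"] by (simp add: whiskers)
    finally show ?thesis .
  qed
  have "?L \<cdot> ?E = (Ass C a b c \<odot> Ass C p q r) \<cdot> mid a p (b \<otimes> c) (q \<otimes> r)
      \<cdot> ((Idn C (a \<otimes> p) \<odot> mid b q c r) \<cdot> Ass C a p ((b \<otimes> q) \<otimes> (c \<otimes> r)))
      \<cdot> (Idn C a \<odot> (Idn C p \<odot> Ass C b q (c \<otimes> r)))"
    by simp
  also have "\<dots> = (Ass C a b c \<odot> Ass C p q r) \<cdot> (mid a p (b \<otimes> c) (q \<otimes> r) \<cdot> Ass C a p ((b \<otimes> c) \<otimes> (q \<otimes> r)))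
      \<cdot> (Idn C a \<odot> (Idn C p \<odot> (mid b q c r \<cdot> Ass C b q (c \<otimes> r))))"
    using Ass_natural3[of "mid b q c r" a p, symmetric] by (simp add: whiskers)
  also have "\<dots> = (Ass C a b c \<odot> Ass C p q r) \<cdot> Ass C a (b \<otimes> c) ?x
      \<cdot> (Idn C a \<odot> (exch p (b \<otimes> c) (q \<otimes> r) \<cdot> (Idn C p \<odot> Ass C b c (q \<otimes> r)) \<cdot> (Idn C p \<odot> (Idn C b \<odot> exch q c r))))"
    by (simp add: mid_Ass whiskers)
  also have "\<dots> = (Idn C ((a \<otimes> b) \<otimes> c) \<odot> Ass C p q r)
      \<cdot> ((Ass C a b c \<odot> Idn C ?x) \<cdot> Ass C a (b \<otimes> c) ?x \<cdot> (Idn C a \<odot> Ass C b c ?x))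
      \<cdot> (Idn C a \<odot> (Idn C b \<odot> (exch p c (q \<otimes> r) \<cdot> (Idn C p \<odot> exch q c r)))) \<cdot> (Idn C a \<odot> exch p b ?z)"
    unfolding past_b by (simp add: whiskers interchange')
  also have "\<dots> = ((Idn C ((a \<otimes> b) \<otimes> c) \<odot> Ass C p q r) \<cdot> Ass C (a \<otimes> b) c ?x) \<cdot> Ass C a b (c \<otimes> ?x)
      \<cdot> (Idn C a \<odot> (Idn C b \<odot> (exch p c (q \<otimes> r) \<cdot> (Idn C p \<odot> exch q c r)))) \<cdot> (Idn C a \<odot> exch p b ?z)"
    unfolding pentagon[symmetric, OF ob(1-3) TOb_in[OF ob(4) TOb_in[OF ob(5,6)]]] by simp
  also have "\<dots> = Ass C (a \<otimes> b) c ?y \<cdot> ((Idn C (a \<otimes> b) \<odot> (Idn C c \<odot> Ass C p q r)) \<cdot> Ass C a b (c \<otimes> ?x))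
      \<cdot> (Idn C a \<odot> (Idn C b \<odot> (exch p c (q \<otimes> r) \<cdot> (Idn C p \<odot> exch q c r)))) \<cdot> (Idn C a \<odot> exch p b ?z)"
    using Ass_natural3[of "Ass C p q r" "a \<otimes> b" c, symmetric] by simp
  also have "\<dots> = Ass C (a \<otimes> b) c ?y \<cdot> Ass C a b (c \<otimes> ?y) \<cdot> (Idn C a \<odot> (Idn C b \<odot> (
      (Idn C c \<odot> Ass C p q r) \<cdot> exch p c (q \<otimes> r) \<cdot> (Idn C p \<odot> exch q c r)))) \<cdot> (Idn C a \<odot> exch p b ?z)"
    using Ass_natural3[of "Idn C c \<odot> Ass C p q r" a b, symmetric] by (simp add: whiskers)
  also have "\<dots> = ?N"
    by (simp add: exch_TOb_left)
  finally have L: "?L \<cdot> ?E = ?N" .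
  have "?R \<cdot> ?E = mid (a \<otimes> b) (p \<otimes> q) c r \<cdot> (mid a p b q \<odot> Idn C (c \<otimes> r))
      \<cdot> (Ass C (a \<otimes> p) (b \<otimes> q) (c \<otimes> r) \<cdot> Ass C a p ((b \<otimes> q) \<otimes> (c \<otimes> r)))
      \<cdot> (Idn C a \<odot> (Idn C p \<odot> Ass C b q (c \<otimes> r)))"
    by simp
  also have "\<dots> = mid (a \<otimes> b) (p \<otimes> q) c r \<cdot> ((mid a p b q \<cdot> Ass C a p (b \<otimes> q)) \<odot> Idn C (c \<otimes> r))
      \<cdot> Ass C a (p \<otimes> (b \<otimes> q)) (c \<otimes> r) \<cdot> (Idn C a \<odot> (Ass C p (b \<otimes> q) (c \<otimes> r) \<cdot> (Idn C p \<odot> Ass C b q (c \<otimes> r))))"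
    unfolding pentagon[OF ob(1,4) TOb_in[OF ob(2,5)] TOb_in[OF ob(3,6)]] by (simp add: whiskers)
  also have "\<dots> = mid (a \<otimes> b) (p \<otimes> q) c r \<cdot> (Ass C a b (p \<otimes> q) \<odot> Idn C (c \<otimes> r))
      \<cdot> (((Idn C a \<odot> exch p b q) \<odot> Idn C (c \<otimes> r)) \<cdot> Ass C a (p \<otimes> (b \<otimes> q)) (c \<otimes> r))
      \<cdot> (Idn C a \<odot> (Ass C p (b \<otimes> q) (c \<otimes> r) \<cdot> (Idn C p \<odot> Ass C b q (c \<otimes> r))))"
    by (simp add: mid_Ass whiskers)
  also have "\<dots> = mid (a \<otimes> b) (p \<otimes> q) c r \<cdot> (Ass C a b (p \<otimes> q) \<odot> Idn C (c \<otimes> r))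
      \<cdot> Ass C a (b \<otimes> (p \<otimes> q)) (c \<otimes> r)
      \<cdot> (Idn C a \<odot> ((exch p b q \<odot> Idn C (c \<otimes> r)) \<cdot> Ass C p (b \<otimes> q) (c \<otimes> r) \<cdot> (Idn C p \<odot> Ass C b q (c \<otimes> r))))"
    using Ass_natural2[of "exch p b q" a "c \<otimes> r", symmetric] by (simp add: whiskers)
  also have "\<dots> = mid (a \<otimes> b) (p \<otimes> q) c r \<cdot> ((Ass C a b (p \<otimes> q) \<odot> Idn C (c \<otimes> r))
      \<cdot> Ass C a (b \<otimes> (p \<otimes> q)) (c \<otimes> r) \<cdot> (Idn C a \<odot> Ass C b (p \<otimes> q) (c \<otimes> r)))
      \<cdot> (Idn C a \<odot> (Idn C b \<odot> Ass C p q (c \<otimes> r))) \<cdot> (Idn C a \<odot> exch p b ?z)"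
    by (simp add: exch_Ass whiskers)
  also have "\<dots> = (mid (a \<otimes> b) (p \<otimes> q) c r \<cdot> Ass C (a \<otimes> b) (p \<otimes> q) (c \<otimes> r)) \<cdot> Ass C a b ((p \<otimes> q) \<otimes> (c \<otimes> r))
      \<cdot> (Idn C a \<odot> (Idn C b \<odot> Ass C p q (c \<otimes> r))) \<cdot> (Idn C a \<odot> exch p b ?z)"
    unfolding pentagon[symmetric, OF ob(1,2) TOb_in[OF ob(4,5)] TOb_in[OF ob(3,6)]] by simp
  also have "\<dots> = Ass C (a \<otimes> b) c ?y \<cdot> ((Idn C (a \<otimes> b) \<odot> exch (p \<otimes> q) c r) \<cdot> Ass C a b ((p \<otimes> q) \<otimes> (c \<otimes> r)))
      \<cdot> (Idn C a \<odot> (Idn C b \<odot> Ass C p q (c \<otimes> r))) \<cdot> (Idn C a \<odot> exch p b ?z)"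
    by (simp add: mid_Ass)
  also have "\<dots> = ?N"
    using Ass_natural3[of "exch (p \<otimes> q) c r" a b, symmetric] by (simp add: whiskers)
  finally have R: "?R \<cdot> ?E = ?N" .
  have "is_iso C ?E" by (rule iso_Cmp) simp_all
  then show ?thesis by (rule iso_epi[OF _ trans[OF L R[symmetric]]]) simp_all
qed

text \<open>The same identity with the interchanges moved to the other side, where they are inverted:
  associativity is a monoidal transformation.\<close>

lemma mid_assoc':
  assumes ob [simp]: "a \<in> Ob C" "b \<in> Ob C" "c \<in> Ob C" "p \<in> Ob C" "q \<in> Ob C" "r \<in> Ob C"
  shows "Ass C (a \<otimes> p) (b \<otimes> q) (c \<otimes> r) \<cdot> (Idn C (a \<otimes> p) \<odot> mid b c q r) \<cdot> mid a (b \<otimes> c) p (q \<otimes> r)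
       = (mid a b p q \<odot> Idn C (c \<otimes> r)) \<cdot> mid (a \<otimes> b) c (p \<otimes> q) r \<cdot> (Ass C a b c \<odot> Ass C p q r)"
proof -
  let ?A = "Ass C (a \<otimes> p) (b \<otimes> q) (c \<otimes> r)" and ?p = "mid a p (b \<otimes> c) (q \<otimes> r) \<cdot> (Idn C (a \<otimes> p) \<odot> mid b q c r)"
    and ?q = "mid (a \<otimes> b) (p \<otimes> q) c r \<cdot> (mid a p b q \<odot> Idn C (c \<otimes> r))"
  have p: "is_iso C ?p" "inverse_of C ?p = (Idn C (a \<otimes> p) \<odot> mid b c q r) \<cdot> mid a (b \<otimes> c) p (q \<otimes> r)"
    using isoI[of ?p "(Idn C (a \<otimes> p) \<odot> mid b c q r) \<cdot> mid a (b \<otimes> c) p (q \<otimes> r)"]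
    by (simp_all add: whiskers mid_mid mid_mid[THEN reassoc])
  have q: "is_iso C ?q" "inverse_of C ?q = (mid a b p q \<odot> Idn C (c \<otimes> r)) \<cdot> mid (a \<otimes> b) c (p \<otimes> q) r"
    using isoI[of ?q "(mid a b p q \<odot> Idn C (c \<otimes> r)) \<cdot> mid (a \<otimes> b) c (p \<otimes> q) r"]
    by (simp_all add: whiskers mid_mid mid_mid[THEN reassoc])
  have "(Ass C a b c \<odot> Ass C p q r) \<cdot> ?p = ?q \<cdot> ?A" using mid_assoc[OF assms] by simp
  then have "inverse_of C ?q \<cdot> (Ass C a b c \<odot> Ass C p q r) = ?A \<cdot> inverse_of C ?p"
    by (rule move_inverses) (use p(1) q(1) in simp_all)
  then show ?thesis unfolding p q by simp
qed

text \<open>The symmetry of two products is a word of four transpositions; the interchange on the right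
  cancels the one of \<open>a\<close> and \<open>d\<close>.\<close>

lemma mid_Sym:
  assumes ob [simp]: "a \<in> Ob C" "b \<in> Ob C" "c \<in> Ob C" "d \<in> Ob C"
  shows "(Sym C a c \<odot> Sym C b d) \<cdot> mid a b c d = mid c d a b \<cdot> Sym C (a \<otimes> b) (c \<otimes> d)" (is "?L = ?R")
proof -
  let ?A = "Ass C a b (c \<otimes> d)"
  have "?R \<cdot> ?A = mid c d a b \<cdot> (Sym C (a \<otimes> b) (c \<otimes> d) \<cdot> ?A)" by simp
  also have "\<dots> = mid c d a b \<cdot> (exch a (c \<otimes> d) b \<cdot> (Idn C a \<odot> Ass C c d b)) \<cdot> (Idn C a \<odot> (Idn C c \<odot> Sym C b d))
      \<cdot> (Idn C a \<odot> exch b c d)"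
    by (simp add: Sym_TOb_left Sym_TOb_right[of b c d] whiskers)
  also have "\<dots> = mid c d a b \<cdot> Ass C c d (a \<otimes> b) \<cdot> (Idn C c \<odot> exch a d b) \<cdot> exch a c (d \<otimes> b)
      \<cdot> (Idn C a \<odot> (Idn C c \<odot> Sym C b d)) \<cdot> (Idn C a \<odot> exch b c d)"
    by (simp add: exch_TOb_right)
  also have "\<dots> = Ass C c a (d \<otimes> b) \<cdot> exch a c (d \<otimes> b)
      \<cdot> (Idn C a \<odot> (Idn C c \<odot> Sym C b d)) \<cdot> (Idn C a \<odot> exch b c d)"
    by (simp add: mid_Ass[THEN reassoc] whiskers exch_exch)
  also have "\<dots> = (Sym C a c \<odot> Idn C (d \<otimes> b)) \<cdot> Ass C a c (d \<otimes> b) 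
      \<cdot> (Idn C a \<odot> (Idn C c \<odot> Sym C b d)) \<cdot> (Idn C a \<odot> exch b c d)"
    by (simp add: exch_def)
  also have "\<dots> = (Sym C a c \<odot> Sym C b d) \<cdot> Ass C a c (b \<otimes> d) \<cdot> (Idn C a \<odot> exch b c d)"
    by (simp add: Ass_natural3[THEN reassoc] interchange')
  also have "\<dots> = ?L \<cdot> ?A"
    by (simp add: mid_Ass)
  finally have "?L \<cdot> ?A = ?R \<cdot> ?A" by simp
  then show ?thesis by (rule iso_epi[rotated]) simp_all
qed

text \<open>With the interchanges inverted: the symmetry is a monoidal transformation.\<close>

lemma mid_Sym':
  assumes ob [simp]: "a \<in> Ob C" "b \<in> Ob C" "c \<in> Ob C" "d \<in> Ob C"
  shows "Sym C (a \<otimes> c) (b \<otimes> d) \<cdot> mid a b c d = mid b a d c \<cdot> (Sym C a b \<odot> Sym C c d)"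
proof -
  have "(Sym C a b \<odot> Sym C c d) \<cdot> mid a c b d = mid b d a c \<cdot> Sym C (a \<otimes> c) (b \<otimes> d)"
    by (rule mid_Sym) simp_all
  then have "inverse_of C (mid b d a c) \<cdot> (Sym C a b \<odot> Sym C c d) = Sym C (a \<otimes> c) (b \<otimes> d) \<cdot> inverse_of C (mid a c b d)"
    by (rule move_inverses) (simp_all add: iso_mid)
  then show ?thesis by (simp add: iso_mid)
qed

text \<open>The triangle absorbs the unit that moves past \<open>b\<close>, and the law for right units of a product
  absorbs the other one.\<close>

lemma mid_Rgt:
  assumes ob [simp]: "a \<in> Ob C" "b \<in> Ob C"
  shows "(Rgt C a \<odot> Rgt C b) \<cdot> mid a b (Unt C) (Unt C) = Rgt C (a \<otimes> b) \<cdot> (Idn C (a \<otimes> b) \<odot> Rgt C (Unt C))"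
    (is "?L = ?R")
proof -
  let ?I = "Unt C"
  have "?L \<cdot> Ass C a b (?I \<otimes> ?I) = (Rgt C a \<odot> Rgt C b) \<cdot> Ass C a ?I (b \<otimes> ?I) \<cdot> (Idn C a \<odot> exch b ?I ?I)"
    by (simp add: mid_Ass)
  also have "\<dots> = (Idn C a \<odot> Rgt C b) \<cdot> ((Rgt C a \<odot> Idn C (b \<otimes> ?I)) \<cdot> Ass C a ?I (b \<otimes> ?I)) \<cdot> (Idn C a \<odot> exch b ?I ?I)"
    by (simp add: interchange')
  also have "\<dots> = Idn C a \<odot> (Rgt C b \<cdot> (Idn C b \<odot> Rgt C ?I))"
    by (simp add: triangle whiskers Lft_exch Rgt_Unt)
  also have "\<dots> = Rgt C (a \<otimes> b) \<cdot> Ass C a b ?I \<cdot> (Idn C a \<odot> (Idn C b \<odot> Rgt C ?I))"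
    by (simp add: Rgt_Ass[THEN reassoc] whiskers)
  also have "\<dots> = ?R \<cdot> Ass C a b (?I \<otimes> ?I)"
    by (simp add: Ass_natural3)
  finally show ?thesis by (rule iso_epi[rotated]) simp_all
qed

text \<open>The symmetry exchanges the two unit laws.\<close>

lemma mid_Lft:
  assumes ob [simp]: "a \<in> Ob C" "b \<in> Ob C"
  shows "(Lft C a \<odot> Lft C b) \<cdot> mid (Unt C) (Unt C) a b = Lft C (a \<otimes> b) \<cdot> (Rgt C (Unt C) \<odot> Idn C (a \<otimes> b))"
proof -
  let ?I = "Unt C"
  have "(Lft C a \<odot> Lft C b) \<cdot> mid ?I ?I a b = (Rgt C a \<odot> Rgt C b) \<cdot> (Sym C ?I a \<odot> Sym C ?I b) \<cdot> mid ?I ?I a b"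
    by (simp add: interchange' Rgt_Sym)
  also have "\<dots> = Rgt C (a \<otimes> b) \<cdot> (Idn C (a \<otimes> b) \<odot> Rgt C ?I) \<cdot> Sym C (?I \<otimes> ?I) (a \<otimes> b)"
    by (simp add: mid_Sym mid_Rgt[THEN reassoc])
  also have "\<dots> = Rgt C (a \<otimes> b) \<cdot> Sym C ?I (a \<otimes> b) \<cdot> (Rgt C ?I \<odot> Idn C (a \<otimes> b))"
    by (simp add: Sym_natural)
  also have "\<dots> = Lft C (a \<otimes> b) \<cdot> (Rgt C ?I \<odot> Idn C (a \<otimes> b))"
    by (simp add: Rgt_Sym[THEN reassoc])
  finally show ?thesis .
qed

text \<open>With the interchanges inverted: the unit arrows are monoidal transformations.\<close>

lemma mid_Rgt':
  assumes ob [simp]: "a \<in> Ob C" "b \<in> Ob C"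
  shows "Rgt C (a \<otimes> b) \<cdot> (Idn C (a \<otimes> b) \<odot> Rgt C (Unt C)) \<cdot> mid a (Unt C) b (Unt C) = Rgt C a \<odot> Rgt C b"
  using mid_Rgt[OF ob, symmetric, THEN reassoc2, of "mid a (Unt C) b (Unt C)"] by (simp add: mid_mid)

lemma mid_Lft':
  assumes ob [simp]: "a \<in> Ob C" "b \<in> Ob C"
  shows "Lft C (a \<otimes> b) \<cdot> (Rgt C (Unt C) \<odot> Idn C (a \<otimes> b)) \<cdot> mid (Unt C) a (Unt C) b = Lft C a \<odot> Lft C b"
  using mid_Lft[OF ob, symmetric, THEN reassoc2, of "mid (Unt C) a (Unt C) b"] by (simp add: mid_mid)

lemma mid_natural_right:
  "\<lbrakk>h \<in> Ar C; k \<in> Ar C; a \<in> Ob C; b \<in> Ob C; Cod C h = c; Cod C k = d\<rbrakk>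
   \<Longrightarrow> mid a b c d \<cdot> (Idn C (a \<otimes> b) \<odot> (h \<odot> k)) = ((Idn C a \<odot> h) \<odot> (Idn C b \<odot> k)) \<cdot> mid a b (Dom C h) (Dom C k)"
  and mid_natural_left:
  "\<lbrakk>f \<in> Ar C; g \<in> Ar C; c \<in> Ob C; d \<in> Ob C; Cod C f = a; Cod C g = b\<rbrakk>
   \<Longrightarrow> mid a b c d \<cdot> ((f \<odot> g) \<odot> Idn C (c \<otimes> d)) = ((f \<odot> Idn C c) \<odot> (g \<odot> Idn C d)) \<cdot> mid (Dom C f) (Dom C g) c d"
  using mid_natural[of "Idn C a" "Idn C b" h k a b c d] mid_natural[of f g "Idn C c" "Idn C d" a b c d] by simp_all

lemma TAr_Cmp_right:
  "\<lbrakk>f \<in> Ar C; g \<in> Ar C; h \<in> Ar C; Dom C g = Cod C h\<rbrakk> \<Longrightarrow> f \<odot> (g \<cdot> h) = (f \<odot> g) \<cdot> (Idn C (Dom C f) \<odot> h)"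
  and TAr_Cmp_left:
  "\<lbrakk>f \<in> Ar C; g \<in> Ar C; h \<in> Ar C; Dom C g = Cod C h\<rbrakk> \<Longrightarrow> (g \<cdot> h) \<odot> f = (g \<odot> f) \<cdot> (h \<odot> Idn C (Dom C f))"
  by (simp_all add: interchange)

lemma Ass_Rgt_inverse:
  "Ass C (Unt C) (Unt C) (Unt C) \<cdot> (Idn C (Unt C) \<odot> inverse_of C (Rgt C (Unt C)))
   = inverse_of C (Rgt C (Unt C)) \<odot> Idn C (Unt C)"
proof (rule iso_mono[of "Rgt C (Unt C) \<odot> Idn C (Unt C)"])
  have "(Rgt C (Unt C) \<odot> Idn C (Unt C)) \<cdot> Ass C (Unt C) (Unt C) (Unt C) = Idn C (Unt C) \<odot> Rgt C (Unt C)"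
    using triangle[of "Unt C" "Unt C"] by (simp add: Rgt_Unt)
  from this[THEN reassoc, of "Idn C (Unt C) \<odot> inverse_of C (Rgt C (Unt C))"]
  show "(Rgt C (Unt C) \<odot> Idn C (Unt C)) \<cdot> Ass C (Unt C) (Unt C) (Unt C) \<cdot> (Idn C (Unt C) \<odot> inverse_of C (Rgt C (Unt C)))
    = (Rgt C (Unt C) \<odot> Idn C (Unt C)) \<cdot> (inverse_of C (Rgt C (Unt C)) \<odot> Idn C (Unt C))"
    by (simp add: interchange)
qed simp_all

lemma Sym_Rgt_inverse:
  "Sym C (Unt C) (Unt C) \<cdot> inverse_of C (Rgt C (Unt C)) = inverse_of C (Rgt C (Unt C))"
  by (rule iso_mono[of "Rgt C (Unt C)"]) (use Rgt_Sym[of "Unt C", THEN reassoc] in \<open>simp_all add: Rgt_Unt\<close>)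

end

section \<open>Symmetric monoidal functors and transformations\<close>

lemma hom_smc_simps [simp]:
  "Dom \<lbrakk>A, B\<rbrakk>\<^sub>0 = ndom" "Cod \<lbrakk>A, B\<rbrakk>\<^sub>0 = ncod" "Idn \<lbrakk>A, B\<rbrakk>\<^sub>0 = mnt_id" "Cmp \<lbrakk>A, B\<rbrakk>\<^sub>0 = mnt_vcomp"
  "TOb \<lbrakk>A, B\<rbrakk>\<^sub>0 = smf_tensor" "TAr \<lbrakk>A, B\<rbrakk>\<^sub>0 = mnt_tensor" "Unt \<lbrakk>A, B\<rbrakk>\<^sub>0 = smf_const A B"
  by (simp_all add: hom_smc_def)

lemma hom_Ob_iff: "F \<in> Ob \<lbrakk>A, B\<rbrakk>\<^sub>0 \<longleftrightarrow> sym_mon_functor F \<and> fdom F = A \<and> fcod F = B"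
  and hom_Ar_iff: "\<sigma> \<in> Ar \<lbrakk>A, B\<rbrakk>\<^sub>0 \<longleftrightarrow> mon_nat_trans \<sigma> \<and> fdom (ndom \<sigma>) = A \<and> fcod (ndom \<sigma>) = B"
  by (simp_all add: hom_smc_def)

text \<open>Membership in the object and arrow sets of \<open>\<lbrakk>A, B\<rbrakk>\<^sub>0\<close> serves as the typing judgement for
  functors \<open>A \<rightarrow> B\<close> and for transformations between them.  The locale fixes the two categories
  so that simplification need not guess them when it checks such a judgement.\<close>

locale smc_hom = A: sym_mon_category A + B: sym_mon_category B
  for A :: "('oa, 'ma) smc" and B :: "('ob, 'mb) smc"
begin

context
  fixes F :: "('oa, 'ma, 'ob, 'mb) smf"
  assumes F: "F \<in> Ob \<lbrakk>A, B\<rbrakk>\<^sub>0"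
begin

private lemma smf: "sym_mon_functor F" "fdom F = A" "fcod F = B"
  using F by (simp_all add: hom_Ob_iff)

lemma fdom [simp]: "fdom F = A"
  and fcod [simp]: "fcod F = B"
  by (simp_all add: smf)

lemma fob_in [simp]: "x \<in> Ob A \<Longrightarrow> fob F x \<in> Ob B"
  using sym_mon_functor.fob_Ob[OF smf(1)] by (simp add: smf)

lemma far_typing [simp]:
  assumes "f \<in> Ar A"
  shows "far F f \<in> Ar B" "Dom B (far F f) = fob F (Dom A f)" "Cod B (far F f) = fob F (Cod A f)"
  using sym_mon_functor.far_Hom[OF smf(1), of f "Dom A f" "Cod A f"] assms by (simp_all add: smf Hom_iff)

lemma far_unit [simp]: "x \<in> Ob A \<Longrightarrow> far F (Idn A x) = Idn B (fob F x)"
  using sym_mon_functor.far_Idn[OF smf(1)] by (simp add: smf)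

lemma far_comp [simp]:
  "\<lbrakk>g \<in> Ar A; f \<in> Ar A; Dom A g = Cod A f\<rbrakk> \<Longrightarrow> far F (g \<cdot>\<^bsub>A\<^esub> f) = far F g \<cdot>\<^bsub>B\<^esub> far F f"
  using sym_mon_functor.far_Cmp[OF smf(1), of f "Dom A f" "Cod A f" g "Cod A g"] by (simp add: smf Hom_iff)

lemma fun0_typing [simp]:
  "fun0 F \<in> Ar B" "Dom B (fun0 F) = Unt B" "Cod B (fun0 F) = fob F (Unt A)"
  using sym_mon_functor.fun0_Hom[OF smf(1)] by (simp_all add: smf Hom_iff)

lemma fun2_typing [simp]:
  assumes "x \<in> Ob A" "y \<in> Ob A"
  shows "fun2 F x y \<in> Ar B" "Dom B (fun2 F x y) = fob F x \<otimes>\<^bsub>B\<^esub> fob F y"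
    "Cod B (fun2 F x y) = fob F (x \<otimes>\<^bsub>A\<^esub> y)"
  using sym_mon_functor.fun2_Hom[OF smf(1)] assms by (simp_all add: smf Hom_iff)

lemma fun2_natural:
  "\<lbrakk>f \<in> Ar A; g \<in> Ar A; Dom A f = x; Dom A g = y\<rbrakk>
   \<Longrightarrow> far F (f \<odot>\<^bsub>A\<^esub> g) \<cdot>\<^bsub>B\<^esub> fun2 F x y
     = fun2 F (Cod A f) (Cod A g) \<cdot>\<^bsub>B\<^esub> (far F f \<odot>\<^bsub>B\<^esub> far F g)"
  using sym_mon_functor.fun2_nat[OF smf(1), of f x "Cod A f" g y "Cod A g"]
  by (simp add: smf Hom_iff)

lemma fun2_natural_left:
  "\<lbrakk>f \<in> Ar A; y \<in> Ob A; Dom A f = x\<rbrakk>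
   \<Longrightarrow> far F (f \<odot>\<^bsub>A\<^esub> Idn A y) \<cdot>\<^bsub>B\<^esub> fun2 F x y = fun2 F (Cod A f) y \<cdot>\<^bsub>B\<^esub> (far F f \<odot>\<^bsub>B\<^esub> Idn B (fob F y))"
  and fun2_natural_right:
  "\<lbrakk>f \<in> Ar A; y \<in> Ob A; Dom A f = x\<rbrakk>
   \<Longrightarrow> far F (Idn A y \<odot>\<^bsub>A\<^esub> f) \<cdot>\<^bsub>B\<^esub> fun2 F y x = fun2 F y (Cod A f) \<cdot>\<^bsub>B\<^esub> (Idn B (fob F y) \<odot>\<^bsub>B\<^esub> far F f)"
  using fun2_natural[of f "Idn A y" x y] fun2_natural[of "Idn A y" f y x] by simp_all

lemma fun2_assoc:
  "\<lbrakk>x \<in> Ob A; y \<in> Ob A; z \<in> Ob A\<rbrakk>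
   \<Longrightarrow> far F (Ass A x y z) \<cdot>\<^bsub>B\<^esub> fun2 F x (y \<otimes>\<^bsub>A\<^esub> z) \<cdot>\<^bsub>B\<^esub> (Idn B (fob F x) \<odot>\<^bsub>B\<^esub> fun2 F y z)
     = fun2 F (x \<otimes>\<^bsub>A\<^esub> y) z \<cdot>\<^bsub>B\<^esub> (fun2 F x y \<odot>\<^bsub>B\<^esub> Idn B (fob F z)) \<cdot>\<^bsub>B\<^esub> Ass B (fob F x) (fob F y) (fob F z)"
  using sym_mon_functor.fun2_Ass[OF smf(1)] by (simp add: smf)

lemma fun0_Rgt:
  "x \<in> Ob A \<Longrightarrow> far F (Rgt A x) \<cdot>\<^bsub>B\<^esub> fun2 F x (Unt A) \<cdot>\<^bsub>B\<^esub> (Idn B (fob F x) \<odot>\<^bsub>B\<^esub> fun0 F) = Rgt B (fob F x)"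
  and fun0_Lft:
  "x \<in> Ob A \<Longrightarrow> far F (Lft A x) \<cdot>\<^bsub>B\<^esub> fun2 F (Unt A) x \<cdot>\<^bsub>B\<^esub> (fun0 F \<odot>\<^bsub>B\<^esub> Idn B (fob F x)) = Lft B (fob F x)"
  and fun2_Sym:
  "\<lbrakk>x \<in> Ob A; y \<in> Ob A\<rbrakk>
   \<Longrightarrow> far F (Sym A x y) \<cdot>\<^bsub>B\<^esub> fun2 F x y = fun2 F y x \<cdot>\<^bsub>B\<^esub> Sym B (fob F x) (fob F y)"
  using sym_mon_functor.fun_Rgt[OF smf(1)] sym_mon_functor.fun_Lft[OF smf(1)]
    sym_mon_functor.fun2_Sym[OF smf(1)] by (simp_all add: smf)

lemma smf_extensional:
  "fob F \<in> extensional (Ob A)" "far F \<in> extensional (Ar A)" "fun2 F \<in> extensional (Ob A)"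
  "x \<in> Ob A \<Longrightarrow> fun2 F x \<in> extensional (Ob A)"
  using sym_mon_functor.fob_ext[OF smf(1)] sym_mon_functor.far_ext[OF smf(1)]
    sym_mon_functor.fun2_ext[OF smf(1)] sym_mon_functor.fun2_ext'[OF smf(1), of x] by (simp_all add: smf)

lemma far_iso:
  assumes "is_iso A f"
  shows "is_iso B (far F f)" "inverse_of B (far F f) = far F (inverse_of A f)"
proof -
  note f = A.iso_Ar[OF assms] assms
  have "far F (inverse_of A f) \<cdot>\<^bsub>B\<^esub> far F f = Idn B (fob F (Dom A f))"
    "far F f \<cdot>\<^bsub>B\<^esub> far F (inverse_of A f) = Idn B (fob F (Cod A f))"
    using f by (simp_all flip: far_comp)
  then show "is_iso B (far F f)" "inverse_of B (far F f) = far F (inverse_of A f)"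
    using f B.isoI[of "far F f" "far F (inverse_of A f)"] by simp_all
qed

end

lemma smfI:
  fixes F :: "('oa, 'ma, 'ob, 'mb) smf"
  assumes "fdom F = A" "fcod F = B"
    and ext: "fob F \<in> extensional (Ob A)" "far F \<in> extensional (Ar A)" "fun2 F \<in> extensional (Ob A)"
      "\<And>x. x \<in> Ob A \<Longrightarrow> fun2 F x \<in> extensional (Ob A)"
    and fob: "\<And>x. x \<in> Ob A \<Longrightarrow> fob F x \<in> Ob B"
    and far: "\<And>f. f \<in> Ar A \<Longrightarrow> far F f \<in> Ar B \<and> Dom B (far F f) = fob F (Dom A f) \<and> Cod B (far F f) = fob F (Cod A f)"
    and unit: "\<And>x. x \<in> Ob A \<Longrightarrow> far F (Idn A x) = Idn B (fob F x)"
    and comp: "\<And>f g. \<lbrakk>g \<in> Ar A; f \<in> Ar A; Dom A g = Cod A f\<rbrakk> \<Longrightarrow> far F (g \<cdot>\<^bsub>A\<^esub> f) = far F g \<cdot>\<^bsub>B\<^esub> far F f"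
    and fun0: "fun0 F \<in> Ar B \<and> Dom B (fun0 F) = Unt B \<and> Cod B (fun0 F) = fob F (Unt A)"
    and fun2: "\<And>x y. \<lbrakk>x \<in> Ob A; y \<in> Ob A\<rbrakk> \<Longrightarrow> fun2 F x y \<in> Ar B
      \<and> Dom B (fun2 F x y) = fob F x \<otimes>\<^bsub>B\<^esub> fob F y \<and> Cod B (fun2 F x y) = fob F (x \<otimes>\<^bsub>A\<^esub> y)"
    and natural: "\<And>f g. \<lbrakk>f \<in> Ar A; g \<in> Ar A\<rbrakk>
      \<Longrightarrow> far F (f \<odot>\<^bsub>A\<^esub> g) \<cdot>\<^bsub>B\<^esub> fun2 F (Dom A f) (Dom A g) = fun2 F (Cod A f) (Cod A g) \<cdot>\<^bsub>B\<^esub> (far F f \<odot>\<^bsub>B\<^esub> far F g)"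
    and Ass: "\<And>x y z. \<lbrakk>x \<in> Ob A; y \<in> Ob A; z \<in> Ob A\<rbrakk>
      \<Longrightarrow> far F (Ass A x y z) \<cdot>\<^bsub>B\<^esub> fun2 F x (y \<otimes>\<^bsub>A\<^esub> z) \<cdot>\<^bsub>B\<^esub> (Idn B (fob F x) \<odot>\<^bsub>B\<^esub> fun2 F y z)
        = fun2 F (x \<otimes>\<^bsub>A\<^esub> y) z \<cdot>\<^bsub>B\<^esub> (fun2 F x y \<odot>\<^bsub>B\<^esub> Idn B (fob F z)) \<cdot>\<^bsub>B\<^esub> Ass B (fob F x) (fob F y) (fob F z)"
    and Rgt: "\<And>x. x \<in> Ob A
      \<Longrightarrow> far F (Rgt A x) \<cdot>\<^bsub>B\<^esub> fun2 F x (Unt A) \<cdot>\<^bsub>B\<^esub> (Idn B (fob F x) \<odot>\<^bsub>B\<^esub> fun0 F) = Rgt B (fob F x)"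
    and Lft: "\<And>x. x \<in> Ob A
      \<Longrightarrow> far F (Lft A x) \<cdot>\<^bsub>B\<^esub> fun2 F (Unt A) x \<cdot>\<^bsub>B\<^esub> (fun0 F \<odot>\<^bsub>B\<^esub> Idn B (fob F x)) = Lft B (fob F x)"
    and Sym: "\<And>x y. \<lbrakk>x \<in> Ob A; y \<in> Ob A\<rbrakk>
      \<Longrightarrow> far F (Sym A x y) \<cdot>\<^bsub>B\<^esub> fun2 F x y = fun2 F y x \<cdot>\<^bsub>B\<^esub> Sym B (fob F x) (fob F y)"
  shows "F \<in> Ob \<lbrakk>A, B\<rbrakk>\<^sub>0"
proof -
  have "sym_mon_functor F"
    by (rule sym_mon_functor.intro; unfold assms(1,2) Hom_iff; clarify?;
        (rule A.sym_mon_category_axioms B.sym_mon_category_axioms ext fob far unit comp fun0 fun2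
          natural Ass Rgt Lft Sym; assumption))
  then show ?thesis using assms(1,2) unfolding hom_Ob_iff by blast
qed

lemma smf_eqI:
  fixes F G :: "('oa, 'ma, 'ob, 'mb) smf"
  assumes F: "F \<in> Ob \<lbrakk>A, B\<rbrakk>\<^sub>0" and G: "G \<in> Ob \<lbrakk>A, B\<rbrakk>\<^sub>0"
    and "\<And>x. x \<in> Ob A \<Longrightarrow> fob F x = fob G x"
    and "\<And>f. f \<in> Ar A \<Longrightarrow> far F f = far G f"
    and "fun0 F = fun0 G"
    and "\<And>x y. \<lbrakk>x \<in> Ob A; y \<in> Ob A\<rbrakk> \<Longrightarrow> fun2 F x y = fun2 G x y"
  shows "F = G"
proof -
  have "fob F = fob G" "far F = far G"
    using assms smf_extensional[OF F] smf_extensional[OF G] by (auto intro: extensionalityI)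
  moreover have "fun2 F = fun2 G"
    by (rule extensionalityI[OF smf_extensional(3)[OF F] smf_extensional(3)[OF G]],
        rule extensionalityI[OF smf_extensional(4)[OF F] smf_extensional(4)[OF G]]) (use assms in auto)
  ultimately show ?thesis using assms by (intro smf.equality) simp_all
qed

context
  fixes \<sigma> :: "('oa, 'ma, 'ob, 'mb) mnt"
  assumes \<sigma>: "\<sigma> \<in> Ar \<lbrakk>A, B\<rbrakk>\<^sub>0"
begin

private lemma mnt: "mon_nat_trans \<sigma>" "fdom (ndom \<sigma>) = A" "fcod (ndom \<sigma>) = B"
  using \<sigma> by (simp_all add: hom_Ar_iff)

lemma ndom_in [simp]: "ndom \<sigma> \<in> Ob \<lbrakk>A, B\<rbrakk>\<^sub>0"
  and ncod_in [simp]: "ncod \<sigma> \<in> Ob \<lbrakk>A, B\<rbrakk>\<^sub>0"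
  using mon_nat_trans.ndom_smf[OF mnt(1)] mon_nat_trans.ncod_smf[OF mnt(1)]
    mon_nat_trans.fdom_ncod[OF mnt(1)] mon_nat_trans.fcod_ncod[OF mnt(1)] mnt
  unfolding hom_Ob_iff by simp_all

lemma ncomp_typing [simp]:
  assumes "x \<in> Ob A"
  shows "ncomp \<sigma> x \<in> Ar B" "Dom B (ncomp \<sigma> x) = fob (ndom \<sigma>) x" "Cod B (ncomp \<sigma> x) = fob (ncod \<sigma>) x"
  using mon_nat_trans.ncomp_Hom[OF mnt(1), of x] assms by (simp_all add: mnt Hom_iff)

lemma ncomp_extensional: "ncomp \<sigma> \<in> extensional (Ob A)"
  using mon_nat_trans.ncomp_ext[OF mnt(1)] by (simp add: mnt)

lemma ncomp_natural:
  "\<lbrakk>f \<in> Ar A; Cod A f = y\<rbrakk> \<Longrightarrow> ncomp \<sigma> y \<cdot>\<^bsub>B\<^esub> far (ndom \<sigma>) f = far (ncod \<sigma>) f \<cdot>\<^bsub>B\<^esub> ncomp \<sigma> (Dom A f)"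
  using mon_nat_trans.ncomp_nat[OF mnt(1), of f "Dom A f" y] by (simp add: mnt Hom_iff)

lemma ncomp_fun0: "ncomp \<sigma> (Unt A) \<cdot>\<^bsub>B\<^esub> fun0 (ndom \<sigma>) = fun0 (ncod \<sigma>)"
  using mon_nat_trans.ncomp_fun0[OF mnt(1)] by (simp add: mnt)

lemma ncomp_fun2:
  "\<lbrakk>x \<in> Ob A; y \<in> Ob A\<rbrakk>
   \<Longrightarrow> ncomp \<sigma> (x \<otimes>\<^bsub>A\<^esub> y) \<cdot>\<^bsub>B\<^esub> fun2 (ndom \<sigma>) x y = fun2 (ncod \<sigma>) x y \<cdot>\<^bsub>B\<^esub> (ncomp \<sigma> x \<odot>\<^bsub>B\<^esub> ncomp \<sigma> y)"
  using mon_nat_trans.ncomp_fun2[OF mnt(1)] by (simp add: mnt)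

end

lemma mntI:
  fixes \<sigma> :: "('oa, 'ma, 'ob, 'mb) mnt"
  assumes dom: "ndom \<sigma> \<in> Ob \<lbrakk>A, B\<rbrakk>\<^sub>0" and cod: "ncod \<sigma> \<in> Ob \<lbrakk>A, B\<rbrakk>\<^sub>0"
    and ext: "ncomp \<sigma> \<in> extensional (Ob A)"
    and typing: "\<And>x. x \<in> Ob A \<Longrightarrow> ncomp \<sigma> x \<in> Ar B \<and> Dom B (ncomp \<sigma> x) = fob (ndom \<sigma>) x
      \<and> Cod B (ncomp \<sigma> x) = fob (ncod \<sigma>) x"
    and natural: "\<And>f. f \<in> Ar A
      \<Longrightarrow> ncomp \<sigma> (Cod A f) \<cdot>\<^bsub>B\<^esub> far (ndom \<sigma>) f = far (ncod \<sigma>) f \<cdot>\<^bsub>B\<^esub> ncomp \<sigma> (Dom A f)"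
    and fun0: "ncomp \<sigma> (Unt A) \<cdot>\<^bsub>B\<^esub> fun0 (ndom \<sigma>) = fun0 (ncod \<sigma>)"
    and fun2: "\<And>x y. \<lbrakk>x \<in> Ob A; y \<in> Ob A\<rbrakk>
      \<Longrightarrow> ncomp \<sigma> (x \<otimes>\<^bsub>A\<^esub> y) \<cdot>\<^bsub>B\<^esub> fun2 (ndom \<sigma>) x y = fun2 (ncod \<sigma>) x y \<cdot>\<^bsub>B\<^esub> (ncomp \<sigma> x \<odot>\<^bsub>B\<^esub> ncomp \<sigma> y)"
  shows "\<sigma> \<in> Ar \<lbrakk>A, B\<rbrakk>\<^sub>0"
proof -
  have smf: "sym_mon_functor (ndom \<sigma>)" "sym_mon_functor (ncod \<sigma>)"
    "fdom (ndom \<sigma>) = A" "fcod (ndom \<sigma>) = B" "fdom (ncod \<sigma>) = A" "fcod (ncod \<sigma>) = B"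
    using dom cod unfolding hom_Ob_iff by blast+
  have "mon_nat_trans \<sigma>"
    by (rule mon_nat_trans.intro, unfold smf(3-6) Hom_iff)
      (rule smf refl ext typing fun0 fun2 | assumption | clarify, rule natural)+
  then show ?thesis using smf unfolding hom_Ar_iff by blast
qed

lemma mnt_eqI:
  fixes \<sigma> \<tau> :: "('oa, 'ma, 'ob, 'mb) mnt"
  assumes \<sigma>: "\<sigma> \<in> Ar \<lbrakk>A, B\<rbrakk>\<^sub>0" and \<tau>: "\<tau> \<in> Ar \<lbrakk>A, B\<rbrakk>\<^sub>0"
    and "ndom \<sigma> = ndom \<tau>" "ncod \<sigma> = ncod \<tau>" "\<And>x. x \<in> Ob A \<Longrightarrow> ncomp \<sigma> x = ncomp \<tau> x"
  shows "\<sigma> = \<tau>"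
  using assms extensionalityI[OF ncomp_extensional[OF \<sigma>] ncomp_extensional[OF \<tau>]]
  by (intro mnt.equality) simp_all

end

lemma smc_hom_of_functor: "F \<in> Ob \<lbrakk>A, B\<rbrakk>\<^sub>0 \<Longrightarrow> smc_hom A B"
  using sym_mon_functor.fdom_smc[of F] sym_mon_functor.fcod_smc[of F]
  by (auto simp: hom_Ob_iff smc_hom_def)

section \<open>The internal hom is symmetric monoidal\<close>

context smc_hom
begin

lemma tensor_simps [simp]:
  fixes F G :: "('oa, 'ma, 'ob, 'mb) smf"
  assumes "F \<in> Ob \<lbrakk>A, B\<rbrakk>\<^sub>0"
  shows "fdom (smf_tensor F G) = A" "fcod (smf_tensor F G) = B"
    "x \<in> Ob A \<Longrightarrow> fob (smf_tensor F G) x = fob F x \<otimes>\<^bsub>B\<^esub> fob G x"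
    "f \<in> Ar A \<Longrightarrow> far (smf_tensor F G) f = far F f \<odot>\<^bsub>B\<^esub> far G f"
    "fun0 (smf_tensor F G) = (fun0 F \<odot>\<^bsub>B\<^esub> fun0 G) \<cdot>\<^bsub>B\<^esub> inverse_of B (Rgt B (Unt B))"
    "\<lbrakk>x \<in> Ob A; y \<in> Ob A\<rbrakk> \<Longrightarrow> fun2 (smf_tensor F G) x y
      = (fun2 F x y \<odot>\<^bsub>B\<^esub> fun2 G x y) \<cdot>\<^bsub>B\<^esub> B.mid (fob F x) (fob G x) (fob F y) (fob G y)"
    and tensor_extensional: "fob (smf_tensor F G) \<in> extensional (Ob A)" "far (smf_tensor F G) \<in> extensional (Ar A)"
    "fun2 (smf_tensor F G) \<in> extensional (Ob A)" "x \<in> Ob A \<Longrightarrow> fun2 (smf_tensor F G) x \<in> extensional (Ob A)"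
  using assms by (simp_all add: smf_tensor_def Let_def)

text \<open>Each axiom for \<open>smf_tensor F G\<close> is the tensor product of the axioms for \<open>F\<close> and \<open>G\<close>, once the
  interchange has been moved out of the way by its own coherence law of the same kind.\<close>

lemma tensor_in [simp]:
  assumes [simp]: "F \<in> Ob \<lbrakk>A, B\<rbrakk>\<^sub>0" "G \<in> Ob \<lbrakk>A, B\<rbrakk>\<^sub>0"
  shows "smf_tensor F G \<in> Ob \<lbrakk>A, B\<rbrakk>\<^sub>0" (is "?FG \<in> _")
proof (rule smfI)
  fix x y z assume [simp]: "x \<in> Ob A" "y \<in> Ob A" "z \<in> Ob A"
  let ?\<phi> = "fun2 F" and ?\<gamma> = "fun2 G" and ?F = "fob F" and ?G = "fob G"
  have "far ?FG (Ass A x y z) \<cdot>\<^bsub>B\<^esub> fun2 ?FG x (y \<otimes>\<^bsub>A\<^esub> z) \<cdot>\<^bsub>B\<^esub> (Idn B (fob ?FG x) \<odot>\<^bsub>B\<^esub> fun2 ?FG y z)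
     = (far F (Ass A x y z) \<odot>\<^bsub>B\<^esub> far G (Ass A x y z)) \<cdot>\<^bsub>B\<^esub> (?\<phi> x (y \<otimes>\<^bsub>A\<^esub> z) \<odot>\<^bsub>B\<^esub> ?\<gamma> x (y \<otimes>\<^bsub>A\<^esub> z))
       \<cdot>\<^bsub>B\<^esub> (B.mid (?F x) (?G x) (?F (y \<otimes>\<^bsub>A\<^esub> z)) (?G (y \<otimes>\<^bsub>A\<^esub> z))
         \<cdot>\<^bsub>B\<^esub> (Idn B (?F x \<otimes>\<^bsub>B\<^esub> ?G x) \<odot>\<^bsub>B\<^esub> (?\<phi> y z \<odot>\<^bsub>B\<^esub> ?\<gamma> y z)))
       \<cdot>\<^bsub>B\<^esub> (Idn B (?F x \<otimes>\<^bsub>B\<^esub> ?G x) \<odot>\<^bsub>B\<^esub> B.mid (?F y) (?G y) (?F z) (?G z))"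
    by (simp add: B.TAr_Cmp_right)
  also have "\<dots> = ((far F (Ass A x y z) \<cdot>\<^bsub>B\<^esub> ?\<phi> x (y \<otimes>\<^bsub>A\<^esub> z) \<cdot>\<^bsub>B\<^esub> (Idn B (?F x) \<odot>\<^bsub>B\<^esub> ?\<phi> y z))
         \<odot>\<^bsub>B\<^esub> (far G (Ass A x y z) \<cdot>\<^bsub>B\<^esub> ?\<gamma> x (y \<otimes>\<^bsub>A\<^esub> z) \<cdot>\<^bsub>B\<^esub> (Idn B (?G x) \<odot>\<^bsub>B\<^esub> ?\<gamma> y z)))
       \<cdot>\<^bsub>B\<^esub> B.mid (?F x) (?G x) (?F y \<otimes>\<^bsub>B\<^esub> ?F z) (?G y \<otimes>\<^bsub>B\<^esub> ?G z)
       \<cdot>\<^bsub>B\<^esub> (Idn B (?F x \<otimes>\<^bsub>B\<^esub> ?G x) \<odot>\<^bsub>B\<^esub> B.mid (?F y) (?G y) (?F z) (?G z))"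
    by (simp add: B.mid_natural_right B.interchange B.interchange')
  also have "\<dots> = ((?\<phi> (x \<otimes>\<^bsub>A\<^esub> y) z \<cdot>\<^bsub>B\<^esub> (?\<phi> x y \<odot>\<^bsub>B\<^esub> Idn B (?F z))) \<odot>\<^bsub>B\<^esub> (?\<gamma> (x \<otimes>\<^bsub>A\<^esub> y) z \<cdot>\<^bsub>B\<^esub> (?\<gamma> x y \<odot>\<^bsub>B\<^esub> Idn B (?G z))))
       \<cdot>\<^bsub>B\<^esub> ((Ass B (?F x) (?F y) (?F z) \<odot>\<^bsub>B\<^esub> Ass B (?G x) (?G y) (?G z))
       \<cdot>\<^bsub>B\<^esub> B.mid (?F x) (?G x) (?F y \<otimes>\<^bsub>B\<^esub> ?F z) (?G y \<otimes>\<^bsub>B\<^esub> ?G z)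
       \<cdot>\<^bsub>B\<^esub> (Idn B (?F x \<otimes>\<^bsub>B\<^esub> ?G x) \<odot>\<^bsub>B\<^esub> B.mid (?F y) (?G y) (?F z) (?G z)))"
    by (simp add: fun2_assoc B.interchange')
  also have "\<dots> = (?\<phi> (x \<otimes>\<^bsub>A\<^esub> y) z \<odot>\<^bsub>B\<^esub> ?\<gamma> (x \<otimes>\<^bsub>A\<^esub> y) z)
       \<cdot>\<^bsub>B\<^esub> (((?\<phi> x y \<odot>\<^bsub>B\<^esub> Idn B (?F z)) \<odot>\<^bsub>B\<^esub> (?\<gamma> x y \<odot>\<^bsub>B\<^esub> Idn B (?G z)))
         \<cdot>\<^bsub>B\<^esub> B.mid (?F x \<otimes>\<^bsub>B\<^esub> ?F y) (?G x \<otimes>\<^bsub>B\<^esub> ?G y) (?F z) (?G z))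
       \<cdot>\<^bsub>B\<^esub> (B.mid (?F x) (?G x) (?F y) (?G y) \<odot>\<^bsub>B\<^esub> Idn B (?F z \<otimes>\<^bsub>B\<^esub> ?G z))
       \<cdot>\<^bsub>B\<^esub> Ass B (?F x \<otimes>\<^bsub>B\<^esub> ?G x) (?F y \<otimes>\<^bsub>B\<^esub> ?G y) (?F z \<otimes>\<^bsub>B\<^esub> ?G z)"
    by (simp add: B.mid_assoc B.interchange')
  also have "\<dots> = fun2 ?FG (x \<otimes>\<^bsub>A\<^esub> y) z \<cdot>\<^bsub>B\<^esub> (fun2 ?FG x y \<odot>\<^bsub>B\<^esub> Idn B (fob ?FG z))
      \<cdot>\<^bsub>B\<^esub> Ass B (fob ?FG x) (fob ?FG y) (fob ?FG z)"
    by (simp add: B.TAr_Cmp_left B.mid_natural_left[THEN B.reassoc])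
  finally show "far ?FG (Ass A x y z) \<cdot>\<^bsub>B\<^esub> fun2 ?FG x (y \<otimes>\<^bsub>A\<^esub> z) \<cdot>\<^bsub>B\<^esub> (Idn B (fob ?FG x) \<odot>\<^bsub>B\<^esub> fun2 ?FG y z)
    = fun2 ?FG (x \<otimes>\<^bsub>A\<^esub> y) z \<cdot>\<^bsub>B\<^esub> (fun2 ?FG x y \<odot>\<^bsub>B\<^esub> Idn B (fob ?FG z))
      \<cdot>\<^bsub>B\<^esub> Ass B (fob ?FG x) (fob ?FG y) (fob ?FG z)" .
next
  fix x assume [simp]: "x \<in> Ob A"
  let ?r' = "inverse_of B (Rgt B (Unt B))"
  have "far ?FG (Rgt A x) \<cdot>\<^bsub>B\<^esub> fun2 ?FG x (Unt A) \<cdot>\<^bsub>B\<^esub> (Idn B (fob ?FG x) \<odot>\<^bsub>B\<^esub> fun0 ?FG)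
      = (far F (Rgt A x) \<odot>\<^bsub>B\<^esub> far G (Rgt A x)) \<cdot>\<^bsub>B\<^esub> (fun2 F x (Unt A) \<odot>\<^bsub>B\<^esub> fun2 G x (Unt A))
        \<cdot>\<^bsub>B\<^esub> ((Idn B (fob F x) \<odot>\<^bsub>B\<^esub> fun0 F) \<odot>\<^bsub>B\<^esub> (Idn B (fob G x) \<odot>\<^bsub>B\<^esub> fun0 G))
        \<cdot>\<^bsub>B\<^esub> B.mid (fob F x) (fob G x) (Unt B) (Unt B) \<cdot>\<^bsub>B\<^esub> (Idn B (fob F x \<otimes>\<^bsub>B\<^esub> fob G x) \<odot>\<^bsub>B\<^esub> ?r')"
    by (simp add: B.TAr_Cmp_right B.mid_natural_right[THEN B.reassoc])
  also have "\<dots> = ((far F (Rgt A x) \<cdot>\<^bsub>B\<^esub> fun2 F x (Unt A) \<cdot>\<^bsub>B\<^esub> (Idn B (fob F x) \<odot>\<^bsub>B\<^esub> fun0 F))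
          \<odot>\<^bsub>B\<^esub> (far G (Rgt A x) \<cdot>\<^bsub>B\<^esub> fun2 G x (Unt A) \<cdot>\<^bsub>B\<^esub> (Idn B (fob G x) \<odot>\<^bsub>B\<^esub> fun0 G)))
        \<cdot>\<^bsub>B\<^esub> B.mid (fob F x) (fob G x) (Unt B) (Unt B) \<cdot>\<^bsub>B\<^esub> (Idn B (fob F x \<otimes>\<^bsub>B\<^esub> fob G x) \<odot>\<^bsub>B\<^esub> ?r')"
    by (simp add: B.interchange')
  also have "\<dots> = Rgt B (fob ?FG x)"
    by (simp add: fun0_Rgt B.mid_Rgt[THEN B.reassoc] B.whiskers)
  finally show "far ?FG (Rgt A x) \<cdot>\<^bsub>B\<^esub> fun2 ?FG x (Unt A) \<cdot>\<^bsub>B\<^esub> (Idn B (fob ?FG x) \<odot>\<^bsub>B\<^esub> fun0 ?FG) = Rgt B (fob ?FG x)" .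
  have "far ?FG (Lft A x) \<cdot>\<^bsub>B\<^esub> fun2 ?FG (Unt A) x \<cdot>\<^bsub>B\<^esub> (fun0 ?FG \<odot>\<^bsub>B\<^esub> Idn B (fob ?FG x))
      = (far F (Lft A x) \<odot>\<^bsub>B\<^esub> far G (Lft A x)) \<cdot>\<^bsub>B\<^esub> (fun2 F (Unt A) x \<odot>\<^bsub>B\<^esub> fun2 G (Unt A) x)
        \<cdot>\<^bsub>B\<^esub> ((fun0 F \<odot>\<^bsub>B\<^esub> Idn B (fob F x)) \<odot>\<^bsub>B\<^esub> (fun0 G \<odot>\<^bsub>B\<^esub> Idn B (fob G x)))
        \<cdot>\<^bsub>B\<^esub> B.mid (Unt B) (Unt B) (fob F x) (fob G x) \<cdot>\<^bsub>B\<^esub> (?r' \<odot>\<^bsub>B\<^esub> Idn B (fob F x \<otimes>\<^bsub>B\<^esub> fob G x))"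
    by (simp add: B.TAr_Cmp_left B.mid_natural_left[THEN B.reassoc])
  also have "\<dots> = ((far F (Lft A x) \<cdot>\<^bsub>B\<^esub> fun2 F (Unt A) x \<cdot>\<^bsub>B\<^esub> (fun0 F \<odot>\<^bsub>B\<^esub> Idn B (fob F x)))
          \<odot>\<^bsub>B\<^esub> (far G (Lft A x) \<cdot>\<^bsub>B\<^esub> fun2 G (Unt A) x \<cdot>\<^bsub>B\<^esub> (fun0 G \<odot>\<^bsub>B\<^esub> Idn B (fob G x))))
        \<cdot>\<^bsub>B\<^esub> B.mid (Unt B) (Unt B) (fob F x) (fob G x) \<cdot>\<^bsub>B\<^esub> (?r' \<odot>\<^bsub>B\<^esub> Idn B (fob F x \<otimes>\<^bsub>B\<^esub> fob G x))"
    by (simp add: B.interchange')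
  also have "\<dots> = Lft B (fob ?FG x)"
    by (simp add: fun0_Lft B.mid_Lft[THEN B.reassoc] B.whiskers)
  finally show "far ?FG (Lft A x) \<cdot>\<^bsub>B\<^esub> fun2 ?FG (Unt A) x \<cdot>\<^bsub>B\<^esub> (fun0 ?FG \<odot>\<^bsub>B\<^esub> Idn B (fob ?FG x)) = Lft B (fob ?FG x)" .
next
  fix x y assume [simp]: "x \<in> Ob A" "y \<in> Ob A"
  show "far ?FG (Sym A x y) \<cdot>\<^bsub>B\<^esub> fun2 ?FG x y
      = fun2 ?FG y x \<cdot>\<^bsub>B\<^esub> Sym B (fob ?FG x) (fob ?FG y)"
    by (simp add: B.interchange' fun2_Sym flip: B.mid_Sym)
qed (auto simp: tensor_extensional B.interchange B.interchange' fun2_natural B.mid_natural)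

end

lemma mnt_boundary_simps [simp]:
  "ndom (mnt_id F) = F" "ncod (mnt_id F) = F"
  "ndom (mnt_vcomp \<tau> \<sigma>) = ndom \<sigma>" "ncod (mnt_vcomp \<tau> \<sigma>) = ncod \<tau>"
  "ndom (mnt_tensor \<sigma> \<rho>) = smf_tensor (ndom \<sigma>) (ndom \<rho>)" "ncod (mnt_tensor \<sigma> \<rho>) = smf_tensor (ncod \<sigma>) (ncod \<rho>)"
  by (simp_all add: mnt_id_def mnt_vcomp_def mnt_tensor_def)

lemma hom_structure_simps [simp]:
  "ndom (Ass \<lbrakk>A, B\<rbrakk>\<^sub>0 F G H) = smf_tensor F (smf_tensor G H)"
  "ncod (Ass \<lbrakk>A, B\<rbrakk>\<^sub>0 F G H) = smf_tensor (smf_tensor F G) H"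
  "a \<in> Ob A \<Longrightarrow> ncomp (Ass \<lbrakk>A, B\<rbrakk>\<^sub>0 F G H) a = Ass B (fob F a) (fob G a) (fob H a)"
  "ndom (Rgt \<lbrakk>A, B\<rbrakk>\<^sub>0 F) = smf_tensor F (smf_const A B)" "ncod (Rgt \<lbrakk>A, B\<rbrakk>\<^sub>0 F) = F"
  "a \<in> Ob A \<Longrightarrow> ncomp (Rgt \<lbrakk>A, B\<rbrakk>\<^sub>0 F) a = Rgt B (fob F a)"
  "ndom (Lft \<lbrakk>A, B\<rbrakk>\<^sub>0 F) = smf_tensor (smf_const A B) F" "ncod (Lft \<lbrakk>A, B\<rbrakk>\<^sub>0 F) = F"
  "a \<in> Ob A \<Longrightarrow> ncomp (Lft \<lbrakk>A, B\<rbrakk>\<^sub>0 F) a = Lft B (fob F a)"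
  "ndom (Sym \<lbrakk>A, B\<rbrakk>\<^sub>0 F G) = smf_tensor F G" "ncod (Sym \<lbrakk>A, B\<rbrakk>\<^sub>0 F G) = smf_tensor G F"
  "a \<in> Ob A \<Longrightarrow> ncomp (Sym \<lbrakk>A, B\<rbrakk>\<^sub>0 F G) a = Sym B (fob F a) (fob G a)"
  and hom_structure_extensional [simp]:
  "ncomp (Ass \<lbrakk>A, B\<rbrakk>\<^sub>0 F G H) \<in> extensional (Ob A)" "ncomp (Rgt \<lbrakk>A, B\<rbrakk>\<^sub>0 F) \<in> extensional (Ob A)"
  "ncomp (Lft \<lbrakk>A, B\<rbrakk>\<^sub>0 F) \<in> extensional (Ob A)" "ncomp (Sym \<lbrakk>A, B\<rbrakk>\<^sub>0 F G) \<in> extensional (Ob A)"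
  by (simp_all add: hom_smc_def)

lemma const_simps [simp]:
  "fdom (smf_const A B) = A" "fcod (smf_const A B) = B"
  "x \<in> Ob A \<Longrightarrow> fob (smf_const A B) x = Unt B" "f \<in> Ar A \<Longrightarrow> far (smf_const A B) f = Idn B (Unt B)"
  "fun0 (smf_const A B) = Idn B (Unt B)"
  "\<lbrakk>x \<in> Ob A; y \<in> Ob A\<rbrakk> \<Longrightarrow> fun2 (smf_const A B) x y = Rgt B (Unt B)"
  by (simp_all add: smf_const_def)

context smc_hom
begin

lemma const_in [simp]: "smf_const A B \<in> Ob \<lbrakk>A, B\<rbrakk>\<^sub>0" (is "?I \<in> _")
proof (rule smfI)
  fix x y z assume [simp]: "x \<in> Ob A" "y \<in> Ob A" "z \<in> Ob A"
  show "far ?I (Ass A x y z) \<cdot>\<^bsub>B\<^esub> fun2 ?I x (y \<otimes>\<^bsub>A\<^esub> z)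
      \<cdot>\<^bsub>B\<^esub> (Idn B (fob ?I x) \<odot>\<^bsub>B\<^esub> fun2 ?I y z)
    = fun2 ?I (x \<otimes>\<^bsub>A\<^esub> y) z \<cdot>\<^bsub>B\<^esub> (fun2 ?I x y \<odot>\<^bsub>B\<^esub> Idn B (fob ?I z))
      \<cdot>\<^bsub>B\<^esub> Ass B (fob ?I x) (fob ?I y) (fob ?I z)"
    using B.triangle[of "Unt B" "Unt B"] by (simp add: B.Rgt_Unt)
qed (use B.Lft_Sym[of "Unt B"] in \<open>simp_all add: B.Rgt_Unt, simp_all add: smf_const_def\<close>)

lemma mnt_simps [simp]:
  assumes "\<sigma> \<in> Ar \<lbrakk>A, B\<rbrakk>\<^sub>0" "x \<in> Ob A"
  shows "ncomp (mnt_vcomp \<tau> \<sigma>) x = ncomp \<tau> x \<cdot>\<^bsub>B\<^esub> ncomp \<sigma> x"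
    "ncomp (mnt_tensor \<sigma> \<tau>) x = ncomp \<sigma> x \<odot>\<^bsub>B\<^esub> ncomp \<tau> x"
  using assms by (simp_all add: mnt_vcomp_def mnt_tensor_def)

lemma mnt_extensional:
  assumes "\<sigma> \<in> Ar \<lbrakk>A, B\<rbrakk>\<^sub>0"
  shows "ncomp (mnt_vcomp \<tau> \<sigma>) \<in> extensional (Ob A)" "ncomp (mnt_tensor \<sigma> \<tau>) \<in> extensional (Ob A)"
  using assms by (simp_all add: mnt_vcomp_def mnt_tensor_def)

lemma mnt_id_simps [simp]:
  assumes "F \<in> Ob \<lbrakk>A, B\<rbrakk>\<^sub>0"
  shows "x \<in> Ob A \<Longrightarrow> ncomp (mnt_id F) x = Idn B (fob F x)" "ncomp (mnt_id F) \<in> extensional (Ob A)"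
  using assms by (simp_all add: mnt_id_def)

lemma mnt_id_in [simp]:
  assumes [simp]: "F \<in> Ob \<lbrakk>A, B\<rbrakk>\<^sub>0"
  shows "mnt_id F \<in> Ar \<lbrakk>A, B\<rbrakk>\<^sub>0"
  by (rule mntI) simp_all

lemma vcomp_in [simp]:
  assumes [simp]: "\<tau> \<in> Ar \<lbrakk>A, B\<rbrakk>\<^sub>0" "\<sigma> \<in> Ar \<lbrakk>A, B\<rbrakk>\<^sub>0" "ndom \<tau> = ncod \<sigma>"
  shows "mnt_vcomp \<tau> \<sigma> \<in> Ar \<lbrakk>A, B\<rbrakk>\<^sub>0" (is "?\<rho> \<in> _")
proof (rule mntI)
  fix f assume [simp]: "f \<in> Ar A"
  show "ncomp ?\<rho> (Cod A f) \<cdot>\<^bsub>B\<^esub> far (ndom ?\<rho>) f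
      = far (ncod ?\<rho>) f \<cdot>\<^bsub>B\<^esub> ncomp ?\<rho> (Dom A f)"
    using ncomp_natural[of \<tau> f, THEN B.reassoc] by (simp add: ncomp_natural)
next
  show "ncomp ?\<rho> (Unt A) \<cdot>\<^bsub>B\<^esub> fun0 (ndom ?\<rho>) = fun0 (ncod ?\<rho>)"
    using ncomp_fun0[of \<tau>] by (simp add: ncomp_fun0)
next
  fix x y assume [simp]: "x \<in> Ob A" "y \<in> Ob A"
  show "ncomp ?\<rho> (x \<otimes>\<^bsub>A\<^esub> y) \<cdot>\<^bsub>B\<^esub> fun2 (ndom ?\<rho>) x y
      = fun2 (ncod ?\<rho>) x y \<cdot>\<^bsub>B\<^esub> (ncomp ?\<rho> x \<odot>\<^bsub>B\<^esub> ncomp ?\<rho> y)"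
    using ncomp_fun2[of \<tau> x y, THEN B.reassoc] by (simp add: ncomp_fun2 B.interchange)
qed (simp_all add: mnt_extensional)

lemma mnt_tensor_in [simp]:
  assumes [simp]: "\<sigma> \<in> Ar \<lbrakk>A, B\<rbrakk>\<^sub>0" "\<tau> \<in> Ar \<lbrakk>A, B\<rbrakk>\<^sub>0"
  shows "mnt_tensor \<sigma> \<tau> \<in> Ar \<lbrakk>A, B\<rbrakk>\<^sub>0"
  by (rule mntI) (simp_all add: mnt_extensional B.interchange B.interchange' ncomp_natural ncomp_fun0
      ncomp_fun2 B.mid_natural)

lemma hom_category: "category \<lbrakk>A, B\<rbrakk>\<^sub>0"
  by (rule category.intro) (auto simp: Hom_iff intro!: mnt_eqI)

sublocale H: category "\<lbrakk>A, B\<rbrakk>\<^sub>0" by (rule hom_category)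

text \<open>Naturality and monoidality are commuting squares, so they pass to componentwise inverses.\<close>

lemma hom_iso:
  assumes \<sigma> [simp]: "\<sigma> \<in> Ar \<lbrakk>A, B\<rbrakk>\<^sub>0" and iso: "\<And>x. x \<in> Ob A \<Longrightarrow> is_iso B (ncomp \<sigma> x)"
  shows "is_iso \<lbrakk>A, B\<rbrakk>\<^sub>0 \<sigma>"
    and ncomp_inverse_of: "x \<in> Ob A \<Longrightarrow> ncomp (inverse_of \<lbrakk>A, B\<rbrakk>\<^sub>0 \<sigma>) x = inverse_of B (ncomp \<sigma> x)"
proof -
  define \<tau> where "\<tau> = \<lparr>ndom = ncod \<sigma>, ncod = ndom \<sigma>, ncomp = (\<lambda>x\<in>Ob A. inverse_of B (ncomp \<sigma> x))\<rparr>"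
  have \<tau>_simps [simp]: "ndom \<tau> = ncod \<sigma>" "ncod \<tau> = ndom \<sigma>" "ncomp \<tau> \<in> extensional (Ob A)"
    "x \<in> Ob A \<Longrightarrow> ncomp \<tau> x = inverse_of B (ncomp \<sigma> x)" for x
    by (simp_all add: \<tau>_def)
  note iso [simp]
  have \<tau> [simp]: "\<tau> \<in> Ar \<lbrakk>A, B\<rbrakk>\<^sub>0"
  proof (rule mntI)
    fix f assume [simp]: "f \<in> Ar A"
    have "inverse_of B (ncomp \<sigma> (Cod A f)) \<cdot>\<^bsub>B\<^esub> far (ncod \<sigma>) f = far (ndom \<sigma>) f \<cdot>\<^bsub>B\<^esub> inverse_of B (ncomp \<sigma> (Dom A f))"
      by (rule B.move_inverses) (simp_all add: ncomp_natural)
    then show "ncomp \<tau> (Cod A f) \<cdot>\<^bsub>B\<^esub> far (ndom \<tau>) f = far (ncod \<tau>) f \<cdot>\<^bsub>B\<^esub> ncomp \<tau> (Dom A f)"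
      by simp
  next
    show "ncomp \<tau> (Unt A) \<cdot>\<^bsub>B\<^esub> fun0 (ndom \<tau>) = fun0 (ncod \<tau>)"
      by (simp add: ncomp_fun0[OF \<sigma>, symmetric])
  next
    fix x y assume [simp]: "x \<in> Ob A" "y \<in> Ob A"
    have "inverse_of B (ncomp \<sigma> (x \<otimes>\<^bsub>A\<^esub> y)) \<cdot>\<^bsub>B\<^esub> fun2 (ncod \<sigma>) x y
        = fun2 (ndom \<sigma>) x y \<cdot>\<^bsub>B\<^esub> inverse_of B (ncomp \<sigma> x \<odot>\<^bsub>B\<^esub> ncomp \<sigma> y)"
      by (rule B.move_inverses) (simp_all add: ncomp_fun2)
    then show "ncomp \<tau> (x \<otimes>\<^bsub>A\<^esub> y) \<cdot>\<^bsub>B\<^esub> fun2 (ndom \<tau>) x y = fun2 (ncod \<tau>) x y \<cdot>\<^bsub>B\<^esub> (ncomp \<tau> x \<odot>\<^bsub>B\<^esub> ncomp \<tau> y)"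
      by (simp add: B.inverse_of_TAr)
  qed simp_all
  have "mnt_vcomp \<tau> \<sigma> = mnt_id (ndom \<sigma>)" "mnt_vcomp \<sigma> \<tau> = mnt_id (ncod \<sigma>)"
    by (auto intro!: mnt_eqI)
  then show "is_iso \<lbrakk>A, B\<rbrakk>\<^sub>0 \<sigma>" "x \<in> Ob A \<Longrightarrow> ncomp (inverse_of \<lbrakk>A, B\<rbrakk>\<^sub>0 \<sigma>) x = inverse_of B (ncomp \<sigma> x)"
    using H.isoI[of \<sigma> \<tau>] by simp_all
qed

text \<open>The structural transformations of the internal hom are monoidal because the associativity,
  unit and symmetry arrows commute with the middle-four interchange.\<close>

lemma hom_Ass_in [simp]:
  assumes [simp]: "F \<in> Ob \<lbrakk>A, B\<rbrakk>\<^sub>0" "G \<in> Ob \<lbrakk>A, B\<rbrakk>\<^sub>0" "H \<in> Ob \<lbrakk>A, B\<rbrakk>\<^sub>0"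
  shows "Ass \<lbrakk>A, B\<rbrakk>\<^sub>0 F G H \<in> Ar \<lbrakk>A, B\<rbrakk>\<^sub>0" (is "?\<sigma> \<in> _")
proof (rule mntI)
  let ?r' = "inverse_of B (Rgt B (Unt B))"
  have "Ass B (fob F (Unt A)) (fob G (Unt A)) (fob H (Unt A)) \<cdot>\<^bsub>B\<^esub> (fun0 F \<odot>\<^bsub>B\<^esub> ((fun0 G \<odot>\<^bsub>B\<^esub> fun0 H) \<cdot>\<^bsub>B\<^esub> ?r')) \<cdot>\<^bsub>B\<^esub> ?r'
      = ((fun0 F \<odot>\<^bsub>B\<^esub> fun0 G) \<odot>\<^bsub>B\<^esub> fun0 H) \<cdot>\<^bsub>B\<^esub> (Ass B (Unt B) (Unt B) (Unt B) \<cdot>\<^bsub>B\<^esub> (Idn B (Unt B) \<odot>\<^bsub>B\<^esub> ?r')) \<cdot>\<^bsub>B\<^esub> ?r'"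
    by (simp add: B.TAr_Cmp_right B.Ass_natural[THEN B.reassoc])
  also have "\<dots> = (((fun0 F \<odot>\<^bsub>B\<^esub> fun0 G) \<cdot>\<^bsub>B\<^esub> ?r') \<odot>\<^bsub>B\<^esub> fun0 H) \<cdot>\<^bsub>B\<^esub> ?r'"
    unfolding B.Ass_Rgt_inverse by (simp add: B.TAr_Cmp_left)
  finally show "ncomp ?\<sigma> (Unt A) \<cdot>\<^bsub>B\<^esub> fun0 (ndom ?\<sigma>) = fun0 (ncod ?\<sigma>)"
    by simp
next
  fix x y assume [simp]: "x \<in> Ob A" "y \<in> Ob A"
  show "ncomp ?\<sigma> (x \<otimes>\<^bsub>A\<^esub> y) \<cdot>\<^bsub>B\<^esub> fun2 (ndom ?\<sigma>) x y
      = fun2 (ncod ?\<sigma>) x y \<cdot>\<^bsub>B\<^esub> (ncomp ?\<sigma> x \<odot>\<^bsub>B\<^esub> ncomp ?\<sigma> y)"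
    by (simp add: B.TAr_Cmp_right B.TAr_Cmp_left B.Ass_natural[THEN B.reassoc] B.mid_assoc')
qed (simp_all add: B.Ass_natural)

lemma hom_Rgt_in [simp]:
  assumes [simp]: "F \<in> Ob \<lbrakk>A, B\<rbrakk>\<^sub>0"
  shows "Rgt \<lbrakk>A, B\<rbrakk>\<^sub>0 F \<in> Ar \<lbrakk>A, B\<rbrakk>\<^sub>0" (is "?\<sigma> \<in> _")
proof (rule mntI)
  fix x y assume [simp]: "x \<in> Ob A" "y \<in> Ob A"
  have "Rgt B (fob F (x \<otimes>\<^bsub>A\<^esub> y)) \<cdot>\<^bsub>B\<^esub> (fun2 F x y \<odot>\<^bsub>B\<^esub> Rgt B (Unt B)) \<cdot>\<^bsub>B\<^esub> B.mid (fob F x) (Unt B) (fob F y) (Unt B)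
      = Rgt B (fob F (x \<otimes>\<^bsub>A\<^esub> y)) \<cdot>\<^bsub>B\<^esub> (fun2 F x y \<odot>\<^bsub>B\<^esub> Idn B (Unt B))
        \<cdot>\<^bsub>B\<^esub> (Idn B (fob F x \<otimes>\<^bsub>B\<^esub> fob F y) \<odot>\<^bsub>B\<^esub> Rgt B (Unt B)) \<cdot>\<^bsub>B\<^esub> B.mid (fob F x) (Unt B) (fob F y) (Unt B)"
    by (simp add: B.interchange')
  also have "\<dots> = fun2 F x y \<cdot>\<^bsub>B\<^esub> (Rgt B (fob F x) \<odot>\<^bsub>B\<^esub> Rgt B (fob F y))"
    by (simp add: B.Rgt_natural[THEN B.reassoc] B.mid_Rgt')
  finally show "ncomp ?\<sigma> (x \<otimes>\<^bsub>A\<^esub> y) \<cdot>\<^bsub>B\<^esub> fun2 (ndom ?\<sigma>) x y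
      = fun2 (ncod ?\<sigma>) x y \<cdot>\<^bsub>B\<^esub> (ncomp ?\<sigma> x \<odot>\<^bsub>B\<^esub> ncomp ?\<sigma> y)"
    by simp
qed (simp_all add: B.Rgt_natural B.Rgt_natural[THEN B.reassoc])

lemma hom_Lft_in [simp]:
  assumes [simp]: "F \<in> Ob \<lbrakk>A, B\<rbrakk>\<^sub>0"
  shows "Lft \<lbrakk>A, B\<rbrakk>\<^sub>0 F \<in> Ar \<lbrakk>A, B\<rbrakk>\<^sub>0" (is "?\<sigma> \<in> _")
proof (rule mntI)
  show "ncomp ?\<sigma> (Unt A) \<cdot>\<^bsub>B\<^esub> fun0 (ndom ?\<sigma>) = fun0 (ncod ?\<sigma>)"
    by (simp add: B.Lft_natural[THEN B.reassoc] B.Rgt_Unt)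
next
  fix x y assume [simp]: "x \<in> Ob A" "y \<in> Ob A"
  have "Lft B (fob F (x \<otimes>\<^bsub>A\<^esub> y)) \<cdot>\<^bsub>B\<^esub> (Rgt B (Unt B) \<odot>\<^bsub>B\<^esub> fun2 F x y) \<cdot>\<^bsub>B\<^esub> B.mid (Unt B) (fob F x) (Unt B) (fob F y)
      = Lft B (fob F (x \<otimes>\<^bsub>A\<^esub> y)) \<cdot>\<^bsub>B\<^esub> (Idn B (Unt B) \<odot>\<^bsub>B\<^esub> fun2 F x y)
        \<cdot>\<^bsub>B\<^esub> (Rgt B (Unt B) \<odot>\<^bsub>B\<^esub> Idn B (fob F x \<otimes>\<^bsub>B\<^esub> fob F y)) \<cdot>\<^bsub>B\<^esub> B.mid (Unt B) (fob F x) (Unt B) (fob F y)"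
    by (simp add: B.interchange')
  also have "\<dots> = fun2 F x y \<cdot>\<^bsub>B\<^esub> (Lft B (fob F x) \<odot>\<^bsub>B\<^esub> Lft B (fob F y))"
    by (simp add: B.Lft_natural[THEN B.reassoc] B.mid_Lft')
  finally show "ncomp ?\<sigma> (x \<otimes>\<^bsub>A\<^esub> y) \<cdot>\<^bsub>B\<^esub> fun2 (ndom ?\<sigma>) x y
      = fun2 (ncod ?\<sigma>) x y \<cdot>\<^bsub>B\<^esub> (ncomp ?\<sigma> x \<odot>\<^bsub>B\<^esub> ncomp ?\<sigma> y)"
    by simp
qed (simp_all add: B.Lft_natural)

lemma hom_Sym_in [simp]:
  assumes [simp]: "F \<in> Ob \<lbrakk>A, B\<rbrakk>\<^sub>0" "G \<in> Ob \<lbrakk>A, B\<rbrakk>\<^sub>0"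
  shows "Sym \<lbrakk>A, B\<rbrakk>\<^sub>0 F G \<in> Ar \<lbrakk>A, B\<rbrakk>\<^sub>0"
  by (rule mntI) (simp_all add: B.Sym_natural B.Sym_natural[THEN B.reassoc] B.Sym_Rgt_inverse B.mid_Sym')

text \<open>Every axiom is an equation between transformations, whose component at \<open>x\<close> is the same
  axiom of \<open>B\<close>.\<close>

lemma hom_sym_mon_category: "sym_mon_category \<lbrakk>A, B\<rbrakk>\<^sub>0"
proof (intro sym_mon_category.intro sym_mon_category_axioms.intro hom_category)
qed (auto simp: Hom_iff hom_iso B.interchange B.Ass_natural B.Rgt_natural B.Lft_natural B.Sym_natural
      B.pentagon B.triangle B.Lft_Sym B.hexagon intro!: mnt_eqI)

end

section \<open>The 2-category of symmetric monoidal categories\<close>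

lemma comp_boundary_simps [simp]:
  "fdom (G \<circ>\<^sub>F F) = fdom F" "fcod (G \<circ>\<^sub>F F) = fcod G" "fdom (smf_id A) = A" "fcod (smf_id A) = A"
  "ndom (\<tau> *\<^sub>h \<sigma>) = ndom \<tau> \<circ>\<^sub>F ndom \<sigma>" "ncod (\<tau> *\<^sub>h \<sigma>) = ncod \<tau> \<circ>\<^sub>F ncod \<sigma>"
  by (simp_all add: smf_comp_def smf_id_def mnt_hcomp_def)

lemma smf_id_simps [simp]:
  "x \<in> Ob A \<Longrightarrow> fob (smf_id A) x = x" "f \<in> Ar A \<Longrightarrow> far (smf_id A) f = f" "fun0 (smf_id A) = Idn A (Unt A)"
  "\<lbrakk>x \<in> Ob A; y \<in> Ob A\<rbrakk> \<Longrightarrow> fun2 (smf_id A) x y = Idn A (x \<otimes>\<^bsub>A\<^esub> y)"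
  by (simp_all add: smf_id_def)

lemma smf_id_in [simp]:
  assumes "sym_mon_category A"
  shows "smf_id A \<in> Ob \<lbrakk>A, A\<rbrakk>\<^sub>0"
proof -
  interpret A: sym_mon_category A by (rule assms)
  interpret AA: smc_hom A A ..
  show ?thesis by (rule AA.smfI) (simp_all, simp_all add: smf_id_def)
qed

locale smc_comp = AB: smc_hom A B + BC: smc_hom B C
  for A :: "('oa, 'ma) smc" and B :: "('ob, 'mb) smc" and C :: "('oc, 'mc) smc"
begin

sublocale AC: smc_hom A C ..

context
  fixes F :: "('oa, 'ma, 'ob, 'mb) smf" and G :: "('ob, 'mb, 'oc, 'mc) smf"
  assumes F [simp]: "F \<in> Ob \<lbrakk>A, B\<rbrakk>\<^sub>0" and G [simp]: "G \<in> Ob \<lbrakk>B, C\<rbrakk>\<^sub>0"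
begin

lemma comp_simps [simp]:
  "x \<in> Ob A \<Longrightarrow> fob (G \<circ>\<^sub>F F) x = fob G (fob F x)" "f \<in> Ar A \<Longrightarrow> far (G \<circ>\<^sub>F F) f = far G (far F f)"
  "fun0 (G \<circ>\<^sub>F F) = far G (fun0 F) \<cdot>\<^bsub>C\<^esub> fun0 G"
  "\<lbrakk>x \<in> Ob A; y \<in> Ob A\<rbrakk> \<Longrightarrow> fun2 (G \<circ>\<^sub>F F) x y = far G (fun2 F x y) \<cdot>\<^bsub>C\<^esub> fun2 G (fob F x) (fob F y)"
  by (simp_all add: smf_comp_def)

lemma comp_extensional:
  "fob (G \<circ>\<^sub>F F) \<in> extensional (Ob A)" "far (G \<circ>\<^sub>F F) \<in> extensional (Ar A)"
  "fun2 (G \<circ>\<^sub>F F) \<in> extensional (Ob A)" "x \<in> Ob A \<Longrightarrow> fun2 (G \<circ>\<^sub>F F) x \<in> extensional (Ob A)"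
  by (simp_all add: smf_comp_def)

text \<open>Each axiom for the composite is the image under \<open>G\<close> of the axiom for \<open>F\<close>, followed by the
  axiom for \<open>G\<close>; naturality of the multiplication of \<open>G\<close> separates the two.\<close>

lemma comp_in [simp]: "G \<circ>\<^sub>F F \<in> Ob \<lbrakk>A, C\<rbrakk>\<^sub>0" (is "?K \<in> _")
proof (rule AC.smfI)
  fix f g assume [simp]: "f \<in> Ar A" "g \<in> Ar A"
  show "far ?K (f \<odot>\<^bsub>A\<^esub> g) \<cdot>\<^bsub>C\<^esub> fun2 ?K (Dom A f) (Dom A g)
      = fun2 ?K (Cod A f) (Cod A g) \<cdot>\<^bsub>C\<^esub> (far ?K f \<odot>\<^bsub>C\<^esub> far ?K g)"
    using arg_cong[OF AB.fun2_natural[of F f g "Dom A f" "Dom A g"], of "far G", simplified,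
        THEN BC.B.reassoc2, of "fun2 G (fob F (Dom A f)) (fob F (Dom A g))"]
    by (simp add: BC.fun2_natural)
next
  fix x y z assume [simp]: "x \<in> Ob A" "y \<in> Ob A" "z \<in> Ob A"
  let ?F = "fob F" and ?\<phi> = "fun2 F" and ?GF = "\<lambda>x. fob G (fob F x)" and ?\<gamma> = "fun2 G"
  have "far G (far F (Ass A x y z)) \<cdot>\<^bsub>C\<^esub> far G (?\<phi> x (y \<otimes>\<^bsub>A\<^esub> z)) \<cdot>\<^bsub>C\<^esub> ?\<gamma> (?F x) (?F (y \<otimes>\<^bsub>A\<^esub> z))
      \<cdot>\<^bsub>C\<^esub> (Idn C (?GF x) \<odot>\<^bsub>C\<^esub> (far G (?\<phi> y z) \<cdot>\<^bsub>C\<^esub> ?\<gamma> (?F y) (?F z)))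
    = far G (far F (Ass A x y z) \<cdot>\<^bsub>B\<^esub> ?\<phi> x (y \<otimes>\<^bsub>A\<^esub> z) \<cdot>\<^bsub>B\<^esub> (Idn B (?F x) \<odot>\<^bsub>B\<^esub> ?\<phi> y z))
      \<cdot>\<^bsub>C\<^esub> ?\<gamma> (?F x) (?F y \<otimes>\<^bsub>B\<^esub> ?F z) \<cdot>\<^bsub>C\<^esub> (Idn C (?GF x) \<odot>\<^bsub>C\<^esub> ?\<gamma> (?F y) (?F z))"
    by (simp add: BC.B.TAr_Cmp_right BC.fun2_natural_right[THEN BC.B.reassoc])
  also have "\<dots> = far G (?\<phi> (x \<otimes>\<^bsub>A\<^esub> y) z) \<cdot>\<^bsub>C\<^esub> far G (?\<phi> x y \<odot>\<^bsub>B\<^esub> Idn B (?F z))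
      \<cdot>\<^bsub>C\<^esub> ?\<gamma> (?F x \<otimes>\<^bsub>B\<^esub> ?F y) (?F z) \<cdot>\<^bsub>C\<^esub> (?\<gamma> (?F x) (?F y) \<odot>\<^bsub>C\<^esub> Idn C (?GF z)) \<cdot>\<^bsub>C\<^esub> Ass C (?GF x) (?GF y) (?GF z)"
    by (simp add: AB.fun2_assoc BC.fun2_assoc)
  also have "\<dots> = far G (?\<phi> (x \<otimes>\<^bsub>A\<^esub> y) z) \<cdot>\<^bsub>C\<^esub> ?\<gamma> (?F (x \<otimes>\<^bsub>A\<^esub> y)) (?F z)
      \<cdot>\<^bsub>C\<^esub> ((far G (?\<phi> x y) \<cdot>\<^bsub>C\<^esub> ?\<gamma> (?F x) (?F y)) \<odot>\<^bsub>C\<^esub> Idn C (?GF z)) \<cdot>\<^bsub>C\<^esub> Ass C (?GF x) (?GF y) (?GF z)"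
    by (simp add: BC.B.TAr_Cmp_left BC.fun2_natural_left[THEN BC.B.reassoc])
  finally show "far ?K (Ass A x y z) \<cdot>\<^bsub>C\<^esub> fun2 ?K x (y \<otimes>\<^bsub>A\<^esub> z) \<cdot>\<^bsub>C\<^esub> (Idn C (fob ?K x) \<odot>\<^bsub>C\<^esub> fun2 ?K y z)
    = fun2 ?K (x \<otimes>\<^bsub>A\<^esub> y) z \<cdot>\<^bsub>C\<^esub> (fun2 ?K x y \<odot>\<^bsub>C\<^esub> Idn C (fob ?K z))
      \<cdot>\<^bsub>C\<^esub> Ass C (fob ?K x) (fob ?K y) (fob ?K z)"
    by simp
next
  fix x assume [simp]: "x \<in> Ob A"
  let ?F = "fob F" and ?GF = "\<lambda>x. fob G (fob F x)" and ?I = "Unt A"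
  have "far G (far F (Rgt A x)) \<cdot>\<^bsub>C\<^esub> far G (fun2 F x ?I) \<cdot>\<^bsub>C\<^esub> fun2 G (?F x) (?F ?I)
      \<cdot>\<^bsub>C\<^esub> (Idn C (?GF x) \<odot>\<^bsub>C\<^esub> (far G (fun0 F) \<cdot>\<^bsub>C\<^esub> fun0 G))
    = far G (far F (Rgt A x) \<cdot>\<^bsub>B\<^esub> fun2 F x ?I \<cdot>\<^bsub>B\<^esub> (Idn B (?F x) \<odot>\<^bsub>B\<^esub> fun0 F))
      \<cdot>\<^bsub>C\<^esub> fun2 G (?F x) (Unt B) \<cdot>\<^bsub>C\<^esub> (Idn C (?GF x) \<odot>\<^bsub>C\<^esub> fun0 G)"
    by (simp add: BC.B.TAr_Cmp_right BC.fun2_natural_right[THEN BC.B.reassoc])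
  also have "\<dots> = Rgt C (?GF x)"
    unfolding AB.fun0_Rgt[OF F \<open>x \<in> Ob A\<close>] by (simp add: BC.fun0_Rgt)
  finally show "far ?K (Rgt A x) \<cdot>\<^bsub>C\<^esub> fun2 ?K x ?I \<cdot>\<^bsub>C\<^esub> (Idn C (fob ?K x) \<odot>\<^bsub>C\<^esub> fun0 ?K)
    = Rgt C (fob ?K x)"
    by simp
  have "far G (far F (Lft A x)) \<cdot>\<^bsub>C\<^esub> far G (fun2 F ?I x) \<cdot>\<^bsub>C\<^esub> fun2 G (?F ?I) (?F x)
      \<cdot>\<^bsub>C\<^esub> ((far G (fun0 F) \<cdot>\<^bsub>C\<^esub> fun0 G) \<odot>\<^bsub>C\<^esub> Idn C (?GF x))
    = far G (far F (Lft A x) \<cdot>\<^bsub>B\<^esub> fun2 F ?I x \<cdot>\<^bsub>B\<^esub> (fun0 F \<odot>\<^bsub>B\<^esub> Idn B (?F x)))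
      \<cdot>\<^bsub>C\<^esub> fun2 G (Unt B) (?F x) \<cdot>\<^bsub>C\<^esub> (fun0 G \<odot>\<^bsub>C\<^esub> Idn C (?GF x))"
    by (simp add: BC.B.TAr_Cmp_left BC.fun2_natural_left[THEN BC.B.reassoc])
  also have "\<dots> = Lft C (?GF x)"
    unfolding AB.fun0_Lft[OF F \<open>x \<in> Ob A\<close>] by (simp add: BC.fun0_Lft)
  finally show "far ?K (Lft A x) \<cdot>\<^bsub>C\<^esub> fun2 ?K ?I x \<cdot>\<^bsub>C\<^esub> (fun0 ?K \<odot>\<^bsub>C\<^esub> Idn C (fob ?K x))
    = Lft C (fob ?K x)"
    by simp
next
  fix x y assume [simp]: "x \<in> Ob A" "y \<in> Ob A"
  have "far G (far F (Sym A x y) \<cdot>\<^bsub>B\<^esub> fun2 F x y) = far G (fun2 F y x \<cdot>\<^bsub>B\<^esub> Sym B (fob F x) (fob F y))"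
    by (simp only: AB.fun2_Sym[OF F \<open>x \<in> Ob A\<close> \<open>y \<in> Ob A\<close>])
  from this[simplified, THEN BC.B.reassoc2, of "fun2 G (fob F x) (fob F y)"]
  show "far ?K (Sym A x y) \<cdot>\<^bsub>C\<^esub> fun2 ?K x y
      = fun2 ?K y x \<cdot>\<^bsub>C\<^esub> Sym C (fob ?K x) (fob ?K y)"
    by (simp add: BC.fun2_Sym)
qed (simp_all add: comp_extensional)

end

context
  fixes \<sigma> :: "('oa, 'ma, 'ob, 'mb) mnt" and \<tau> :: "('ob, 'mb, 'oc, 'mc) mnt"
  assumes \<sigma> [simp]: "\<sigma> \<in> Ar \<lbrakk>A, B\<rbrakk>\<^sub>0" and \<tau> [simp]: "\<tau> \<in> Ar \<lbrakk>B, C\<rbrakk>\<^sub>0"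
begin

lemma hcomp_simps [simp]:
  "x \<in> Ob A \<Longrightarrow> ncomp (\<tau> *\<^sub>h \<sigma>) x = ncomp \<tau> (fob (ncod \<sigma>) x) \<cdot>\<^bsub>C\<^esub> far (ndom \<tau>) (ncomp \<sigma> x)"
  by (simp add: mnt_hcomp_def)

lemma hcomp_in [simp]: "\<tau> *\<^sub>h \<sigma> \<in> Ar \<lbrakk>A, C\<rbrakk>\<^sub>0" (is "?\<rho> \<in> _")
proof (rule AC.mntI)
  fix f assume [simp]: "f \<in> Ar A"
  have "far (ndom \<tau>) (ncomp \<sigma> (Cod A f) \<cdot>\<^bsub>B\<^esub> far (ndom \<sigma>) f) = far (ndom \<tau>) (far (ncod \<sigma>) f \<cdot>\<^bsub>B\<^esub> ncomp \<sigma> (Dom A f))"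
    by (simp only: AB.ncomp_natural[OF \<sigma> \<open>f \<in> Ar A\<close> refl])
  then show "ncomp ?\<rho> (Cod A f) \<cdot>\<^bsub>C\<^esub> far (ndom ?\<rho>) f
      = far (ncod ?\<rho>) f \<cdot>\<^bsub>C\<^esub> ncomp ?\<rho> (Dom A f)"
    by (simp add: BC.ncomp_natural[THEN BC.B.reassoc])
next
  have "far (ndom \<tau>) (ncomp \<sigma> (Unt A) \<cdot>\<^bsub>B\<^esub> fun0 (ndom \<sigma>)) = far (ndom \<tau>) (fun0 (ncod \<sigma>))"
    by (simp only: AB.ncomp_fun0[OF \<sigma>])
  from this[simplified, THEN BC.B.reassoc, of "fun0 (ndom \<tau>)"]
  show "ncomp ?\<rho> (Unt A) \<cdot>\<^bsub>C\<^esub> fun0 (ndom ?\<rho>) = fun0 (ncod ?\<rho>)"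
    by (simp add: BC.ncomp_natural[THEN BC.B.reassoc] BC.ncomp_fun0)
next
  fix x y assume [simp]: "x \<in> Ob A" "y \<in> Ob A"
  have "far (ndom \<tau>) (ncomp \<sigma> (x \<otimes>\<^bsub>A\<^esub> y) \<cdot>\<^bsub>B\<^esub> fun2 (ndom \<sigma>) x y)
      = far (ndom \<tau>) (fun2 (ncod \<sigma>) x y \<cdot>\<^bsub>B\<^esub> (ncomp \<sigma> x \<odot>\<^bsub>B\<^esub> ncomp \<sigma> y))"
    by (simp only: AB.ncomp_fun2[OF \<sigma> \<open>x \<in> Ob A\<close> \<open>y \<in> Ob A\<close>])
  from this[simplified, THEN BC.B.reassoc2, of "fun2 (ndom \<tau>) (fob (ndom \<sigma>) x) (fob (ndom \<sigma>) y)"]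
  show "ncomp ?\<rho> (x \<otimes>\<^bsub>A\<^esub> y) \<cdot>\<^bsub>C\<^esub> fun2 (ndom ?\<rho>) x y
      = fun2 (ncod ?\<rho>) x y \<cdot>\<^bsub>C\<^esub> (ncomp ?\<rho> x \<odot>\<^bsub>C\<^esub> ncomp ?\<rho> y)"
    by (simp add: BC.fun2_natural BC.ncomp_natural[THEN BC.B.reassoc] BC.ncomp_fun2[THEN BC.B.reassoc] BC.B.interchange)
qed (simp_all, simp add: mnt_hcomp_def)

end

lemma hcomp_mnt_id [simp]:
  assumes "F \<in> Ob \<lbrakk>A, B\<rbrakk>\<^sub>0" "G \<in> Ob \<lbrakk>B, C\<rbrakk>\<^sub>0"
  shows "mnt_id G *\<^sub>h mnt_id F = mnt_id (G \<circ>\<^sub>F F)"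
  by (rule AC.mnt_eqI) (use assms in simp_all)

text \<open>The middle-four law for transformations is naturality of the outer one at the components of
  the inner one.\<close>

lemma hcomp_vcomp:
  assumes [simp]: "\<sigma> \<in> Ar \<lbrakk>A, B\<rbrakk>\<^sub>0" "\<sigma>' \<in> Ar \<lbrakk>A, B\<rbrakk>\<^sub>0" "\<tau> \<in> Ar \<lbrakk>B, C\<rbrakk>\<^sub>0" "\<tau>' \<in> Ar \<lbrakk>B, C\<rbrakk>\<^sub>0"
    "ndom \<sigma>' = ncod \<sigma>" "ndom \<tau>' = ncod \<tau>"
  shows "mnt_vcomp \<tau>' \<tau> *\<^sub>h mnt_vcomp \<sigma>' \<sigma> = mnt_vcomp (\<tau>' *\<^sub>h \<sigma>') (\<tau> *\<^sub>h \<sigma>)"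
  by (rule AC.mnt_eqI) (simp_all add: BC.ncomp_natural[THEN BC.B.reassoc])

end

lemma smc_compI:
  assumes "F \<in> Ob \<lbrakk>A, B\<rbrakk>\<^sub>0" "G \<in> Ob \<lbrakk>B, C\<rbrakk>\<^sub>0"
  shows "smc_comp A B C"
  using assms[THEN smc_hom_of_functor] by (simp add: smc_comp_def)

lemma smf_comp_assoc:
  assumes [simp]: "F \<in> Ob \<lbrakk>A, B\<rbrakk>\<^sub>0" "G \<in> Ob \<lbrakk>B, C\<rbrakk>\<^sub>0" "H \<in> Ob \<lbrakk>C, E\<rbrakk>\<^sub>0"
  shows "(H \<circ>\<^sub>F G) \<circ>\<^sub>F F = H \<circ>\<^sub>F (G \<circ>\<^sub>F F)"
proof -
  interpret ABC: smc_comp A B C by (rule smc_compI[OF assms(1,2)])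
  interpret BCE: smc_comp B C E by (rule smc_compI[OF assms(2,3)])
  interpret ABE: smc_comp A B E by (rule smc_compI[OF assms(1) BCE.comp_in[OF assms(2,3)]])
  interpret ACE: smc_comp A C E by (rule smc_compI[OF ABC.comp_in[OF assms(1,2)] assms(3)])
  show ?thesis by (rule ABE.AC.smf_eqI) simp_all
qed

lemma smf_comp_id:
  assumes [simp]: "F \<in> Ob \<lbrakk>A, B\<rbrakk>\<^sub>0"
  shows "F \<circ>\<^sub>F smf_id A = F" "smf_id B \<circ>\<^sub>F F = F"
proof -
  interpret AB: smc_hom A B by (rule smc_hom_of_functor[OF assms])
  have [simp]: "smf_id A \<in> Ob \<lbrakk>A, A\<rbrakk>\<^sub>0" "smf_id B \<in> Ob \<lbrakk>B, B\<rbrakk>\<^sub>0"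
    using AB.A.sym_mon_category_axioms AB.B.sym_mon_category_axioms by simp_all
  interpret AAB: smc_comp A A B by (rule smc_compI[of "smf_id A" _ _ F]) simp_all
  interpret ABB: smc_comp A B B by (rule smc_compI[of F _ _ "smf_id B"]) simp_all
  show "F \<circ>\<^sub>F smf_id A = F" by (rule AB.smf_eqI) simp_all
  show "smf_id B \<circ>\<^sub>F F = F" by (rule AB.smf_eqI) simp_all
qed

lemma mnt_hcomp_assoc:
  assumes [simp]: "\<rho> \<in> Ar \<lbrakk>A, B\<rbrakk>\<^sub>0" "\<sigma> \<in> Ar \<lbrakk>B, C\<rbrakk>\<^sub>0" "\<tau> \<in> Ar \<lbrakk>C, E\<rbrakk>\<^sub>0"
    and "sym_mon_category A" "sym_mon_category B" "sym_mon_category C" "sym_mon_category E"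
  shows "(\<tau> *\<^sub>h \<sigma>) *\<^sub>h \<rho> = \<tau> *\<^sub>h (\<sigma> *\<^sub>h \<rho>)"
proof -
  interpret ABC: smc_comp A B C using assms(4-) by (simp add: smc_comp_def smc_hom_def)
  interpret BCE: smc_comp B C E using assms(4-) by (simp add: smc_comp_def smc_hom_def)
  interpret ABE: smc_comp A B E ..
  interpret ACE: smc_comp A C E ..
  show ?thesis
    by (rule ABE.AC.mnt_eqI) (simp_all add: smf_comp_assoc[of _ A B _ C _ E])
qed

lemma mnt_hcomp_id:
  assumes [simp]: "\<sigma> \<in> Ar \<lbrakk>A, B\<rbrakk>\<^sub>0" and "sym_mon_category A" "sym_mon_category B"
  shows "\<sigma> *\<^sub>h mnt_id (smf_id A) = \<sigma>" "mnt_id (smf_id B) *\<^sub>h \<sigma> = \<sigma>"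
proof -
  interpret AB: smc_hom A B using assms(2-) by (simp add: smc_hom_def)
  interpret AAB: smc_comp A A B using assms(2-) by (simp add: smc_comp_def smc_hom_def)
  interpret ABB: smc_comp A B B using assms(2-) by (simp add: smc_comp_def smc_hom_def)
  note [simp] = assms(2,3)
  show "\<sigma> *\<^sub>h mnt_id (smf_id A) = \<sigma>"
    by (rule AB.mnt_eqI) (simp_all add: smf_comp_id[of _ A B])
  show "mnt_id (smf_id B) *\<^sub>h \<sigma> = \<sigma>"
    by (rule AB.mnt_eqI) (simp_all add: smf_comp_id[of _ A B])
qed

lemma smc_hom_of_mnt:
  assumes "\<sigma> \<in> Ar \<lbrakk>A, B\<rbrakk>\<^sub>0"
  shows "smc_hom A B"
proof -
  have "ndom \<sigma> \<in> Ob \<lbrakk>A, B\<rbrakk>\<^sub>0" using assms mon_nat_trans.ndom_smf[of \<sigma>] by (simp add: hom_Ar_iff hom_Ob_iff)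
  then show ?thesis by (rule smc_hom_of_functor)
qed

lemma cells_SMC:
  "A \<in> cells0 SMC \<longleftrightarrow> sym_mon_category A"
  "F \<in> cells1 SMC \<longleftrightarrow> F \<in> Ob \<lbrakk>fdom F, fcod F\<rbrakk>\<^sub>0"
  "F \<in> Cells1 SMC A B \<longleftrightarrow> F \<in> Ob \<lbrakk>A, B\<rbrakk>\<^sub>0"
  "\<sigma> \<in> Cells2 SMC F G \<longleftrightarrow> \<sigma> \<in> Ar \<lbrakk>fdom F, fcod F\<rbrakk>\<^sub>0 \<and> ndom \<sigma> = F \<and> ncod \<sigma> = G"
  by (auto simp: SMC_def Cells1_def Cells2_def hom_Ob_iff hom_Ar_iff)

lemma SMC_simps [simp]:
  "src1 SMC = fdom" "tgt1 SMC = fcod" "src2 SMC = ndom" "tgt2 SMC = ncod"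
  "unit1 SMC = smf_id" "unit2 SMC = mnt_id" "comp1 SMC = smf_comp" "vcomp SMC = mnt_vcomp" "hcomp SMC = mnt_hcomp"
  by (simp_all add: SMC_def)

lemma two_category_SMC: "two_category SMC"
proof
  fix F :: "('a, 'b, 'a, 'b) smf" and A B assume F: "F \<in> Cells1 SMC A B"
  interpret smc_hom A B using F by (intro smc_hom_of_functor) (simp add: cells_SMC)
  show "comp1 SMC F (unit1 SMC A) = F" "comp1 SMC (unit1 SMC B) F = F"
    using F by (simp_all add: cells_SMC smf_comp_id)
next
  fix F :: "('a, 'b, 'a, 'b) smf" and \<sigma> F' A B assume "F \<in> Cells1 SMC A B" "\<sigma> \<in> Cells2 SMC F F'"
  then have F: "F \<in> Ob \<lbrakk>A, B\<rbrakk>\<^sub>0" and \<sigma>: "\<sigma> \<in> Ar \<lbrakk>A, B\<rbrakk>\<^sub>0" by (auto simp: cells_SMC hom_Ob_iff)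
  interpret smc_hom A B using F by (rule smc_hom_of_functor)
  show "hcomp SMC \<sigma> (unit2 SMC (unit1 SMC A)) = \<sigma>" "hcomp SMC (unit2 SMC (unit1 SMC B)) \<sigma> = \<sigma>"
    using mnt_hcomp_id[OF \<sigma> A.sym_mon_category_axioms B.sym_mon_category_axioms] by simp_all
next
  fix F G H :: "('a, 'b, 'a, 'b) smf" and \<sigma> \<tau> \<rho> F' G' H' A B C E
  assume "F \<in> Cells1 SMC A B" "\<sigma> \<in> Cells2 SMC F F'" "G \<in> Cells1 SMC B C" "\<tau> \<in> Cells2 SMC G G'"
    "H \<in> Cells1 SMC C E" "\<rho> \<in> Cells2 SMC H H'"
  then have F: "F \<in> Ob \<lbrakk>A, B\<rbrakk>\<^sub>0" and G: "G \<in> Ob \<lbrakk>B, C\<rbrakk>\<^sub>0" and H: "H \<in> Ob \<lbrakk>C, E\<rbrakk>\<^sub>0"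
    and 2: "\<sigma> \<in> Ar \<lbrakk>A, B\<rbrakk>\<^sub>0" "\<tau> \<in> Ar \<lbrakk>B, C\<rbrakk>\<^sub>0" "\<rho> \<in> Ar \<lbrakk>C, E\<rbrakk>\<^sub>0"
    by (auto simp: cells_SMC hom_Ob_iff)
  interpret AB: smc_comp A B C using F G by (rule smc_compI)
  interpret BC: smc_comp B C E using G H by (rule smc_compI)
  show "hcomp SMC (hcomp SMC \<rho> \<tau>) \<sigma> = hcomp SMC \<rho> (hcomp SMC \<tau> \<sigma>)"
    using mnt_hcomp_assoc[OF 2 AB.AB.A.sym_mon_category_axioms AB.AB.B.sym_mon_category_axioms
        AB.BC.B.sym_mon_category_axioms BC.BC.B.sym_mon_category_axioms] by simp
next
  fix F G :: "('a, 'b, 'a, 'b) smf" and \<sigma> \<sigma>' \<tau> \<tau>' F' G' F'' G'' A B C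
  assume "F \<in> Cells1 SMC A B" "\<sigma> \<in> Cells2 SMC F F'" "\<sigma>' \<in> Cells2 SMC F' F''"
    "G \<in> Cells1 SMC B C" "\<tau> \<in> Cells2 SMC G G'" "\<tau>' \<in> Cells2 SMC G' G''"
  then have F: "F \<in> Ob \<lbrakk>A, B\<rbrakk>\<^sub>0" and G: "G \<in> Ob \<lbrakk>B, C\<rbrakk>\<^sub>0"
    and \<sigma>: "\<sigma> \<in> Ar \<lbrakk>A, B\<rbrakk>\<^sub>0" and \<tau>: "\<tau> \<in> Ar \<lbrakk>B, C\<rbrakk>\<^sub>0" 
    and \<sigma>': "\<sigma>' \<in> Ar \<lbrakk>fdom (ncod \<sigma>), fcod (ncod \<sigma>)\<rbrakk>\<^sub>0" "ndom \<sigma>' = ncod \<sigma>"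
    and \<tau>': "\<tau>' \<in> Ar \<lbrakk>fdom (ncod \<tau>), fcod (ncod \<tau>)\<rbrakk>\<^sub>0" "ndom \<tau>' = ncod \<tau>"
    by (auto simp: cells_SMC hom_Ob_iff)
  interpret smc_comp A B C using F G by (rule smc_compI)
  have "\<sigma>' \<in> Ar \<lbrakk>A, B\<rbrakk>\<^sub>0" "\<tau>' \<in> Ar \<lbrakk>B, C\<rbrakk>\<^sub>0"
    using \<sigma> \<tau> \<sigma>' \<tau>' AB.fdom[OF AB.ncod_in[OF \<sigma>]] AB.fcod[OF AB.ncod_in[OF \<sigma>]]
      BC.fdom[OF BC.ncod_in[OF \<tau>]] BC.fcod[OF BC.ncod_in[OF \<tau>]] by simp_all
  then show "hcomp SMC (vcomp SMC \<tau>' \<tau>) (vcomp SMC \<sigma>' \<sigma>) = vcomp SMC (hcomp SMC \<tau>' \<sigma>') (hcomp SMC \<tau> \<sigma>)"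
    using hcomp_vcomp[OF \<sigma> _ \<tau>] \<sigma>'(2) \<tau>'(2) by simp
next
  fix F G :: "('a, 'b, 'a, 'b) smf" and A B C
  assume "F \<in> Cells1 SMC A B" "G \<in> Cells1 SMC B C"
  then have F: "F \<in> Ob \<lbrakk>A, B\<rbrakk>\<^sub>0" and G: "G \<in> Ob \<lbrakk>B, C\<rbrakk>\<^sub>0" by (auto simp: cells_SMC)
  interpret smc_comp A B C using F G by (rule smc_compI)
  show "comp1 SMC G F \<in> Cells1 SMC A C" "hcomp SMC (unit2 SMC G) (unit2 SMC F) = unit2 SMC (comp1 SMC G F)"
    using F G by (simp_all add: cells_SMC)
next
  fix F G :: "('a, 'b, 'a, 'b) smf" and \<sigma> \<tau> F' G' A B C
  assume "F \<in> Cells1 SMC A B" "\<sigma> \<in> Cells2 SMC F F'" "G \<in> Cells1 SMC B C" "\<tau> \<in> Cells2 SMC G G'"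
  then have F: "F \<in> Ob \<lbrakk>A, B\<rbrakk>\<^sub>0" and G: "G \<in> Ob \<lbrakk>B, C\<rbrakk>\<^sub>0"
    and 2: "\<sigma> \<in> Ar \<lbrakk>A, B\<rbrakk>\<^sub>0" "\<tau> \<in> Ar \<lbrakk>B, C\<rbrakk>\<^sub>0" "ndom \<sigma> = F" "ncod \<sigma> = F'" "ndom \<tau> = G" "ncod \<tau> = G'"
    by (auto simp: cells_SMC hom_Ob_iff)
  interpret smc_comp A B C using F G by (rule smc_compI)
  show "hcomp SMC \<tau> \<sigma> \<in> Cells2 SMC (comp1 SMC G F) (comp1 SMC G' F')"
    using F G 2 by (simp add: cells_SMC)
next
  fix F G :: "('a, 'b, 'a, 'b) smf" and \<sigma> assume "\<sigma> \<in> Cells2 SMC F G"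
  moreover define A B where "A = fdom F" and "B = fcod F"
  ultimately have \<sigma> [simp]: "\<sigma> \<in> Ar \<lbrakk>A, B\<rbrakk>\<^sub>0" "ndom \<sigma> = F" "ncod \<sigma> = G" by (simp_all add: cells_SMC)
  interpret smc_hom A B using \<sigma>(1) by (rule smc_hom_of_mnt)
  have [simp]: "F \<in> Ob \<lbrakk>A, B\<rbrakk>\<^sub>0" "G \<in> Ob \<lbrakk>A, B\<rbrakk>\<^sub>0" using ndom_in[OF \<sigma>(1)] ncod_in[OF \<sigma>(1)] by simp_all
  show "vcomp SMC \<sigma> (unit2 SMC F) = \<sigma>" "vcomp SMC (unit2 SMC G) \<sigma> = \<sigma>"
    by (auto intro!: mnt_eqI)
  fix H \<tau> assume "\<tau> \<in> Cells2 SMC G H"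
  then have \<tau> [simp]: "\<tau> \<in> Ar \<lbrakk>A, B\<rbrakk>\<^sub>0" "ndom \<tau> = G" "ncod \<tau> = H" by (simp_all add: cells_SMC)
  then have [simp]: "H \<in> Ob \<lbrakk>A, B\<rbrakk>\<^sub>0" using ncod_in[OF \<tau>(1)] by simp
  show "vcomp SMC \<tau> \<sigma> \<in> Cells2 SMC F H" by (simp add: cells_SMC)
  fix K \<rho> assume "\<rho> \<in> Cells2 SMC H K"
  then have [simp]: "\<rho> \<in> Ar \<lbrakk>A, B\<rbrakk>\<^sub>0" "ndom \<rho> = H" by (simp_all add: cells_SMC)
  show "vcomp SMC (vcomp SMC \<rho> \<tau>) \<sigma> = vcomp SMC \<rho> (vcomp SMC \<tau> \<sigma>)"
    by (auto intro!: mnt_eqI)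
next
  fix \<sigma> :: "('a, 'b, 'a, 'b) mnt" assume "\<sigma> \<in> cells2 SMC"
  then have "mon_nat_trans \<sigma>" by (simp add: SMC_def)
  from mon_nat_trans.ndom_smf[OF this] mon_nat_trans.ncod_smf[OF this]
    mon_nat_trans.fdom_ncod[OF this] mon_nat_trans.fcod_ncod[OF this]
  show "src2 SMC \<sigma> \<in> cells1 SMC" "tgt2 SMC \<sigma> \<in> cells1 SMC"
    "src1 SMC (tgt2 SMC \<sigma>) = src1 SMC (src2 SMC \<sigma>)" "tgt1 SMC (tgt2 SMC \<sigma>) = tgt1 SMC (src2 SMC \<sigma>)"
    by (simp_all add: cells_SMC hom_Ob_iff)
next
  fix F :: "('a, 'b, 'a, 'b) smf" assume F: "F \<in> cells1 SMC"
  define A B where "A = fdom F" and "B = fcod F"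
  then have F [simp]: "F \<in> Ob \<lbrakk>A, B\<rbrakk>\<^sub>0" using F by (simp add: cells_SMC)
  interpret smc_hom A B using F by (rule smc_hom_of_functor)
  show "src1 SMC F \<in> cells0 SMC" "tgt1 SMC F \<in> cells0 SMC" "unit2 SMC F \<in> Cells2 SMC F F"
    using A.sym_mon_category_axioms B.sym_mon_category_axioms by (simp_all add: cells_SMC)
qed (auto simp: cells_SMC smf_comp_assoc)

lemma op1_simps [simp]:
  "cells0 (op1 K) = cells0 K" "cells1 (op1 K) = cells1 K" "cells2 (op1 K) = cells2 K"
  "src1 (op1 K) = tgt1 K" "tgt1 (op1 K) = src1 K" "src2 (op1 K) = src2 K" "tgt2 (op1 K) = tgt2 K"
  "unit1 (op1 K) = unit1 K" "unit2 (op1 K) = unit2 K" "comp1 (op1 K) g f = comp1 K f g"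
  "vcomp (op1 K) = vcomp K" "hcomp (op1 K) t s = hcomp K s t"
  "Cells1 (op1 K) a b = Cells1 K b a" "Cells2 (op1 K) = Cells2 K"
  by (auto simp: op1_def Cells1_def Cells2_def fun_eq_iff)

lemma two_category_op1: "two_category K \<Longrightarrow> two_category (op1 K)"
proof -
  assume "two_category K"
  then interpret two_category K .
  show ?thesis
    by unfold_locales
      (auto simp: src1_cells0 tgt1_cells0 src2_cells1 tgt2_cells1 parallel_src parallel_tgt unit1_Cells1
        comp1_unit1 unit1_comp1 comp1_assoc unit2_Cells2 vcomp_unit2 unit2_vcomp vcomp_assoc hcomp_unit2
        interchange hcomp_unit1 unit1_hcomp hcomp_assoc
        intro: comp1_Cells1 vcomp_Cells2 hcomp_Cells2)
qed

lemma prod_two_cat_simps [simp]: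
  "cells0 (K \<times>\<^sub>2 L) = cells0 K \<times> cells0 L" "cells1 (K \<times>\<^sub>2 L) = cells1 K \<times> cells1 L"
  "cells2 (K \<times>\<^sub>2 L) = cells2 K \<times> cells2 L"
  "src1 (K \<times>\<^sub>2 L) = map_prod (src1 K) (src1 L)" "tgt1 (K \<times>\<^sub>2 L) = map_prod (tgt1 K) (tgt1 L)"
  "src2 (K \<times>\<^sub>2 L) = map_prod (src2 K) (src2 L)" "tgt2 (K \<times>\<^sub>2 L) = map_prod (tgt2 K) (tgt2 L)"
  "unit1 (K \<times>\<^sub>2 L) = map_prod (unit1 K) (unit1 L)" "unit2 (K \<times>\<^sub>2 L) = map_prod (unit2 K) (unit2 L)"
  "comp1 (K \<times>\<^sub>2 L) (g, g') (f, f') = (comp1 K g f, comp1 L g' f')"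
  "vcomp (K \<times>\<^sub>2 L) (t, t') (s, s') = (vcomp K t s, vcomp L t' s')"
  "hcomp (K \<times>\<^sub>2 L) (t, t') (s, s') = (hcomp K t s, hcomp L t' s')"
  by (simp_all add: prod_two_cat_def)

lemma Cells_prod [simp]:
  "(f, f') \<in> Cells1 (K \<times>\<^sub>2 L) (a, a') (b, b') \<longleftrightarrow> f \<in> Cells1 K a b \<and> f' \<in> Cells1 L a' b'"
  "(s, s') \<in> Cells2 (K \<times>\<^sub>2 L) (f, f') (g, g') \<longleftrightarrow> s \<in> Cells2 K f g \<and> s' \<in> Cells2 L f' g'"
  by (auto simp: Cells1_def Cells2_def)

lemma two_category_prod:
  assumes "two_category K" "two_category L"
  shows "two_category (K \<times>\<^sub>2 L)"
proof -
  interpret K: two_category K by (rule assms(1))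
  interpret L: two_category L by (rule assms(2))
  note KL = K.two_category_axioms L.two_category_axioms
  note simps = KL[THEN two_category.src1_cells0] KL[THEN two_category.tgt1_cells0]
    KL[THEN two_category.src2_cells1] KL[THEN two_category.tgt2_cells1]
    KL[THEN two_category.parallel_src] KL[THEN two_category.parallel_tgt]
    KL[THEN two_category.unit1_Cells1] KL[THEN two_category.comp1_unit1]
    KL[THEN two_category.unit1_comp1] KL[THEN two_category.comp1_assoc]
    KL[THEN two_category.unit2_Cells2] KL[THEN two_category.vcomp_unit2]
    KL[THEN two_category.unit2_vcomp] KL[THEN two_category.vcomp_assoc]
    KL[THEN two_category.hcomp_unit2] KL[THEN two_category.interchange]
    KL[THEN two_category.hcomp_unit1] KL[THEN two_category.unit1_hcomp] KL[THEN two_category.hcomp_assoc]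
  note intros = KL[THEN two_category.comp1_Cells1] KL[THEN two_category.vcomp_Cells2]
    KL[THEN two_category.hcomp_Cells2]
  show ?thesis
    by unfold_locales (auto simp: simps intro: intros)
qed

section \<open>The internal hom as a 2-functor\<close>

context smc_hom
begin

text \<open>A symmetric monoidal functor preserves transpositions, because it preserves associativity and
  symmetry.\<close>

lemma fun2_exch:
  assumes [simp]: "F \<in> Ob \<lbrakk>A, B\<rbrakk>\<^sub>0" "b \<in> Ob A" "c \<in> Ob A" "d \<in> Ob A"
  shows "far F (A.exch b c d) \<cdot>\<^bsub>B\<^esub> fun2 F b (c \<otimes>\<^bsub>A\<^esub> d) \<cdot>\<^bsub>B\<^esub> (Idn B (fob F b) \<odot>\<^bsub>B\<^esub> fun2 F c d)
       = fun2 F c (b \<otimes>\<^bsub>A\<^esub> d) \<cdot>\<^bsub>B\<^esub> (Idn B (fob F c) \<odot>\<^bsub>B\<^esub> fun2 F b d) \<cdot>\<^bsub>B\<^esub> B.exch (fob F b) (fob F c) (fob F d)"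
    (is "?L = ?R")
proof (rule B.iso_mono[of "far F (Ass A c b d)"])
  let ?F = "fob F" and ?\<phi> = "fun2 F"
  have "far F (Ass A c b d) \<cdot>\<^bsub>B\<^esub> ?L
      = far F (Ass A c b d \<cdot>\<^bsub>A\<^esub> A.exch b c d) \<cdot>\<^bsub>B\<^esub> ?\<phi> b (c \<otimes>\<^bsub>A\<^esub> d) \<cdot>\<^bsub>B\<^esub> (Idn B (?F b) \<odot>\<^bsub>B\<^esub> ?\<phi> c d)"
    by simp
  also have "\<dots> = (far F (Sym A b c \<odot>\<^bsub>A\<^esub> Idn A d) \<cdot>\<^bsub>B\<^esub> ?\<phi> (b \<otimes>\<^bsub>A\<^esub> c) d) \<cdot>\<^bsub>B\<^esub> (?\<phi> b c \<odot>\<^bsub>B\<^esub> Idn B (?F d)) \<cdot>\<^bsub>B\<^esub> Ass B (?F b) (?F c) (?F d)"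
    unfolding A.Ass_exch[OF assms(2-)] by (simp add: fun2_assoc)
  also have "\<dots> = ?\<phi> (c \<otimes>\<^bsub>A\<^esub> b) d \<cdot>\<^bsub>B\<^esub> (?\<phi> c b \<odot>\<^bsub>B\<^esub> Idn B (?F d)) \<cdot>\<^bsub>B\<^esub> (Sym B (?F b) (?F c) \<odot>\<^bsub>B\<^esub> Idn B (?F d)) \<cdot>\<^bsub>B\<^esub> Ass B (?F b) (?F c) (?F d)"
    by (simp add: fun2_natural_left B.whiskers fun2_Sym)
  also have "\<dots> = ?\<phi> (c \<otimes>\<^bsub>A\<^esub> b) d \<cdot>\<^bsub>B\<^esub> (?\<phi> c b \<odot>\<^bsub>B\<^esub> Idn B (?F d)) \<cdot>\<^bsub>B\<^esub> Ass B (?F c) (?F b) (?F d) \<cdot>\<^bsub>B\<^esub> B.exch (?F b) (?F c) (?F d)"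
    by (simp add: B.Ass_exch)
  also have "\<dots> = (far F (Ass A c b d) \<cdot>\<^bsub>B\<^esub> ?\<phi> c (b \<otimes>\<^bsub>A\<^esub> d) \<cdot>\<^bsub>B\<^esub> (Idn B (?F c) \<odot>\<^bsub>B\<^esub> ?\<phi> b d)) \<cdot>\<^bsub>B\<^esub> B.exch (?F b) (?F c) (?F d)"
    by (simp add: fun2_assoc)
  finally show "far F (Ass A c b d) \<cdot>\<^bsub>B\<^esub> ?L = far F (Ass A c b d) \<cdot>\<^bsub>B\<^esub> ?R"
    by simp
qed (simp_all add: far_iso)

text \<open>After bracketing the four factors to the right, only the transposition of the inner two
  remains, which is preserved by the previous lemma.\<close>

lemma fun2_mid:
  assumes [simp]: "F \<in> Ob \<lbrakk>A, B\<rbrakk>\<^sub>0" "a \<in> Ob A" "b \<in> Ob A" "c \<in> Ob A" "d \<in> Ob A"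
  shows "far F (A.mid a b c d) \<cdot>\<^bsub>B\<^esub> fun2 F (a \<otimes>\<^bsub>A\<^esub> b) (c \<otimes>\<^bsub>A\<^esub> d) \<cdot>\<^bsub>B\<^esub> (fun2 F a b \<odot>\<^bsub>B\<^esub> fun2 F c d)
       = fun2 F (a \<otimes>\<^bsub>A\<^esub> c) (b \<otimes>\<^bsub>A\<^esub> d) \<cdot>\<^bsub>B\<^esub> (fun2 F a c \<odot>\<^bsub>B\<^esub> fun2 F b d) \<cdot>\<^bsub>B\<^esub> B.mid (fob F a) (fob F b) (fob F c) (fob F d)"
    (is "?L = ?R")
proof -
  let ?F = "fob F" and ?\<phi> = "fun2 F"
  have bracket: "?\<phi> (x \<otimes>\<^bsub>A\<^esub> y) (z \<otimes>\<^bsub>A\<^esub> w) \<cdot>\<^bsub>B\<^esub> (?\<phi> x y \<odot>\<^bsub>B\<^esub> ?\<phi> z w) \<cdot>\<^bsub>B\<^esub> Ass B (?F x) (?F y) (?F z \<otimes>\<^bsub>B\<^esub> ?F w)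
      = far F (Ass A x y (z \<otimes>\<^bsub>A\<^esub> w)) \<cdot>\<^bsub>B\<^esub> ?\<phi> x (y \<otimes>\<^bsub>A\<^esub> (z \<otimes>\<^bsub>A\<^esub> w))
        \<cdot>\<^bsub>B\<^esub> (Idn B (?F x) \<odot>\<^bsub>B\<^esub> (?\<phi> y (z \<otimes>\<^bsub>A\<^esub> w) \<cdot>\<^bsub>B\<^esub> (Idn B (?F y) \<odot>\<^bsub>B\<^esub> ?\<phi> z w)))"
    if [simp]: "x \<in> Ob A" "y \<in> Ob A" "z \<in> Ob A" "w \<in> Ob A" for x y z w
  proof -
    have "?\<phi> (x \<otimes>\<^bsub>A\<^esub> y) (z \<otimes>\<^bsub>A\<^esub> w) \<cdot>\<^bsub>B\<^esub> (?\<phi> x y \<odot>\<^bsub>B\<^esub> ?\<phi> z w) \<cdot>\<^bsub>B\<^esub> Ass B (?F x) (?F y) (?F z \<otimes>\<^bsub>B\<^esub> ?F w)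
        = ?\<phi> (x \<otimes>\<^bsub>A\<^esub> y) (z \<otimes>\<^bsub>A\<^esub> w) \<cdot>\<^bsub>B\<^esub> (?\<phi> x y \<odot>\<^bsub>B\<^esub> Idn B (?F (z \<otimes>\<^bsub>A\<^esub> w)))
          \<cdot>\<^bsub>B\<^esub> ((Idn B (?F x \<otimes>\<^bsub>B\<^esub> ?F y) \<odot>\<^bsub>B\<^esub> ?\<phi> z w) \<cdot>\<^bsub>B\<^esub> Ass B (?F x) (?F y) (?F z \<otimes>\<^bsub>B\<^esub> ?F w))"
      by (simp add: B.interchange')
    also have "\<dots> = (?\<phi> (x \<otimes>\<^bsub>A\<^esub> y) (z \<otimes>\<^bsub>A\<^esub> w) \<cdot>\<^bsub>B\<^esub> (?\<phi> x y \<odot>\<^bsub>B\<^esub> Idn B (?F (z \<otimes>\<^bsub>A\<^esub> w)))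
          \<cdot>\<^bsub>B\<^esub> Ass B (?F x) (?F y) (?F (z \<otimes>\<^bsub>A\<^esub> w))) \<cdot>\<^bsub>B\<^esub> (Idn B (?F x) \<odot>\<^bsub>B\<^esub> (Idn B (?F y) \<odot>\<^bsub>B\<^esub> ?\<phi> z w))"
      using B.Ass_natural3[of "?\<phi> z w" "?F x" "?F y", symmetric] by simp
    also have "\<dots> = far F (Ass A x y (z \<otimes>\<^bsub>A\<^esub> w)) \<cdot>\<^bsub>B\<^esub> ?\<phi> x (y \<otimes>\<^bsub>A\<^esub> (z \<otimes>\<^bsub>A\<^esub> w))
        \<cdot>\<^bsub>B\<^esub> (Idn B (?F x) \<odot>\<^bsub>B\<^esub> (?\<phi> y (z \<otimes>\<^bsub>A\<^esub> w) \<cdot>\<^bsub>B\<^esub> (Idn B (?F y) \<odot>\<^bsub>B\<^esub> ?\<phi> z w)))"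
      by (simp add: fun2_assoc[symmetric] B.whiskers)
    finally show ?thesis .
  qed
  have "?L \<cdot>\<^bsub>B\<^esub> Ass B (?F a) (?F b) (?F c \<otimes>\<^bsub>B\<^esub> ?F d)
      = far F (A.mid a b c d \<cdot>\<^bsub>A\<^esub> Ass A a b (c \<otimes>\<^bsub>A\<^esub> d)) \<cdot>\<^bsub>B\<^esub> ?\<phi> a (b \<otimes>\<^bsub>A\<^esub> (c \<otimes>\<^bsub>A\<^esub> d))
        \<cdot>\<^bsub>B\<^esub> (Idn B (?F a) \<odot>\<^bsub>B\<^esub> (?\<phi> b (c \<otimes>\<^bsub>A\<^esub> d) \<cdot>\<^bsub>B\<^esub> (Idn B (?F b) \<odot>\<^bsub>B\<^esub> ?\<phi> c d)))"
    by (simp add: bracket)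
  also have "\<dots> = far F (Ass A a c (b \<otimes>\<^bsub>A\<^esub> d)) \<cdot>\<^bsub>B\<^esub> ?\<phi> a (c \<otimes>\<^bsub>A\<^esub> (b \<otimes>\<^bsub>A\<^esub> d))
        \<cdot>\<^bsub>B\<^esub> (Idn B (?F a) \<odot>\<^bsub>B\<^esub> (far F (A.exch b c d) \<cdot>\<^bsub>B\<^esub> ?\<phi> b (c \<otimes>\<^bsub>A\<^esub> d) \<cdot>\<^bsub>B\<^esub> (Idn B (?F b) \<odot>\<^bsub>B\<^esub> ?\<phi> c d)))"
    unfolding A.mid_Ass[OF assms(2-)] by (simp add: fun2_natural_right[THEN B.reassoc] B.whiskers)
  also have "\<dots> = (far F (Ass A a c (b \<otimes>\<^bsub>A\<^esub> d)) \<cdot>\<^bsub>B\<^esub> ?\<phi> a (c \<otimes>\<^bsub>A\<^esub> (b \<otimes>\<^bsub>A\<^esub> d))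
        \<cdot>\<^bsub>B\<^esub> (Idn B (?F a) \<odot>\<^bsub>B\<^esub> (?\<phi> c (b \<otimes>\<^bsub>A\<^esub> d) \<cdot>\<^bsub>B\<^esub> (Idn B (?F c) \<odot>\<^bsub>B\<^esub> ?\<phi> b d))))
        \<cdot>\<^bsub>B\<^esub> (Idn B (?F a) \<odot>\<^bsub>B\<^esub> B.exch (?F b) (?F c) (?F d))"
    unfolding fun2_exch[OF assms(1,3-)] by (simp add: B.whiskers)
  also have "\<dots> = ?R \<cdot>\<^bsub>B\<^esub> Ass B (?F a) (?F b) (?F c \<otimes>\<^bsub>B\<^esub> ?F d)"
    by (simp add: bracket[symmetric] B.mid_Ass)
  finally show ?thesis by (rule B.iso_epi[rotated]) simp_all
qed

text \<open>Monoidality of \<open>F\<^sup>0\<close>, as a transformation with constant component, with respect to the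
  multiplication.\<close>

lemma fun0_Unt:
  assumes [simp]: "F \<in> Ob \<lbrakk>A, B\<rbrakk>\<^sub>0"
  shows "far F (Rgt A (Unt A)) \<cdot>\<^bsub>B\<^esub> fun2 F (Unt A) (Unt A) \<cdot>\<^bsub>B\<^esub> (fun0 F \<odot>\<^bsub>B\<^esub> fun0 F) = fun0 F \<cdot>\<^bsub>B\<^esub> Rgt B (Unt B)"
proof -
  have "far F (Rgt A (Unt A)) \<cdot>\<^bsub>B\<^esub> fun2 F (Unt A) (Unt A) \<cdot>\<^bsub>B\<^esub> (fun0 F \<odot>\<^bsub>B\<^esub> fun0 F)
      = (far F (Rgt A (Unt A)) \<cdot>\<^bsub>B\<^esub> fun2 F (Unt A) (Unt A) \<cdot>\<^bsub>B\<^esub> (Idn B (fob F (Unt A)) \<odot>\<^bsub>B\<^esub> fun0 F)) \<cdot>\<^bsub>B\<^esub> (fun0 F \<odot>\<^bsub>B\<^esub> Idn B (Unt B))"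
    by (simp add: B.interchange)
  also have "\<dots> = fun0 F \<cdot>\<^bsub>B\<^esub> Rgt B (Unt B)"
    by (simp add: fun0_Rgt B.Rgt_natural)
  finally show ?thesis .
qed

text \<open>The same square with the unit arrows inverted.\<close>

lemma fun0_Unt':
  assumes [simp]: "F \<in> Ob \<lbrakk>A, B\<rbrakk>\<^sub>0"
  shows "fun2 F (Unt A) (Unt A) \<cdot>\<^bsub>B\<^esub> (fun0 F \<odot>\<^bsub>B\<^esub> fun0 F) \<cdot>\<^bsub>B\<^esub> inverse_of B (Rgt B (Unt B))
       = far F (inverse_of A (Rgt A (Unt A))) \<cdot>\<^bsub>B\<^esub> fun0 F"
proof -
  have "inverse_of B (far F (Rgt A (Unt A))) \<cdot>\<^bsub>B\<^esub> fun0 F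
      = (fun2 F (Unt A) (Unt A) \<cdot>\<^bsub>B\<^esub> (fun0 F \<odot>\<^bsub>B\<^esub> fun0 F)) \<cdot>\<^bsub>B\<^esub> inverse_of B (Rgt B (Unt B))"
    by (rule B.move_inverses) (simp_all add: fun0_Unt far_iso)
  then show ?thesis by (simp add: far_iso)
qed

end

text \<open>The four ends of a functor \<open>C \<rightarrow> A\<close> in the contravariant and a functor \<open>B \<rightarrow> D\<close> in the
  covariant argument of the internal hom.\<close>

locale smc_hom_map = CA: smc_hom C A + BD: smc_hom B D
  for C :: "('oc, 'mc) smc" and A :: "('oa, 'ma) smc" and B :: "('ob, 'mb) smc" and D :: "('od, 'md) smc"
begin

sublocale AB: smc_hom A B ..
sublocale CD: smc_hom C D ..
sublocale CAB: smc_comp C A B ..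
sublocale CBD: smc_comp C B D ..

sublocale hom: smc_hom "\<lbrakk>A, B\<rbrakk>\<^sub>0" "\<lbrakk>C, D\<rbrakk>\<^sub>0"
  by (simp add: smc_hom_def AB.hom_sym_mon_category CD.hom_sym_mon_category)

context
  fixes F :: "('oc, 'mc, 'oa, 'ma) smf" and G :: "('ob, 'mb, 'od, 'md) smf"
  assumes F [simp]: "F \<in> Ob \<lbrakk>C, A\<rbrakk>\<^sub>0" and G [simp]: "G \<in> Ob \<lbrakk>B, D\<rbrakk>\<^sub>0"
begin

lemma hom_smf_simps [simp]:
  "fdom \<lbrakk>F, G\<rbrakk>\<^sub>1 = \<lbrakk>A, B\<rbrakk>\<^sub>0" "fcod \<lbrakk>F, G\<rbrakk>\<^sub>1 = \<lbrakk>C, D\<rbrakk>\<^sub>0"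
  "H \<in> Ob \<lbrakk>A, B\<rbrakk>\<^sub>0 \<Longrightarrow> fob \<lbrakk>F, G\<rbrakk>\<^sub>1 H = G \<circ>\<^sub>F H \<circ>\<^sub>F F"
  "\<theta> \<in> Ar \<lbrakk>A, B\<rbrakk>\<^sub>0 \<Longrightarrow> far \<lbrakk>F, G\<rbrakk>\<^sub>1 \<theta> = mnt_id G *\<^sub>h \<theta> *\<^sub>h mnt_id F"
  "ndom (fun0 \<lbrakk>F, G\<rbrakk>\<^sub>1) = smf_const C D" "ncod (fun0 \<lbrakk>F, G\<rbrakk>\<^sub>1) = G \<circ>\<^sub>F smf_const A B \<circ>\<^sub>F F"
  "c \<in> Ob C \<Longrightarrow> ncomp (fun0 \<lbrakk>F, G\<rbrakk>\<^sub>1) c = fun0 G"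
  "\<lbrakk>H \<in> Ob \<lbrakk>A, B\<rbrakk>\<^sub>0; K \<in> Ob \<lbrakk>A, B\<rbrakk>\<^sub>0\<rbrakk> \<Longrightarrow> ndom (fun2 \<lbrakk>F, G\<rbrakk>\<^sub>1 H K) = smf_tensor (G \<circ>\<^sub>F H \<circ>\<^sub>F F) (G \<circ>\<^sub>F K \<circ>\<^sub>F F)"
  "\<lbrakk>H \<in> Ob \<lbrakk>A, B\<rbrakk>\<^sub>0; K \<in> Ob \<lbrakk>A, B\<rbrakk>\<^sub>0\<rbrakk> \<Longrightarrow> ncod (fun2 \<lbrakk>F, G\<rbrakk>\<^sub>1 H K) = G \<circ>\<^sub>F smf_tensor H K \<circ>\<^sub>F F"
  "\<lbrakk>H \<in> Ob \<lbrakk>A, B\<rbrakk>\<^sub>0; K \<in> Ob \<lbrakk>A, B\<rbrakk>\<^sub>0; c \<in> Ob C\<rbrakk>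
   \<Longrightarrow> ncomp (fun2 \<lbrakk>F, G\<rbrakk>\<^sub>1 H K) c = fun2 G (fob H (fob F c)) (fob K (fob F c))"
  by (simp_all add: hom_smf_def Let_def)

lemma hom_smf_extensional:
  "fob \<lbrakk>F, G\<rbrakk>\<^sub>1 \<in> extensional (Ob \<lbrakk>A, B\<rbrakk>\<^sub>0)" "far \<lbrakk>F, G\<rbrakk>\<^sub>1 \<in> extensional (Ar \<lbrakk>A, B\<rbrakk>\<^sub>0)"
  "fun2 \<lbrakk>F, G\<rbrakk>\<^sub>1 \<in> extensional (Ob \<lbrakk>A, B\<rbrakk>\<^sub>0)" "H \<in> Ob \<lbrakk>A, B\<rbrakk>\<^sub>0 \<Longrightarrow> fun2 \<lbrakk>F, G\<rbrakk>\<^sub>1 H \<in> extensional (Ob \<lbrakk>A, B\<rbrakk>\<^sub>0)"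
  "ncomp (fun0 \<lbrakk>F, G\<rbrakk>\<^sub>1) \<in> extensional (Ob C)"
  "\<lbrakk>H \<in> Ob \<lbrakk>A, B\<rbrakk>\<^sub>0; K \<in> Ob \<lbrakk>A, B\<rbrakk>\<^sub>0\<rbrakk> \<Longrightarrow> ncomp (fun2 \<lbrakk>F, G\<rbrakk>\<^sub>1 H K) \<in> extensional (Ob C)"
  by (simp_all add: hom_smf_def Let_def)

lemma hom_smf_fun0_in: "fun0 \<lbrakk>F, G\<rbrakk>\<^sub>1 \<in> Ar \<lbrakk>C, D\<rbrakk>\<^sub>0"
  by (rule CD.mntI) (simp_all add: hom_smf_extensional BD.fun0_Unt)

text \<open>The monoidal structure of \<open>G H F \<otimes> G K F\<close> involves the interchange in \<open>D\<close>, that of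
  \<open>G (H \<otimes> K) F\<close> the image under \<open>G\<close> of the interchange in \<open>B\<close>; so monoidality of this
  transformation amounts to \<open>G\<close> preserving the interchange.\<close>

lemma hom_smf_fun2_in:
  assumes [simp]: "H \<in> Ob \<lbrakk>A, B\<rbrakk>\<^sub>0" "K \<in> Ob \<lbrakk>A, B\<rbrakk>\<^sub>0"
  shows "fun2 \<lbrakk>F, G\<rbrakk>\<^sub>1 H K \<in> Ar \<lbrakk>C, D\<rbrakk>\<^sub>0" (is "?\<rho> \<in> _")
proof (rule CD.mntI)
  let ?r' = "inverse_of B (Rgt B (Unt B))" and ?I = "Unt A"
  have "fun2 G (fob H (fob F (Unt C))) (fob K (fob F (Unt C)))
      \<cdot>\<^bsub>D\<^esub> ((far G (far H (fun0 F)) \<cdot>\<^bsub>D\<^esub> far G (fun0 H) \<cdot>\<^bsub>D\<^esub> fun0 G) \<odot>\<^bsub>D\<^esub> (far G (far K (fun0 F)) \<cdot>\<^bsub>D\<^esub> far G (fun0 K) \<cdot>\<^bsub>D\<^esub> fun0 G))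
      \<cdot>\<^bsub>D\<^esub> inverse_of D (Rgt D (Unt D))
    = (fun2 G (fob H (fob F (Unt C))) (fob K (fob F (Unt C)))
      \<cdot>\<^bsub>D\<^esub> (far G (far H (fun0 F)) \<odot>\<^bsub>D\<^esub> far G (far K (fun0 F)))) \<cdot>\<^bsub>D\<^esub> (far G (fun0 H) \<odot>\<^bsub>D\<^esub> far G (fun0 K))
      \<cdot>\<^bsub>D\<^esub> (fun0 G \<odot>\<^bsub>D\<^esub> fun0 G) \<cdot>\<^bsub>D\<^esub> inverse_of D (Rgt D (Unt D))"
    by (simp add: BD.B.interchange')
  also have "\<dots> = far G (far H (fun0 F) \<odot>\<^bsub>B\<^esub> far K (fun0 F)) \<cdot>\<^bsub>D\<^esub> far G (fun0 H \<odot>\<^bsub>B\<^esub> fun0 K)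
      \<cdot>\<^bsub>D\<^esub> fun2 G (Unt B) (Unt B) \<cdot>\<^bsub>D\<^esub> (fun0 G \<odot>\<^bsub>D\<^esub> fun0 G) \<cdot>\<^bsub>D\<^esub> inverse_of D (Rgt D (Unt D))"
    by (simp add: BD.fun2_natural[THEN BD.B.reassoc])
  also have "\<dots> = far G (far H (fun0 F) \<odot>\<^bsub>B\<^esub> far K (fun0 F)) \<cdot>\<^bsub>D\<^esub> far G (fun0 H \<odot>\<^bsub>B\<^esub> fun0 K) \<cdot>\<^bsub>D\<^esub> far G ?r' \<cdot>\<^bsub>D\<^esub> fun0 G"
    by (simp add: BD.fun0_Unt')
  finally show "ncomp ?\<rho> (Unt C) \<cdot>\<^bsub>D\<^esub> fun0 (ndom ?\<rho>) = fun0 (ncod ?\<rho>)"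
    by simp
next
  fix x y assume [simp]: "x \<in> Ob C" "y \<in> Ob C"
  let ?H = "\<lambda>x. fob H (fob F x)" and ?K = "\<lambda>x. fob K (fob F x)"
  let ?h = "far H (fun2 F x y)" and ?k = "far K (fun2 F x y)"
  let ?h2 = "fun2 H (fob F x) (fob F y)" and ?k2 = "fun2 K (fob F x) (fob F y)"
  let ?mid = "middle4 D (fob G (?H x)) (fob G (?K x)) (fob G (?H y)) (fob G (?K y))"
  have "fun2 G (?H (x \<otimes>\<^bsub>C\<^esub> y)) (?K (x \<otimes>\<^bsub>C\<^esub> y))
      \<cdot>\<^bsub>D\<^esub> ((far G ?h \<cdot>\<^bsub>D\<^esub> far G ?h2 \<cdot>\<^bsub>D\<^esub> fun2 G (?H x) (?H y)) \<odot>\<^bsub>D\<^esub> (far G ?k \<cdot>\<^bsub>D\<^esub> far G ?k2 \<cdot>\<^bsub>D\<^esub> fun2 G (?K x) (?K y))) \<cdot>\<^bsub>D\<^esub> ?mid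
    = (fun2 G (?H (x \<otimes>\<^bsub>C\<^esub> y)) (?K (x \<otimes>\<^bsub>C\<^esub> y)) \<cdot>\<^bsub>D\<^esub> (far G ?h \<odot>\<^bsub>D\<^esub> far G ?k)) \<cdot>\<^bsub>D\<^esub> (far G ?h2 \<odot>\<^bsub>D\<^esub> far G ?k2)
      \<cdot>\<^bsub>D\<^esub> (fun2 G (?H x) (?H y) \<odot>\<^bsub>D\<^esub> fun2 G (?K x) (?K y)) \<cdot>\<^bsub>D\<^esub> ?mid"
    by (simp add: BD.B.interchange')
  also have "\<dots> = far G (?h \<odot>\<^bsub>B\<^esub> ?k) \<cdot>\<^bsub>D\<^esub> far G (?h2 \<odot>\<^bsub>B\<^esub> ?k2) \<cdot>\<^bsub>D\<^esub> fun2 G (?H x \<otimes>\<^bsub>B\<^esub> ?H y) (?K x \<otimes>\<^bsub>B\<^esub> ?K y)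
      \<cdot>\<^bsub>D\<^esub> (fun2 G (?H x) (?H y) \<odot>\<^bsub>D\<^esub> fun2 G (?K x) (?K y)) \<cdot>\<^bsub>D\<^esub> ?mid"
    by (simp add: BD.fun2_natural[THEN BD.B.reassoc])
  also have "\<dots> = far G (?h \<odot>\<^bsub>B\<^esub> ?k) \<cdot>\<^bsub>D\<^esub> far G (?h2 \<odot>\<^bsub>B\<^esub> ?k2) \<cdot>\<^bsub>D\<^esub> far G (middle4 B (?H x) (?K x) (?H y) (?K y))
      \<cdot>\<^bsub>D\<^esub> fun2 G (?H x \<otimes>\<^bsub>B\<^esub> ?K x) (?H y \<otimes>\<^bsub>B\<^esub> ?K y) \<cdot>\<^bsub>D\<^esub> (fun2 G (?H x) (?K x) \<odot>\<^bsub>D\<^esub> fun2 G (?H y) (?K y))"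
    by (simp add: BD.fun2_mid)
  finally show "ncomp ?\<rho> (x \<otimes>\<^bsub>C\<^esub> y) \<cdot>\<^bsub>D\<^esub> fun2 (ndom ?\<rho>) x y
     = fun2 (ncod ?\<rho>) x y \<cdot>\<^bsub>D\<^esub> (ncomp ?\<rho> x \<odot>\<^bsub>D\<^esub> ncomp ?\<rho> y)"
    by simp
qed (simp_all add: hom_smf_extensional BD.fun2_natural)

lemma hom_smf_in [simp]: "\<lbrakk>F, G\<rbrakk>\<^sub>1 \<in> Ob \<lbrakk>\<lbrakk>A, B\<rbrakk>\<^sub>0, \<lbrakk>C, D\<rbrakk>\<^sub>0\<rbrakk>\<^sub>0"
proof -
  note [simp] = hom_smf_fun0_in hom_smf_fun2_in
  show ?thesis
  by (rule hom.smfI; (simp add: hom_smf_extensional)?; rule CD.mnt_eqI)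
   (simp_all add: BD.fun2_natural BD.fun2_assoc BD.fun0_Rgt BD.fun0_Lft BD.fun2_Sym)
qed

end

end

lemma hom_mnt_boundary [simp]:
  "ndom \<lbrakk>\<sigma>, \<tau>\<rbrakk>\<^sub>2 = \<lbrakk>ndom \<sigma>, ndom \<tau>\<rbrakk>\<^sub>1" "ncod \<lbrakk>\<sigma>, \<tau>\<rbrakk>\<^sub>2 = \<lbrakk>ncod \<sigma>, ncod \<tau>\<rbrakk>\<^sub>1"
  by (simp_all add: hom_mnt_def)

context smc_hom_map
begin

context
  fixes \<sigma> :: "('oc, 'mc, 'oa, 'ma) mnt" and \<tau> :: "('ob, 'mb, 'od, 'md) mnt"
  assumes \<sigma> [simp]: "\<sigma> \<in> Ar \<lbrakk>C, A\<rbrakk>\<^sub>0" and \<tau> [simp]: "\<tau> \<in> Ar \<lbrakk>B, D\<rbrakk>\<^sub>0"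
begin

lemma hom_mnt_simps [simp]:
  "H \<in> Ob \<lbrakk>A, B\<rbrakk>\<^sub>0 \<Longrightarrow> ncomp \<lbrakk>\<sigma>, \<tau>\<rbrakk>\<^sub>2 H = \<tau> *\<^sub>h mnt_id H *\<^sub>h \<sigma>"
  by (simp_all add: hom_mnt_def)

lemma hom_mnt_in [simp]: "\<lbrakk>\<sigma>, \<tau>\<rbrakk>\<^sub>2 \<in> Ar \<lbrakk>\<lbrakk>A, B\<rbrakk>\<^sub>0, \<lbrakk>C, D\<rbrakk>\<^sub>0\<rbrakk>\<^sub>0" (is "?\<rho> \<in> _")
proof (rule hom.mntI)
  show "ncomp ?\<rho> \<in> extensional (Ob \<lbrakk>A, B\<rbrakk>\<^sub>0)" by (simp add: hom_mnt_def)
next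
  fix \<theta> assume [simp]: "\<theta> \<in> Ar \<lbrakk>A, B\<rbrakk>\<^sub>0"
  have \<theta>: "far (ndom \<tau>) (far (ncod \<theta>) (ncomp \<sigma> c)) \<cdot>\<^bsub>D\<^esub> far (ndom \<tau>) (ncomp \<theta> (fob (ndom \<sigma>) c))
      = far (ndom \<tau>) (ncomp \<theta> (fob (ncod \<sigma>) c)) \<cdot>\<^bsub>D\<^esub> far (ndom \<tau>) (far (ndom \<theta>) (ncomp \<sigma> c))" if "c \<in> Ob C" for c
    using that AB.ncomp_natural[of \<theta> "ncomp \<sigma> c"] by (simp flip: BD.far_comp)
  show "ncomp ?\<rho> (Cod \<lbrakk>A, B\<rbrakk>\<^sub>0 \<theta>) \<cdot>\<^bsub>\<lbrakk>C, D\<rbrakk>\<^sub>0\<^esub> far (ndom ?\<rho>) \<theta>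
      = far (ncod ?\<rho>) \<theta> \<cdot>\<^bsub>\<lbrakk>C, D\<rbrakk>\<^sub>0\<^esub> ncomp ?\<rho> (Dom \<lbrakk>A, B\<rbrakk>\<^sub>0 \<theta>)"
    by (simp; rule CD.mnt_eqI) (simp_all add: \<theta> BD.ncomp_natural[THEN BD.B.reassoc])
next
  note [simp] = hom_smf_fun0_in hom_smf_fun2_in
  show "ncomp ?\<rho> (Unt \<lbrakk>A, B\<rbrakk>\<^sub>0) \<cdot>\<^bsub>\<lbrakk>C, D\<rbrakk>\<^sub>0\<^esub> fun0 (ndom ?\<rho>) = fun0 (ncod ?\<rho>)"
    by (simp; rule CD.mnt_eqI) (simp_all add: BD.ncomp_fun0)
  fix H K assume [simp]: "H \<in> Ob \<lbrakk>A, B\<rbrakk>\<^sub>0" "K \<in> Ob \<lbrakk>A, B\<rbrakk>\<^sub>0"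
  show "ncomp ?\<rho> (H \<otimes>\<^bsub>\<lbrakk>A, B\<rbrakk>\<^sub>0\<^esub> K) \<cdot>\<^bsub>\<lbrakk>C, D\<rbrakk>\<^sub>0\<^esub> fun2 (ndom ?\<rho>) H K
      = fun2 (ncod ?\<rho>) H K \<cdot>\<^bsub>\<lbrakk>C, D\<rbrakk>\<^sub>0\<^esub> (ncomp ?\<rho> H \<odot>\<^bsub>\<lbrakk>C, D\<rbrakk>\<^sub>0\<^esub> ncomp ?\<rho> K)"
    by (simp; rule CD.mnt_eqI)
      (simp_all add: BD.fun2_natural BD.ncomp_fun2[THEN BD.B.reassoc] BD.B.interchange)
qed simp_all

end

lemma hom_mnt_unit:
  assumes [simp]: "F \<in> Ob \<lbrakk>C, A\<rbrakk>\<^sub>0" "G \<in> Ob \<lbrakk>B, D\<rbrakk>\<^sub>0"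
  shows "\<lbrakk>mnt_id F, mnt_id G\<rbrakk>\<^sub>2 = mnt_id \<lbrakk>F, G\<rbrakk>\<^sub>1"
  by (rule hom.mnt_eqI) simp_all

lemma hom_mnt_vcomp:
  assumes [simp]: "\<sigma> \<in> Ar \<lbrakk>C, A\<rbrakk>\<^sub>0" "\<sigma>' \<in> Ar \<lbrakk>C, A\<rbrakk>\<^sub>0" "\<tau> \<in> Ar \<lbrakk>B, D\<rbrakk>\<^sub>0" "\<tau>' \<in> Ar \<lbrakk>B, D\<rbrakk>\<^sub>0"
    "ndom \<sigma>' = ncod \<sigma>" "ndom \<tau>' = ncod \<tau>"
  shows "\<lbrakk>mnt_vcomp \<sigma>' \<sigma>, mnt_vcomp \<tau>' \<tau>\<rbrakk>\<^sub>2 = mnt_vcomp \<lbrakk>\<sigma>', \<tau>'\<rbrakk>\<^sub>2 \<lbrakk>\<sigma>, \<tau>\<rbrakk>\<^sub>2"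
proof (rule hom.mnt_eqI)
  fix H assume [simp]: "H \<in> Ob \<lbrakk>A, B\<rbrakk>\<^sub>0"
  show "ncomp \<lbrakk>mnt_vcomp \<sigma>' \<sigma>, mnt_vcomp \<tau>' \<tau>\<rbrakk>\<^sub>2 H = ncomp (mnt_vcomp \<lbrakk>\<sigma>', \<tau>'\<rbrakk>\<^sub>2 \<lbrakk>\<sigma>, \<tau>\<rbrakk>\<^sub>2) H"
    by (simp; rule CD.mnt_eqI) (simp_all add: BD.ncomp_natural[THEN BD.B.reassoc])
qed simp_all

end

lemma hom_smf_unit:
  assumes "sym_mon_category A" "sym_mon_category B"
  shows "\<lbrakk>smf_id A, smf_id B\<rbrakk>\<^sub>1 = smf_id \<lbrakk>A, B\<rbrakk>\<^sub>0"
proof -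
  interpret AB: smc_hom A B using assms by (simp add: smc_hom_def)
  interpret AABB: smc_hom_map A A B B using assms by (simp add: smc_hom_map_def smc_hom_def)
  note [simp] = assms AB.hom_sym_mon_category smf_comp_id[of _ A B] mnt_hcomp_id[OF _ assms]
    AABB.hom_smf_fun0_in AABB.hom_smf_fun2_in
  show ?thesis
  proof (rule AABB.hom.smf_eqI)
    show "fun0 \<lbrakk>smf_id A, smf_id B\<rbrakk>\<^sub>1 = fun0 (smf_id \<lbrakk>A, B\<rbrakk>\<^sub>0)"
      by (rule AB.mnt_eqI) simp_all
    fix H K assume [simp]: "H \<in> Ob \<lbrakk>A, B\<rbrakk>\<^sub>0" "K \<in> Ob \<lbrakk>A, B\<rbrakk>\<^sub>0"
    show "fun2 \<lbrakk>smf_id A, smf_id B\<rbrakk>\<^sub>1 H K = fun2 (smf_id \<lbrakk>A, B\<rbrakk>\<^sub>0) H K"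
      by (rule AB.mnt_eqI) simp_all
  qed simp_all
qed

text \<open>Two composable pairs: \<open>E \<rightarrow> C \<rightarrow> A\<close> on the contravariant side and \<open>B \<rightarrow> D \<rightarrow> L\<close> on the
  covariant side.\<close>

locale smc_hom_map_comp = inner: smc_hom_map C A B D + outer: smc_hom_map E C D L
  for E :: "('oe, 'me) smc" and C :: "('oc, 'mc) smc" and A :: "('oa, 'ma) smc"
    and B :: "('ob, 'mb) smc" and D :: "('od, 'md) smc" and L :: "('ol, 'ml) smc"
begin

sublocale ECA: smc_comp E C A ..
sublocale BDL: smc_comp B D L ..
sublocale both: smc_hom_map E A B L ..
sublocale hom_comp: smc_comp "\<lbrakk>A, B\<rbrakk>\<^sub>0" "\<lbrakk>C, D\<rbrakk>\<^sub>0" "\<lbrakk>E, L\<rbrakk>\<^sub>0" ..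
sublocale CBL: smc_comp C B L ..
sublocale CDL: smc_comp C D L ..
sublocale ECB: smc_comp E C B ..
sublocale ECL: smc_comp E C L ..
sublocale EBD: smc_comp E B D ..

lemma hom_smf_comp:
  assumes [simp]: "F \<in> Ob \<lbrakk>C, A\<rbrakk>\<^sub>0" "F' \<in> Ob \<lbrakk>E, C\<rbrakk>\<^sub>0" "G \<in> Ob \<lbrakk>B, D\<rbrakk>\<^sub>0" "G' \<in> Ob \<lbrakk>D, L\<rbrakk>\<^sub>0"
  shows "\<lbrakk>F \<circ>\<^sub>F F', G' \<circ>\<^sub>F G\<rbrakk>\<^sub>1 = \<lbrakk>F', G'\<rbrakk>\<^sub>1 \<circ>\<^sub>F \<lbrakk>F, G\<rbrakk>\<^sub>1"
proof (rule both.hom.smf_eqI)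
  note [simp] = inner.hom_smf_fun0_in inner.hom_smf_fun2_in outer.hom_smf_fun0_in outer.hom_smf_fun2_in
    both.hom_smf_fun0_in both.hom_smf_fun2_in
  have assoc [simp]: "(G' \<circ>\<^sub>F G) \<circ>\<^sub>F H \<circ>\<^sub>F F \<circ>\<^sub>F F' = G' \<circ>\<^sub>F (G \<circ>\<^sub>F H \<circ>\<^sub>F F) \<circ>\<^sub>F F'" if [simp]: "H \<in> Ob \<lbrakk>A, B\<rbrakk>\<^sub>0" for H
    by (rule outer.CD.smf_eqI) simp_all
  show "fun0 \<lbrakk>F \<circ>\<^sub>F F', G' \<circ>\<^sub>F G\<rbrakk>\<^sub>1 = fun0 (\<lbrakk>F', G'\<rbrakk>\<^sub>1 \<circ>\<^sub>F \<lbrakk>F, G\<rbrakk>\<^sub>1)"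
    by (rule outer.CD.mnt_eqI) simp_all
  fix H K assume [simp]: "H \<in> Ob \<lbrakk>A, B\<rbrakk>\<^sub>0" "K \<in> Ob \<lbrakk>A, B\<rbrakk>\<^sub>0"
  show "fob \<lbrakk>F \<circ>\<^sub>F F', G' \<circ>\<^sub>F G\<rbrakk>\<^sub>1 H = fob (\<lbrakk>F', G'\<rbrakk>\<^sub>1 \<circ>\<^sub>F \<lbrakk>F, G\<rbrakk>\<^sub>1) H"
    by simp
  show "fun2 \<lbrakk>F \<circ>\<^sub>F F', G' \<circ>\<^sub>F G\<rbrakk>\<^sub>1 H K = fun2 (\<lbrakk>F', G'\<rbrakk>\<^sub>1 \<circ>\<^sub>F \<lbrakk>F, G\<rbrakk>\<^sub>1) H K"
    by (rule outer.CD.mnt_eqI) simp_all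
next
  fix \<theta> assume [simp]: "\<theta> \<in> Ar \<lbrakk>A, B\<rbrakk>\<^sub>0"
  have assoc [simp]: "(G' \<circ>\<^sub>F G) \<circ>\<^sub>F H \<circ>\<^sub>F F \<circ>\<^sub>F F' = G' \<circ>\<^sub>F (G \<circ>\<^sub>F H \<circ>\<^sub>F F) \<circ>\<^sub>F F'" if [simp]: "H \<in> Ob \<lbrakk>A, B\<rbrakk>\<^sub>0" for H
    by (rule outer.CD.smf_eqI) simp_all
  show "far \<lbrakk>F \<circ>\<^sub>F F', G' \<circ>\<^sub>F G\<rbrakk>\<^sub>1 \<theta> = far (\<lbrakk>F', G'\<rbrakk>\<^sub>1 \<circ>\<^sub>F \<lbrakk>F, G\<rbrakk>\<^sub>1) \<theta>"
    by (rule outer.CD.mnt_eqI) simp_all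
qed simp_all

text \<open>At an object \<open>e\<close> the two sides differ by naturality of \<open>\<sigma>\<close> at \<open>\<sigma>'\<^sub>e\<close> and of
  \<open>\<tau>\<close> at the resulting arrow.\<close>

lemma hom_mnt_hcomp:
  assumes [simp]: "\<sigma> \<in> Ar \<lbrakk>C, A\<rbrakk>\<^sub>0" "\<sigma>' \<in> Ar \<lbrakk>E, C\<rbrakk>\<^sub>0" "\<tau> \<in> Ar \<lbrakk>B, D\<rbrakk>\<^sub>0" "\<tau>' \<in> Ar \<lbrakk>D, L\<rbrakk>\<^sub>0"
  shows "\<lbrakk>\<sigma> *\<^sub>h \<sigma>', \<tau>' *\<^sub>h \<tau>\<rbrakk>\<^sub>2 = \<lbrakk>\<sigma>', \<tau>'\<rbrakk>\<^sub>2 *\<^sub>h \<lbrakk>\<sigma>, \<tau>\<rbrakk>\<^sub>2"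
proof (rule both.hom.mnt_eqI)
  fix H assume [simp]: "H \<in> Ob \<lbrakk>A, B\<rbrakk>\<^sub>0"
  have assoc: "(G' \<circ>\<^sub>F G) \<circ>\<^sub>F H \<circ>\<^sub>F F \<circ>\<^sub>F F' = G' \<circ>\<^sub>F (G \<circ>\<^sub>F H \<circ>\<^sub>F F) \<circ>\<^sub>F F'"
    if [simp]: "F \<in> Ob \<lbrakk>C, A\<rbrakk>\<^sub>0" "F' \<in> Ob \<lbrakk>E, C\<rbrakk>\<^sub>0" "G \<in> Ob \<lbrakk>B, D\<rbrakk>\<^sub>0" "G' \<in> Ob \<lbrakk>D, L\<rbrakk>\<^sub>0" for F F' G G'
    by (rule outer.CD.smf_eqI) simp_all
  show "ncomp \<lbrakk>\<sigma> *\<^sub>h \<sigma>', \<tau>' *\<^sub>h \<tau>\<rbrakk>\<^sub>2 H = ncomp (\<lbrakk>\<sigma>', \<tau>'\<rbrakk>\<^sub>2 *\<^sub>h \<lbrakk>\<sigma>, \<tau>\<rbrakk>\<^sub>2) H"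
  proof (rule outer.CD.mnt_eqI)
    fix e assume [simp]: "e \<in> Ob E"
    let ?G = "far (ndom \<tau>)" and ?H = "far H" and ?s = "ncomp \<sigma>" and ?t = "ncomp \<sigma>' e"
    have "ncomp \<tau> (fob H (fob (ncod \<sigma>) (fob (ncod \<sigma>') e))) \<cdot>\<^bsub>D\<^esub> ?G (?H (?s (fob (ncod \<sigma>') e) \<cdot>\<^bsub>A\<^esub> far (ndom \<sigma>) ?t))
        = ncomp \<tau> (fob H (fob (ncod \<sigma>) (fob (ncod \<sigma>') e))) \<cdot>\<^bsub>D\<^esub> ?G (?H (far (ncod \<sigma>) ?t \<cdot>\<^bsub>A\<^esub> ?s (fob (ndom \<sigma>') e)))"
      by (simp only: inner.CA.ncomp_natural[OF \<open>\<sigma> \<in> Ar \<lbrakk>C, A\<rbrakk>\<^sub>0\<close>, of ?t] outer.CA.ncomp_typing \<open>\<sigma>' \<in> Ar \<lbrakk>E, C\<rbrakk>\<^sub>0\<close> \<open>e \<in> Ob E\<close>)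
    also have "\<dots> = far (ncod \<tau>) (?H (far (ncod \<sigma>) ?t)) \<cdot>\<^bsub>D\<^esub> ncomp \<tau> (fob H (fob (ncod \<sigma>) (fob (ndom \<sigma>') e))) \<cdot>\<^bsub>D\<^esub> ?G (?H (?s (fob (ndom \<sigma>') e)))"
      by (simp add: inner.BD.ncomp_natural[THEN inner.BD.B.reassoc])
    finally have *: "far (ndom \<tau>') (ncomp \<tau> (fob H (fob (ncod \<sigma>) (fob (ncod \<sigma>') e)))
        \<cdot>\<^bsub>D\<^esub> ?G (?H (?s (fob (ncod \<sigma>') e) \<cdot>\<^bsub>A\<^esub> far (ndom \<sigma>) ?t)))
      = far (ndom \<tau>') (far (ncod \<tau>) (?H (far (ncod \<sigma>) ?t)) \<cdot>\<^bsub>D\<^esub> ncomp \<tau> (fob H (fob (ncod \<sigma>) (fob (ndom \<sigma>') e))) \<cdot>\<^bsub>D\<^esub> ?G (?H (?s (fob (ndom \<sigma>') e))))"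
      by simp
    show "ncomp (ncomp \<lbrakk>\<sigma> *\<^sub>h \<sigma>', \<tau>' *\<^sub>h \<tau>\<rbrakk>\<^sub>2 H) e = ncomp (ncomp (\<lbrakk>\<sigma>', \<tau>'\<rbrakk>\<^sub>2 *\<^sub>h \<lbrakk>\<sigma>, \<tau>\<rbrakk>\<^sub>2) H) e"
      using * by simp
  qed (simp_all add: assoc)
qed (simp_all add: hom_smf_comp)

end

lemma smc_hom_mapI: "\<lbrakk>smc_hom A' A; smc_hom B B'\<rbrakk> \<Longrightarrow> smc_hom_map A' A B B'"
  by (simp add: smc_hom_map_def)

lemma hom_smf_typing:
  "\<lbrakk>F \<in> Ob \<lbrakk>A', A\<rbrakk>\<^sub>0; G \<in> Ob \<lbrakk>B, B'\<rbrakk>\<^sub>0\<rbrakk> \<Longrightarrow> \<lbrakk>F, G\<rbrakk>\<^sub>1 \<in> Ob \<lbrakk>\<lbrakk>A, B\<rbrakk>\<^sub>0, \<lbrakk>A', B'\<rbrakk>\<^sub>0\<rbrakk>\<^sub>0"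
  by (intro smc_hom_map.hom_smf_in smc_hom_mapI smc_hom_of_functor)

lemma hom_mnt_typing:
  "\<lbrakk>\<sigma> \<in> Ar \<lbrakk>A', A\<rbrakk>\<^sub>0; \<tau> \<in> Ar \<lbrakk>B, B'\<rbrakk>\<^sub>0\<rbrakk> \<Longrightarrow> \<lbrakk>\<sigma>, \<tau>\<rbrakk>\<^sub>2 \<in> Ar \<lbrakk>\<lbrakk>A, B\<rbrakk>\<^sub>0, \<lbrakk>A', B'\<rbrakk>\<^sub>0\<rbrakk>\<^sub>0"
  by (intro smc_hom_map.hom_mnt_in smc_hom_mapI smc_hom_of_mnt)

lemma hom_smf_comp:
  "\<lbrakk>F \<in> Ob \<lbrakk>A', A\<rbrakk>\<^sub>0; F' \<in> Ob \<lbrakk>A'', A'\<rbrakk>\<^sub>0; G \<in> Ob \<lbrakk>B, B'\<rbrakk>\<^sub>0; G' \<in> Ob \<lbrakk>B', B''\<rbrakk>\<^sub>0\<rbrakk>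
   \<Longrightarrow> \<lbrakk>F \<circ>\<^sub>F F', G' \<circ>\<^sub>F G\<rbrakk>\<^sub>1 = \<lbrakk>F', G'\<rbrakk>\<^sub>1 \<circ>\<^sub>F \<lbrakk>F, G\<rbrakk>\<^sub>1"
  by (rule smc_hom_map_comp.hom_smf_comp[OF smc_hom_map_comp.intro])
    (simp_all add: smc_hom_mapI smc_hom_of_functor)

lemma hom_mnt_hcomp:
  "\<lbrakk>\<sigma> \<in> Ar \<lbrakk>A', A\<rbrakk>\<^sub>0; \<sigma>' \<in> Ar \<lbrakk>A'', A'\<rbrakk>\<^sub>0; \<tau> \<in> Ar \<lbrakk>B, B'\<rbrakk>\<^sub>0; \<tau>' \<in> Ar \<lbrakk>B', B''\<rbrakk>\<^sub>0\<rbrakk>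
   \<Longrightarrow> \<lbrakk>\<sigma> *\<^sub>h \<sigma>', \<tau>' *\<^sub>h \<tau>\<rbrakk>\<^sub>2 = \<lbrakk>\<sigma>', \<tau>'\<rbrakk>\<^sub>2 *\<^sub>h \<lbrakk>\<sigma>, \<tau>\<rbrakk>\<^sub>2"
  by (rule smc_hom_map_comp.hom_mnt_hcomp[OF smc_hom_map_comp.intro])
    (simp_all add: smc_hom_mapI smc_hom_of_mnt)

lemma hom_mnt_unit:
  "\<lbrakk>F \<in> Ob \<lbrakk>A', A\<rbrakk>\<^sub>0; G \<in> Ob \<lbrakk>B, B'\<rbrakk>\<^sub>0\<rbrakk> \<Longrightarrow> \<lbrakk>mnt_id F, mnt_id G\<rbrakk>\<^sub>2 = mnt_id \<lbrakk>F, G\<rbrakk>\<^sub>1"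
  by (rule smc_hom_map.hom_mnt_unit[OF smc_hom_mapI]) (simp_all add: smc_hom_of_functor)

lemma hom_mnt_vcomp:
  "\<lbrakk>\<sigma> \<in> Ar \<lbrakk>A', A\<rbrakk>\<^sub>0; \<sigma>' \<in> Ar \<lbrakk>A', A\<rbrakk>\<^sub>0; \<tau> \<in> Ar \<lbrakk>B, B'\<rbrakk>\<^sub>0; \<tau>' \<in> Ar \<lbrakk>B, B'\<rbrakk>\<^sub>0; ndom \<sigma>' = ncod \<sigma>; ndom \<tau>' = ncod \<tau>\<rbrakk>
   \<Longrightarrow> \<lbrakk>mnt_vcomp \<sigma>' \<sigma>, mnt_vcomp \<tau>' \<tau>\<rbrakk>\<^sub>2 = mnt_vcomp \<lbrakk>\<sigma>', \<tau>'\<rbrakk>\<^sub>2 \<lbrakk>\<sigma>, \<tau>\<rbrakk>\<^sub>2"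
  by (rule smc_hom_map.hom_mnt_vcomp[OF smc_hom_mapI]) (simp_all add: smc_hom_of_mnt)

lemma mnt_boundary_typing:
  assumes "\<sigma> \<in> Ar \<lbrakk>A, B\<rbrakk>\<^sub>0"
  shows "ndom \<sigma> \<in> Ob \<lbrakk>A, B\<rbrakk>\<^sub>0" "ncod \<sigma> \<in> Ob \<lbrakk>A, B\<rbrakk>\<^sub>0"
  using smc_hom.ndom_in[OF smc_hom_of_mnt assms] smc_hom.ncod_in[OF smc_hom_of_mnt assms] assms by auto

lemma Cells2_SMC_typing:
  "\<lbrakk>\<sigma> \<in> Cells2 SMC F G; F \<in> Ob \<lbrakk>A, B\<rbrakk>\<^sub>0 \<or> G \<in> Ob \<lbrakk>A, B\<rbrakk>\<^sub>0\<rbrakk>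
   \<Longrightarrow> \<sigma> \<in> Ar \<lbrakk>A, B\<rbrakk>\<^sub>0 \<and> ndom \<sigma> = F \<and> ncod \<sigma> = G \<and> F \<in> Ob \<lbrakk>A, B\<rbrakk>\<^sub>0 \<and> G \<in> Ob \<lbrakk>A, B\<rbrakk>\<^sub>0"
  using mnt_boundary_typing[of \<sigma> "fdom F" "fcod F"] by (auto simp: cells_SMC hom_Ob_iff)

lemma Cells2_SMC_dest:
  "\<sigma> \<in> Cells2 SMC F G \<Longrightarrow> \<exists>A B. \<sigma> \<in> Ar \<lbrakk>A, B\<rbrakk>\<^sub>0 \<and> ndom \<sigma> = F \<and> ncod \<sigma> = G \<and> F \<in> Ob \<lbrakk>A, B\<rbrakk>\<^sub>0 \<and> G \<in> Ob \<lbrakk>A, B\<rbrakk>\<^sub>0"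
  using mnt_boundary_typing[of \<sigma> "fdom F" "fcod F"] by (auto simp: cells_SMC)

lemma two_category_SMC3: "two_category (op1 SMC \<times>\<^sub>2 op1 SMC \<times>\<^sub>2 SMC)"
  by (intro two_category_prod two_category_op1 two_category_SMC)

lemma two_functor_hom_ABC:
  "two_functor (op1 SMC \<times>\<^sub>2 op1 SMC \<times>\<^sub>2 SMC) SMC hom_ABC"
proof (rule two_functor.intro[OF two_category_SMC3 two_category_SMC])
  let ?K = "op1 SMC \<times>\<^sub>2 op1 SMC \<times>\<^sub>2 SMC"
  fix x :: "('a, 'b) smc \<times> ('c, 'd) smc \<times> ('e, 'f) smc" assume "x \<in> cells0 ?K"
  moreover obtain A B C where x: "x = (A, B, C)" by (metis prod_cases3)
  ultimately have [simp]: "sym_mon_category A" "sym_mon_category B" "sym_mon_category C" by (simp_all add: cells_SMC)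
  then have [simp]: "sym_mon_category \<lbrakk>B, C\<rbrakk>\<^sub>0" by (intro smc_hom.hom_sym_mon_category smc_hom.intro)
  show "on0 hom_ABC x \<in> cells0 SMC"
    by (simp add: x hom_ABC_def cells_SMC smc_hom.hom_sym_mon_category smc_hom.intro)
  show "on1 hom_ABC (unit1 ?K x) = unit1 SMC (on0 hom_ABC x)"
    by (simp add: x hom_ABC_def hom_smf_unit)
next
  let ?K = "op1 SMC \<times>\<^sub>2 op1 SMC \<times>\<^sub>2 SMC"
  fix f :: "('a, 'b, 'a, 'b) smf \<times> ('c, 'd, 'c, 'd) smf \<times> ('e, 'f, 'e, 'f) smf" assume "f \<in> cells1 ?K"
  moreover obtain F G H where f: "f = (F, G, H)" by (metis prod_cases3)
  ultimately have "F \<in> Ob \<lbrakk>fdom F, fcod F\<rbrakk>\<^sub>0" "G \<in> Ob \<lbrakk>fdom G, fcod G\<rbrakk>\<^sub>0" "H \<in> Ob \<lbrakk>fdom H, fcod H\<rbrakk>\<^sub>0"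
    by (simp_all add: cells_SMC)
  note FGH = this hom_smf_typing[OF this(2,3)]
  show "on2 hom_ABC (unit2 ?K f) = unit2 SMC (on1 hom_ABC f)"
    by (simp add: f hom_ABC_def hom_mnt_unit[OF FGH(2,3)] hom_mnt_unit[OF FGH(1,4)])
next
  let ?K = "op1 SMC \<times>\<^sub>2 op1 SMC \<times>\<^sub>2 SMC"
  fix f :: "('a, 'b, 'a, 'b) smf \<times> ('c, 'd, 'c, 'd) smf \<times> ('e, 'f, 'e, 'f) smf" and x y assume "f \<in> Cells1 ?K x y"
  moreover obtain F G H A B C A' B' C' where f: "f = (F, G, H)" and x: "x = (A, B, C)" and y: "y = (A', B', C')"
    by (metis prod_cases3)
  ultimately have "F \<in> Ob \<lbrakk>A', A\<rbrakk>\<^sub>0" "G \<in> Ob \<lbrakk>B', B\<rbrakk>\<^sub>0" "H \<in> Ob \<lbrakk>C, C'\<rbrakk>\<^sub>0" by (simp_all add: cells_SMC)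
  note FGH = this hom_smf_typing[OF this(2,3)]
  show "on1 hom_ABC f \<in> Cells1 SMC (on0 hom_ABC x) (on0 hom_ABC y)"
    by (simp add: x y f hom_ABC_def cells_SMC hom_smf_typing FGH)
  fix g z assume "g \<in> Cells1 ?K y z"
  moreover obtain F' G' H' A'' B'' C'' where g: "g = (F', G', H')" and z: "z = (A'', B'', C'')"
    by (metis prod_cases3)
  ultimately have "F' \<in> Ob \<lbrakk>A'', A'\<rbrakk>\<^sub>0" "G' \<in> Ob \<lbrakk>B'', B'\<rbrakk>\<^sub>0" "H' \<in> Ob \<lbrakk>C', C''\<rbrakk>\<^sub>0"
    by (simp_all add: y cells_SMC)
  note FGH' = this hom_smf_typing[OF this(2,3)]
  show "on1 hom_ABC (comp1 ?K g f) = comp1 SMC (on1 hom_ABC g) (on1 hom_ABC f)"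
    by (simp add: f g hom_ABC_def hom_smf_comp[OF FGH(2) FGH'(2) FGH(3) FGH'(3)]
        hom_smf_comp[OF FGH(1) FGH'(1) FGH(4) FGH'(4)])
  fix s t f' g' assume "s \<in> Cells2 ?K f f'" "t \<in> Cells2 ?K g g'"
  moreover obtain \<rho> \<sigma> \<tau> \<rho>' \<sigma>' \<tau>' where s: "s = (\<rho>, \<sigma>, \<tau>)" and t: "t = (\<rho>', \<sigma>', \<tau>')" by (metis prod_cases3)
  moreover obtain F1 G1 H1 F1' G1' H1' where "f' = (F1, G1, H1)" "g' = (F1', G1', H1')" by (metis prod_cases3)
  ultimately have "\<rho> \<in> Ar \<lbrakk>A', A\<rbrakk>\<^sub>0" "\<sigma> \<in> Ar \<lbrakk>B', B\<rbrakk>\<^sub>0" "\<tau> \<in> Ar \<lbrakk>C, C'\<rbrakk>\<^sub>0"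
    "\<rho>' \<in> Ar \<lbrakk>A'', A'\<rbrakk>\<^sub>0" "\<sigma>' \<in> Ar \<lbrakk>B'', B'\<rbrakk>\<^sub>0" "\<tau>' \<in> Ar \<lbrakk>C', C''\<rbrakk>\<^sub>0"
    using FGH FGH' by (auto simp: f g dest: Cells2_SMC_typing)
  note st = this hom_mnt_typing[OF this(2,3)] hom_mnt_typing[OF this(5,6)]
  show "on2 hom_ABC (hcomp ?K t s) = hcomp SMC (on2 hom_ABC t) (on2 hom_ABC s)"
    by (simp add: s t hom_ABC_def hom_mnt_hcomp[OF st(2,5,3,6)] hom_mnt_hcomp[OF st(1,4,7,8)])
next
  let ?K = "op1 SMC \<times>\<^sub>2 op1 SMC \<times>\<^sub>2 SMC"
  fix f g :: "('a, 'b, 'a, 'b) smf \<times> ('c, 'd, 'c, 'd) smf \<times> ('e, 'f, 'e, 'f) smf" and s assume "s \<in> Cells2 ?K f g"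
  moreover obtain F G H F' G' H' \<rho> \<sigma> \<tau> where f: "f = (F, G, H)" and g: "g = (F', G', H')" and s: "s = (\<rho>, \<sigma>, \<tau>)"
    by (metis prod_cases3)
  ultimately have "\<rho> \<in> Cells2 SMC F F'" "\<sigma> \<in> Cells2 SMC G G'" "\<tau> \<in> Cells2 SMC H H'" by simp_all
  from this[THEN Cells2_SMC_dest] obtain A A' B B' C C' where
    \<rho>: "\<rho> \<in> Ar \<lbrakk>A', A\<rbrakk>\<^sub>0" "ndom \<rho> = F" "ncod \<rho> = F'" "F \<in> Ob \<lbrakk>A', A\<rbrakk>\<^sub>0" "F' \<in> Ob \<lbrakk>A', A\<rbrakk>\<^sub>0"
    and \<sigma>: "\<sigma> \<in> Ar \<lbrakk>B', B\<rbrakk>\<^sub>0" "ndom \<sigma> = G" "ncod \<sigma> = G'" "G \<in> Ob \<lbrakk>B', B\<rbrakk>\<^sub>0" "G' \<in> Ob \<lbrakk>B', B\<rbrakk>\<^sub>0"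
    and \<tau>: "\<tau> \<in> Ar \<lbrakk>C, C'\<rbrakk>\<^sub>0" "ndom \<tau> = H" "ncod \<tau> = H'" "H \<in> Ob \<lbrakk>C, C'\<rbrakk>\<^sub>0" "H' \<in> Ob \<lbrakk>C, C'\<rbrakk>\<^sub>0"
    by blast
  note \<sigma>\<tau> = hom_mnt_typing[OF \<sigma>(1) \<tau>(1)]
  have "\<lbrakk>F, \<lbrakk>G, H\<rbrakk>\<^sub>1\<rbrakk>\<^sub>1 \<in> Ob \<lbrakk>\<lbrakk>A, \<lbrakk>B, C\<rbrakk>\<^sub>0\<rbrakk>\<^sub>0, \<lbrakk>A', \<lbrakk>B', C'\<rbrakk>\<^sub>0\<rbrakk>\<^sub>0\<rbrakk>\<^sub>0"
    by (intro hom_smf_typing \<rho> \<sigma> \<tau>)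
  then show "on2 hom_ABC s \<in> Cells2 SMC (on1 hom_ABC f) (on1 hom_ABC g)"
    using hom_mnt_typing[OF \<rho>(1) \<sigma>\<tau>] \<rho> \<sigma> \<tau> by (simp add: f g s hom_ABC_def cells_SMC hom_Ob_iff)
  fix h t assume "t \<in> Cells2 ?K g h"
  moreover obtain F'' G'' H'' \<rho>' \<sigma>' \<tau>' where "h = (F'', G'', H'')" and t: "t = (\<rho>', \<sigma>', \<tau>')" by (metis prod_cases3)
  ultimately have "\<rho>' \<in> Ar \<lbrakk>A', A\<rbrakk>\<^sub>0 \<and> ndom \<rho>' = F'" "\<sigma>' \<in> Ar \<lbrakk>B', B\<rbrakk>\<^sub>0 \<and> ndom \<sigma>' = G'" "\<tau>' \<in> Ar \<lbrakk>C, C'\<rbrakk>\<^sub>0 \<and> ndom \<tau>' = H'"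
    using \<rho> \<sigma> \<tau> by (auto simp: g dest: Cells2_SMC_typing)
  then have "\<rho>' \<in> Ar \<lbrakk>A', A\<rbrakk>\<^sub>0" "ndom \<rho>' = ncod \<rho>" "\<sigma>' \<in> Ar \<lbrakk>B', B\<rbrakk>\<^sub>0" "ndom \<sigma>' = ncod \<sigma>" "\<tau>' \<in> Ar \<lbrakk>C, C'\<rbrakk>\<^sub>0" "ndom \<tau>' = ncod \<tau>"
    using \<rho> \<sigma> \<tau> by simp_all
  note t' = this hom_mnt_typing[OF this(3,5)]
  show "on2 hom_ABC (vcomp ?K t s) = vcomp SMC (on2 hom_ABC t) (on2 hom_ABC s)"
    using hom_mnt_vcomp[OF \<sigma>(1) t'(3) \<tau>(1) t'(5) t'(4,6)] hom_mnt_vcomp[OF \<rho>(1) t'(1) \<sigma>\<tau> t'(7) t'(2)] t'(4,6)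
    by (simp add: s t hom_ABC_def)
qed

text \<open>The two iterated homs are one 2-functor up to exchanging the contravariant variables.\<close>

lemma two_functor_swap:
  assumes "two_functor (K \<times>\<^sub>2 K' \<times>\<^sub>2 L) M P" and "two_category (K' \<times>\<^sub>2 K \<times>\<^sub>2 L)"
  shows "two_functor (K' \<times>\<^sub>2 K \<times>\<^sub>2 L) M
    \<lparr>on0 = (\<lambda>(a, b, c). on0 P (b, a, c)), on1 = (\<lambda>(f, g, h). on1 P (g, f, h)), on2 = (\<lambda>(r, s, t). on2 P (s, r, t))\<rparr>"
proof -
  interpret P: two_functor "K \<times>\<^sub>2 K' \<times>\<^sub>2 L" M P by (rule assms(1))
  note on =
    P.on0_cells0[of "(a, a', a'')" for a a' a'', simplified]
    P.on1_Cells1[of "(f, f', f'')" "(a, a', a'')" "(b, b', b'')" for f f' f'' a a' a'' b b' b'', simplified]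
    P.on2_Cells2[of "(s, s', s'')" "(f, f', f'')" "(g, g', g'')" for s s' s'' f f' f'' g g' g'', simplified]
    P.on1_unit1[of "(a, a', a'')" for a a' a'', simplified]
    P.on1_comp1[of "(f, f', f'')" "(a, a', a'')" "(b, b', b'')" "(g, g', g'')" "(c, c', c'')" for f f' f'' a a' a'' b b' b'' g g' g'' c c' c'', simplified]
    P.on2_unit2[of "(f, f', f'')" for f f' f'', simplified]
    P.on2_vcomp[of "(s, s', s'')" "(f, f', f'')" "(g, g', g'')" "(t, t', t'')" "(h, h', h'')" for s s' s'' f f' f'' g g' g'' t t' t'' h h' h'', simplified]
    P.on2_hcomp[of "(f, f', f'')" "(a, a', a'')" "(b, b', b'')" "(s, s', s'')" "(u, u', u'')" "(g, g', g'')" "(c, c', c'')" "(t, t', t'')" "(v, v', v'')" for f f' f'' a a' a'' b b' b'' s s' s'' u u' u'' g g' g'' c c' c'' t t' t'' v v' v'', simplified]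
  show ?thesis
    by (rule two_functor.intro[OF assms(2) P.cod_two_category]) (auto simp: on intro: on)
qed

lemma two_functor_hom_BAC:
  "two_functor (op1 SMC \<times>\<^sub>2 op1 SMC \<times>\<^sub>2 SMC) SMC hom_BAC"
  using two_functor_swap[OF two_functor_hom_ABC two_category_SMC3] by (simp add: hom_ABC_def hom_BAC_def)

section \<open>Duality\<close>

context smc_hom
begin

lemma ncomp_inverse_of_Rgt [simp]:
  assumes "F \<in> Ob \<lbrakk>A, B\<rbrakk>\<^sub>0" "x \<in> Ob A"
  shows "inverse_of \<lbrakk>A, B\<rbrakk>\<^sub>0 (Rgt \<lbrakk>A, B\<rbrakk>\<^sub>0 F) \<in> Ar \<lbrakk>A, B\<rbrakk>\<^sub>0"
    "ndom (inverse_of \<lbrakk>A, B\<rbrakk>\<^sub>0 (Rgt \<lbrakk>A, B\<rbrakk>\<^sub>0 F)) = F"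
    "ncod (inverse_of \<lbrakk>A, B\<rbrakk>\<^sub>0 (Rgt \<lbrakk>A, B\<rbrakk>\<^sub>0 F)) = smf_tensor F (smf_const A B)"
    "ncomp (inverse_of \<lbrakk>A, B\<rbrakk>\<^sub>0 (Rgt \<lbrakk>A, B\<rbrakk>\<^sub>0 F)) x = inverse_of B (Rgt B (fob F x))"
  using assms hom_iso(1)[of "Rgt \<lbrakk>A, B\<rbrakk>\<^sub>0 F"] ncomp_inverse_of[of "Rgt \<lbrakk>A, B\<rbrakk>\<^sub>0 F"]
    H.inverse_of[of "Rgt \<lbrakk>A, B\<rbrakk>\<^sub>0 F"] by simp_all

lemma ncomp_middle4 [simp]:
  assumes [simp]: "F \<in> Ob \<lbrakk>A, B\<rbrakk>\<^sub>0" "G \<in> Ob \<lbrakk>A, B\<rbrakk>\<^sub>0" "H \<in> Ob \<lbrakk>A, B\<rbrakk>\<^sub>0" "K \<in> Ob \<lbrakk>A, B\<rbrakk>\<^sub>0" "x \<in> Ob A"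
  shows "middle4 \<lbrakk>A, B\<rbrakk>\<^sub>0 F G H K \<in> Ar \<lbrakk>A, B\<rbrakk>\<^sub>0"
    "ndom (middle4 \<lbrakk>A, B\<rbrakk>\<^sub>0 F G H K) = smf_tensor (smf_tensor F G) (smf_tensor H K)"
    "ncod (middle4 \<lbrakk>A, B\<rbrakk>\<^sub>0 F G H K) = smf_tensor (smf_tensor F H) (smf_tensor G K)"
    "ncomp (middle4 \<lbrakk>A, B\<rbrakk>\<^sub>0 F G H K) x = middle4 B (fob F x) (fob G x) (fob H x) (fob K x)"
proof -
  interpret M: sym_mon_category "\<lbrakk>A, B\<rbrakk>\<^sub>0" by (rule hom_sym_mon_category)
  show "middle4 \<lbrakk>A, B\<rbrakk>\<^sub>0 F G H K \<in> Ar \<lbrakk>A, B\<rbrakk>\<^sub>0"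
    "ndom (middle4 \<lbrakk>A, B\<rbrakk>\<^sub>0 F G H K) = smf_tensor (smf_tensor F G) (smf_tensor H K)"
    "ncod (middle4 \<lbrakk>A, B\<rbrakk>\<^sub>0 F G H K) = smf_tensor (smf_tensor F H) (smf_tensor G K)"
    using M.mid_typing[of F G H K] by simp_all
  have inv: "inverse_of \<lbrakk>A, B\<rbrakk>\<^sub>0 (Ass \<lbrakk>A, B\<rbrakk>\<^sub>0 X Y Z) \<in> Ar \<lbrakk>A, B\<rbrakk>\<^sub>0"
    "ndom (inverse_of \<lbrakk>A, B\<rbrakk>\<^sub>0 (Ass \<lbrakk>A, B\<rbrakk>\<^sub>0 X Y Z)) = smf_tensor (smf_tensor X Y) Z"
    "ncod (inverse_of \<lbrakk>A, B\<rbrakk>\<^sub>0 (Ass \<lbrakk>A, B\<rbrakk>\<^sub>0 X Y Z)) = smf_tensor X (smf_tensor Y Z)"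
    "ncomp (inverse_of \<lbrakk>A, B\<rbrakk>\<^sub>0 (Ass \<lbrakk>A, B\<rbrakk>\<^sub>0 X Y Z)) x = inverse_of B (Ass B (fob X x) (fob Y x) (fob Z x))"
    if [simp]: "X \<in> Ob \<lbrakk>A, B\<rbrakk>\<^sub>0" "Y \<in> Ob \<lbrakk>A, B\<rbrakk>\<^sub>0" "Z \<in> Ob \<lbrakk>A, B\<rbrakk>\<^sub>0" for X Y Z
    using H.inverse_of[of "Ass \<lbrakk>A, B\<rbrakk>\<^sub>0 X Y Z"] M.Ass_typing(4)[of X Y Z] ncomp_inverse_of[of "Ass \<lbrakk>A, B\<rbrakk>\<^sub>0 X Y Z" x]
    by simp_all
  show "ncomp (middle4 \<lbrakk>A, B\<rbrakk>\<^sub>0 F G H K) x = middle4 B (fob F x) (fob G x) (fob H x) (fob K x)"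
    unfolding middle4_def by (simp add: inv)
qed

end

locale smc_dual = A: sym_mon_category A + B: sym_mon_category B + C: sym_mon_category C
  for A :: "('oa, 'ma) smc" and B :: "('ob, 'mb) smc" and C :: "('oc, 'mc) smc"
begin

sublocale AC: smc_hom A C ..
sublocale BC: smc_hom B C ..
sublocale A_BC: smc_hom A "\<lbrakk>B, C\<rbrakk>\<^sub>0"
  by (simp add: smc_hom_def BC.hom_sym_mon_category A.sym_mon_category_axioms)
sublocale B_AC: smc_hom B "\<lbrakk>A, C\<rbrakk>\<^sub>0"
  by (simp add: smc_hom_def AC.hom_sym_mon_category B.sym_mon_category_axioms)
sublocale hom: smc_hom "\<lbrakk>A, \<lbrakk>B, C\<rbrakk>\<^sub>0\<rbrakk>\<^sub>0" "\<lbrakk>B, \<lbrakk>A, C\<rbrakk>\<^sub>0\<rbrakk>\<^sub>0"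
  by (simp add: smc_hom_def A_BC.hom_sym_mon_category B_AC.hom_sym_mon_category)

context
  fixes F :: "('oa, 'ma, ('ob, 'mb, 'oc, 'mc) smf, ('ob, 'mb, 'oc, 'mc) mnt) smf"
  assumes F [simp]: "F \<in> Ob \<lbrakk>A, \<lbrakk>B, C\<rbrakk>\<^sub>0\<rbrakk>\<^sub>0"
begin

text \<open>The functor axioms of \<open>F\<close> are equations between transformations; at each object of \<open>B\<close>
  they are the functor axioms of the dual.\<close>

lemmas curried_typing [simp] = A_BC.far_typing[OF F, simplified] A_BC.far_unit[OF F, simplified]
  A_BC.far_comp[OF F, simplified] A_BC.fun0_typing[OF F, simplified] A_BC.fun2_typing[OF F, simplified]

context
  fixes b
  assumes b [simp]: "b \<in> Ob B"
begin

lemma curried_fun2_natural: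
  "\<lbrakk>f \<in> Ar A; g \<in> Ar A\<rbrakk>
   \<Longrightarrow> ncomp (far F (f \<odot>\<^bsub>A\<^esub> g)) b \<cdot>\<^bsub>C\<^esub> ncomp (fun2 F (Dom A f) (Dom A g)) b
     = ncomp (fun2 F (Cod A f) (Cod A g)) b \<cdot>\<^bsub>C\<^esub> (ncomp (far F f) b \<odot>\<^bsub>C\<^esub> ncomp (far F g) b)"
  using arg_cong[OF A_BC.fun2_natural[OF F, of f g "Dom A f" "Dom A g"], of "\<lambda>\<sigma>. ncomp \<sigma> b"] by simp

lemma curried_fun2_assoc:
  "\<lbrakk>x \<in> Ob A; y \<in> Ob A; z \<in> Ob A\<rbrakk>
   \<Longrightarrow> ncomp (far F (Ass A x y z)) b \<cdot>\<^bsub>C\<^esub> ncomp (fun2 F x (y \<otimes>\<^bsub>A\<^esub> z)) b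
       \<cdot>\<^bsub>C\<^esub> (Idn C (fob (fob F x) b) \<odot>\<^bsub>C\<^esub> ncomp (fun2 F y z) b)
     = ncomp (fun2 F (x \<otimes>\<^bsub>A\<^esub> y) z) b \<cdot>\<^bsub>C\<^esub> (ncomp (fun2 F x y) b \<odot>\<^bsub>C\<^esub> Idn C (fob (fob F z) b))
       \<cdot>\<^bsub>C\<^esub> Ass C (fob (fob F x) b) (fob (fob F y) b) (fob (fob F z) b)"
  using arg_cong[OF A_BC.fun2_assoc[OF F, of x y z], of "\<lambda>\<sigma>. ncomp \<sigma> b"] by simp

lemma curried_fun0_Rgt:
  "x \<in> Ob A \<Longrightarrow> ncomp (far F (Rgt A x)) b \<cdot>\<^bsub>C\<^esub> ncomp (fun2 F x (Unt A)) b
     \<cdot>\<^bsub>C\<^esub> (Idn C (fob (fob F x) b) \<odot>\<^bsub>C\<^esub> ncomp (fun0 F) b) = Rgt C (fob (fob F x) b)"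
  and curried_fun0_Lft:
  "x \<in> Ob A \<Longrightarrow> ncomp (far F (Lft A x)) b \<cdot>\<^bsub>C\<^esub> ncomp (fun2 F (Unt A) x) b
     \<cdot>\<^bsub>C\<^esub> (ncomp (fun0 F) b \<odot>\<^bsub>C\<^esub> Idn C (fob (fob F x) b)) = Lft C (fob (fob F x) b)"
  and curried_fun2_Sym:
  "\<lbrakk>x \<in> Ob A; y \<in> Ob A\<rbrakk>
   \<Longrightarrow> ncomp (far F (Sym A x y)) b \<cdot>\<^bsub>C\<^esub> ncomp (fun2 F x y) b
     = ncomp (fun2 F y x) b \<cdot>\<^bsub>C\<^esub> Sym C (fob (fob F x) b) (fob (fob F y) b)"
  using arg_cong[OF A_BC.fun0_Rgt[OF F, of x], of "\<lambda>\<sigma>. ncomp \<sigma> b"]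
    arg_cong[OF A_BC.fun0_Lft[OF F, of x], of "\<lambda>\<sigma>. ncomp \<sigma> b"]
    arg_cong[OF A_BC.fun2_Sym[OF F, of x y], of "\<lambda>\<sigma>. ncomp \<sigma> b"] by simp_all

lemma dual_ob_simps [simp]:
  "fdom (dual_ob A C F b) = A" "fcod (dual_ob A C F b) = C"
  "a \<in> Ob A \<Longrightarrow> fob (dual_ob A C F b) a = fob (fob F a) b"
  "f \<in> Ar A \<Longrightarrow> far (dual_ob A C F b) f = ncomp (far F f) b"
  "fun0 (dual_ob A C F b) = ncomp (fun0 F) b"
  "\<lbrakk>a \<in> Ob A; a' \<in> Ob A\<rbrakk> \<Longrightarrow> fun2 (dual_ob A C F b) a a' = ncomp (fun2 F a a') b"
  by (simp_all add: dual_ob_def)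

lemma dual_ob_in [simp]: "dual_ob A C F b \<in> Ob \<lbrakk>A, C\<rbrakk>\<^sub>0"
  by (rule AC.smfI)
    (simp_all add: curried_fun2_natural curried_fun2_assoc curried_fun0_Rgt curried_fun0_Lft curried_fun2_Sym,
     simp_all add: dual_ob_def)

end

lemma dual_smf_simps [simp]:
  "fdom (dual_smf A B C F) = B" "fcod (dual_smf A B C F) = \<lbrakk>A, C\<rbrakk>\<^sub>0"
  "b \<in> Ob B \<Longrightarrow> fob (dual_smf A B C F) b = dual_ob A C F b"
  "g \<in> Ar B \<Longrightarrow> ndom (far (dual_smf A B C F) g) = dual_ob A C F (Dom B g)"
  "g \<in> Ar B \<Longrightarrow> ncod (far (dual_smf A B C F) g) = dual_ob A C F (Cod B g)"
  "\<lbrakk>g \<in> Ar B; a \<in> Ob A\<rbrakk> \<Longrightarrow> ncomp (far (dual_smf A B C F) g) a = far (fob F a) g"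
  "ndom (fun0 (dual_smf A B C F)) = smf_const A C"
  "ncod (fun0 (dual_smf A B C F)) = dual_ob A C F (Unt B)"
  "a \<in> Ob A \<Longrightarrow> ncomp (fun0 (dual_smf A B C F)) a = fun0 (fob F a)"
  "\<lbrakk>b \<in> Ob B; b' \<in> Ob B\<rbrakk> \<Longrightarrow> ndom (fun2 (dual_smf A B C F) b b') = smf_tensor (dual_ob A C F b) (dual_ob A C F b')"
  "\<lbrakk>b \<in> Ob B; b' \<in> Ob B\<rbrakk> \<Longrightarrow> ncod (fun2 (dual_smf A B C F) b b') = dual_ob A C F (b \<otimes>\<^bsub>B\<^esub> b')"
  "\<lbrakk>b \<in> Ob B; b' \<in> Ob B; a \<in> Ob A\<rbrakk> \<Longrightarrow> ncomp (fun2 (dual_smf A B C F) b b') a = fun2 (fob F a) b b'"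
  by (simp_all add: dual_smf_def)

lemma dual_smf_extensional:
  "fob (dual_smf A B C F) \<in> extensional (Ob B)" "far (dual_smf A B C F) \<in> extensional (Ar B)"
  "fun2 (dual_smf A B C F) \<in> extensional (Ob B)" "b \<in> Ob B \<Longrightarrow> fun2 (dual_smf A B C F) b \<in> extensional (Ob B)"
  "g \<in> Ar B \<Longrightarrow> ncomp (far (dual_smf A B C F) g) \<in> extensional (Ob A)"
  "ncomp (fun0 (dual_smf A B C F)) \<in> extensional (Ob A)"
  "\<lbrakk>b \<in> Ob B; b' \<in> Ob B\<rbrakk> \<Longrightarrow> ncomp (fun2 (dual_smf A B C F) b b') \<in> extensional (Ob A)"
  by (simp_all add: dual_smf_def)

text \<open>The naturality and monoidality axioms of \<open>F f\<close>, \<open>F\<^sup>0\<close> and \<open>F\<^sup>2\<close> are those of \<open>F\<^sup>* g\<close>,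
  \<open>(F\<^sup>*)\<^sup>0\<close> and \<open>(F\<^sup>*)\<^sup>2\<close>, with the roles of the two variables exchanged: for instance, naturality of
  \<open>F\<^sup>0\<close> and \<open>F\<^sup>2\<close> at \<open>g\<close> is monoidality of \<open>F\<^sup>* g\<close>.\<close>

lemma dual_far_in [simp]:
  assumes [simp]: "g \<in> Ar B"
  shows "far (dual_smf A B C F) g \<in> Ar \<lbrakk>A, C\<rbrakk>\<^sub>0" (is "?\<sigma> \<in> _")
proof (rule AC.mntI)
  show "ncomp ?\<sigma> (Unt A) \<cdot>\<^bsub>C\<^esub> fun0 (ndom ?\<sigma>) = fun0 (ncod ?\<sigma>)"
    using BC.ncomp_natural[of "fun0 F" g] by simp
next
  fix x y assume [simp]: "x \<in> Ob A" "y \<in> Ob A"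
  show "ncomp ?\<sigma> (x \<otimes>\<^bsub>A\<^esub> y) \<cdot>\<^bsub>C\<^esub> fun2 (ndom ?\<sigma>) x y
      = fun2 (ncod ?\<sigma>) x y
        \<cdot>\<^bsub>C\<^esub> (ncomp ?\<sigma> x \<odot>\<^bsub>C\<^esub> ncomp ?\<sigma> y)"
    using BC.ncomp_natural[of "fun2 F x y" g] by simp
next
  fix f assume [simp]: "f \<in> Ar A"
  show "ncomp ?\<sigma> (Cod A f) \<cdot>\<^bsub>C\<^esub> far (ndom ?\<sigma>) f
      = far (ncod ?\<sigma>) f \<cdot>\<^bsub>C\<^esub> ncomp ?\<sigma> (Dom A f)"
    using BC.ncomp_natural[of "far F f" g] by simp
qed (simp_all add: dual_smf_extensional)

lemma dual_fun0_in [simp]: "fun0 (dual_smf A B C F) \<in> Ar \<lbrakk>A, C\<rbrakk>\<^sub>0" (is "?\<sigma> \<in> _")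
proof (rule AC.mntI)
  fix f assume [simp]: "f \<in> Ar A"
  show "ncomp ?\<sigma> (Cod A f) \<cdot>\<^bsub>C\<^esub> far (ndom ?\<sigma>) f
      = far (ncod ?\<sigma>) f \<cdot>\<^bsub>C\<^esub> ncomp ?\<sigma> (Dom A f)"
    using BC.ncomp_fun0[of "far F f"] by simp
next
  show "ncomp ?\<sigma> (Unt A) \<cdot>\<^bsub>C\<^esub> fun0 (ndom ?\<sigma>) = fun0 (ncod ?\<sigma>)"
    using BC.ncomp_fun0[of "fun0 F"] by simp
next
  fix x y assume [simp]: "x \<in> Ob A" "y \<in> Ob A"
  show "ncomp ?\<sigma> (x \<otimes>\<^bsub>A\<^esub> y) \<cdot>\<^bsub>C\<^esub> fun2 (ndom ?\<sigma>) x y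
      = fun2 (ncod ?\<sigma>) x y
        \<cdot>\<^bsub>C\<^esub> (ncomp ?\<sigma> x \<odot>\<^bsub>C\<^esub> ncomp ?\<sigma> y)"
    using BC.ncomp_fun0[of "fun2 F x y", symmetric] by simp
qed (simp_all add: dual_smf_extensional)

lemma dual_fun2_in [simp]:
  assumes [simp]: "b \<in> Ob B" "b' \<in> Ob B"
  shows "fun2 (dual_smf A B C F) b b' \<in> Ar \<lbrakk>A, C\<rbrakk>\<^sub>0" (is "?\<sigma> \<in> _")
proof (rule AC.mntI)
  show "ncomp ?\<sigma> (Unt A) \<cdot>\<^bsub>C\<^esub> fun0 (ndom ?\<sigma>)
      = fun0 (ncod ?\<sigma>)"
    using BC.ncomp_fun2[of "fun0 F" b b', symmetric, THEN C.reassoc] by simp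
next
  fix x y assume [simp]: "x \<in> Ob A" "y \<in> Ob A"
  \<comment> \<open>The interchanges of the two pointwise tensor products are inverse to each other.\<close>
  let ?m = "middle4 C (fob (fob F x) b) (fob (fob F x) b') (fob (fob F y) b) (fob (fob F y) b')"
  have "(ncomp (fun2 F x y) (b \<otimes>\<^bsub>B\<^esub> b') \<cdot>\<^bsub>C\<^esub> fun2 (smf_tensor (fob F x) (fob F y)) b b') \<cdot>\<^bsub>C\<^esub> ?m
      = (fun2 (fob F (x \<otimes>\<^bsub>A\<^esub> y)) b b' \<cdot>\<^bsub>C\<^esub> (ncomp (fun2 F x y) b \<odot>\<^bsub>C\<^esub> ncomp (fun2 F x y) b')) \<cdot>\<^bsub>C\<^esub> ?m"
    using BC.ncomp_fun2[of "fun2 F x y" b b'] by simp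
  then show "ncomp ?\<sigma> (x \<otimes>\<^bsub>A\<^esub> y) \<cdot>\<^bsub>C\<^esub> fun2 (ndom ?\<sigma>) x y
      = fun2 (ncod ?\<sigma>) x y
        \<cdot>\<^bsub>C\<^esub> (ncomp ?\<sigma> x \<odot>\<^bsub>C\<^esub> ncomp ?\<sigma> y)"
    by (simp add: C.mid_mid)
next
  fix f assume [simp]: "f \<in> Ar A"
  show "ncomp ?\<sigma> (Cod A f) \<cdot>\<^bsub>C\<^esub> far (ndom ?\<sigma>) f
      = far (ncod ?\<sigma>) f \<cdot>\<^bsub>C\<^esub> ncomp ?\<sigma> (Dom A f)"
    using BC.ncomp_fun2[of "far F f" b b'] by simp
qed (simp_all add: dual_smf_extensional)

lemma dual_smf_in [simp]: "dual_smf A B C F \<in> Ob \<lbrakk>B, \<lbrakk>A, C\<rbrakk>\<^sub>0\<rbrakk>\<^sub>0"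
  by (rule B_AC.smfI; (simp add: dual_smf_extensional)?; rule AC.mnt_eqI)
    (simp_all add: BC.fun2_natural BC.fun2_assoc BC.fun0_Rgt BC.fun0_Lft BC.fun2_Sym)

end

end

context smc_dual
begin

lemma curried_mnt_typing [simp]:
  assumes "\<theta> \<in> Ar \<lbrakk>A, \<lbrakk>B, C\<rbrakk>\<^sub>0\<rbrakk>\<^sub>0" "a \<in> Ob A"
  shows "ncomp \<theta> a \<in> Ar \<lbrakk>B, C\<rbrakk>\<^sub>0" "ndom (ncomp \<theta> a) = fob (ndom \<theta>) a" "ncod (ncomp \<theta> a) = fob (ncod \<theta>) a"
  using A_BC.ncomp_typing[OF assms] by simp_all

lemma curried_smf_eqI:
  assumes F: "F \<in> Ob \<lbrakk>A, \<lbrakk>B, C\<rbrakk>\<^sub>0\<rbrakk>\<^sub>0" and G: "G \<in> Ob \<lbrakk>A, \<lbrakk>B, C\<rbrakk>\<^sub>0\<rbrakk>\<^sub>0"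
    and ob: "\<And>a b. \<lbrakk>a \<in> Ob A; b \<in> Ob B\<rbrakk> \<Longrightarrow> fob (fob F a) b = fob (fob G a) b"
    and far: "\<And>a g. \<lbrakk>a \<in> Ob A; g \<in> Ar B\<rbrakk> \<Longrightarrow> far (fob F a) g = far (fob G a) g"
    and fun0: "\<And>a. a \<in> Ob A \<Longrightarrow> fun0 (fob F a) = fun0 (fob G a)"
    and fun2: "\<And>a b b'. \<lbrakk>a \<in> Ob A; b \<in> Ob B; b' \<in> Ob B\<rbrakk> \<Longrightarrow> fun2 (fob F a) b b' = fun2 (fob G a) b b'"
    and mor: "\<And>f b. \<lbrakk>f \<in> Ar A; b \<in> Ob B\<rbrakk> \<Longrightarrow> ncomp (far F f) b = ncomp (far G f) b"
    and cfun0: "\<And>b. b \<in> Ob B \<Longrightarrow> ncomp (fun0 F) b = ncomp (fun0 G) b"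
    and cfun2: "\<And>a a' b. \<lbrakk>a \<in> Ob A; a' \<in> Ob A; b \<in> Ob B\<rbrakk> \<Longrightarrow> ncomp (fun2 F a a') b = ncomp (fun2 G a a') b"
  shows "F = G"
proof -
  note [simp] = F G
  have fob [simp]: "fob F a = fob G a" if "a \<in> Ob A" for a
    by (rule BC.smf_eqI) (use that in \<open>simp_all add: ob far fun0 fun2\<close>)
  show ?thesis
    by (rule A_BC.smf_eqI[OF F G]; (rule BC.mnt_eqI)?) (simp_all add: mor cfun0 cfun2)
qed

lemma curried_mnt_eqI:
  assumes [simp]: "\<theta> \<in> Ar \<lbrakk>A, \<lbrakk>B, C\<rbrakk>\<^sub>0\<rbrakk>\<^sub>0" "\<eta> \<in> Ar \<lbrakk>A, \<lbrakk>B, C\<rbrakk>\<^sub>0\<rbrakk>\<^sub>0"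
    and "ndom \<theta> = ndom \<eta>" "ncod \<theta> = ncod \<eta>"
    and "\<And>a b. \<lbrakk>a \<in> Ob A; b \<in> Ob B\<rbrakk> \<Longrightarrow> ncomp (ncomp \<theta> a) b = ncomp (ncomp \<eta> a) b"
  shows "\<theta> = \<eta>"
  by (rule A_BC.mnt_eqI; (rule BC.mnt_eqI)?) (simp_all add: assms(3-))

lemma swap: "smc_dual B A C"
  by unfold_locales

end

context smc_dual
begin

lemmas dual_smf_eqI = smc_dual.curried_smf_eqI[OF swap]
lemmas dual_mnt_eqI = smc_dual.curried_mnt_eqI[OF swap]
lemmas [simp] = smc_dual.curried_mnt_typing[OF swap] smc_dual.curried_typing[OF swap]

context
  fixes \<theta> :: "('oa, 'ma, ('ob, 'mb, 'oc, 'mc) smf, ('ob, 'mb, 'oc, 'mc) mnt) mnt"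
  assumes \<theta> [simp]: "\<theta> \<in> Ar \<lbrakk>A, \<lbrakk>B, C\<rbrakk>\<^sub>0\<rbrakk>\<^sub>0"
begin

lemma dual_mnt_simps [simp]:
  "ndom (dual_mnt A B C \<theta>) = dual_smf A B C (ndom \<theta>)" "ncod (dual_mnt A B C \<theta>) = dual_smf A B C (ncod \<theta>)"
  "b \<in> Ob B \<Longrightarrow> ndom (ncomp (dual_mnt A B C \<theta>) b) = dual_ob A C (ndom \<theta>) b"
  "b \<in> Ob B \<Longrightarrow> ncod (ncomp (dual_mnt A B C \<theta>) b) = dual_ob A C (ncod \<theta>) b"
  "\<lbrakk>b \<in> Ob B; a \<in> Ob A\<rbrakk> \<Longrightarrow> ncomp (ncomp (dual_mnt A B C \<theta>) b) a = ncomp (ncomp \<theta> a) b"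
  by (simp_all add: dual_mnt_def)

lemma dual_mnt_component_in [simp]:
  assumes [simp]: "b \<in> Ob B"
  shows "ncomp (dual_mnt A B C \<theta>) b \<in> Ar \<lbrakk>A, C\<rbrakk>\<^sub>0" (is "?\<sigma> \<in> _")
proof (rule AC.mntI)
  show "ncomp ?\<sigma> \<in> extensional (Ob A)" by (simp add: dual_mnt_def)
next
  fix f assume [simp]: "f \<in> Ar A"
  show "ncomp ?\<sigma> (Cod A f) \<cdot>\<^bsub>C\<^esub> far (ndom ?\<sigma>) f
      = far (ncod ?\<sigma>) f \<cdot>\<^bsub>C\<^esub> ncomp ?\<sigma> (Dom A f)"
    using arg_cong[OF A_BC.ncomp_natural[OF \<theta>, of f "Cod A f"], of "\<lambda>\<sigma>. ncomp \<sigma> b"] by simp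
next
  show "ncomp ?\<sigma> (Unt A) \<cdot>\<^bsub>C\<^esub> fun0 (ndom ?\<sigma>)
      = fun0 (ncod ?\<sigma>)"
    using arg_cong[OF A_BC.ncomp_fun0[OF \<theta>], of "\<lambda>\<sigma>. ncomp \<sigma> b"] by simp
next
  fix x y assume [simp]: "x \<in> Ob A" "y \<in> Ob A"
  show "ncomp ?\<sigma> (x \<otimes>\<^bsub>A\<^esub> y) \<cdot>\<^bsub>C\<^esub> fun2 (ndom ?\<sigma>) x y
      = fun2 (ncod ?\<sigma>) x y
        \<cdot>\<^bsub>C\<^esub> (ncomp ?\<sigma> x \<odot>\<^bsub>C\<^esub> ncomp ?\<sigma> y)"
    using arg_cong[OF A_BC.ncomp_fun2[OF \<theta>, of x y], of "\<lambda>\<sigma>. ncomp \<sigma> b"] by simp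
qed simp_all

lemma curried_mnt_monoidal:
  assumes [simp]: "a \<in> Ob A"
  shows "g \<in> Ar B \<Longrightarrow> ncomp (ncomp \<theta> a) (Cod B g) \<cdot>\<^bsub>C\<^esub> far (fob (ndom \<theta>) a) g
      = far (fob (ncod \<theta>) a) g \<cdot>\<^bsub>C\<^esub> ncomp (ncomp \<theta> a) (Dom B g)"
    and "ncomp (ncomp \<theta> a) (Unt B) \<cdot>\<^bsub>C\<^esub> fun0 (fob (ndom \<theta>) a) = fun0 (fob (ncod \<theta>) a)"
    and "\<lbrakk>x \<in> Ob B; y \<in> Ob B\<rbrakk> \<Longrightarrow> ncomp (ncomp \<theta> a) (x \<otimes>\<^bsub>B\<^esub> y) \<cdot>\<^bsub>C\<^esub> fun2 (fob (ndom \<theta>) a) x y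
      = fun2 (fob (ncod \<theta>) a) x y \<cdot>\<^bsub>C\<^esub> (ncomp (ncomp \<theta> a) x \<odot>\<^bsub>C\<^esub> ncomp (ncomp \<theta> a) y)"
  using BC.ncomp_natural[of "ncomp \<theta> a" g] BC.ncomp_fun0[of "ncomp \<theta> a"] BC.ncomp_fun2[of "ncomp \<theta> a" x y]
  by simp_all

lemma dual_mnt_in [simp]: "dual_mnt A B C \<theta> \<in> Ar \<lbrakk>B, \<lbrakk>A, C\<rbrakk>\<^sub>0\<rbrakk>\<^sub>0" (is "?\<sigma> \<in> _")
proof (rule B_AC.mntI)
  show "ncomp ?\<sigma> \<in> extensional (Ob B)" by (simp add: dual_mnt_def)
next
  fix g assume [simp]: "g \<in> Ar B"
  show "ncomp ?\<sigma> (Cod B g) \<cdot>\<^bsub>\<lbrakk>A, C\<rbrakk>\<^sub>0\<^esub> far (ndom ?\<sigma>) g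
      = far (ncod ?\<sigma>) g \<cdot>\<^bsub>\<lbrakk>A, C\<rbrakk>\<^sub>0\<^esub> ncomp ?\<sigma> (Dom B g)"
    by (simp; rule AC.mnt_eqI) (simp_all add: curried_mnt_monoidal)
next
  show "ncomp ?\<sigma> (Unt B) \<cdot>\<^bsub>\<lbrakk>A, C\<rbrakk>\<^sub>0\<^esub> fun0 (ndom ?\<sigma>) = fun0 (ncod ?\<sigma>)"
    by (simp; rule AC.mnt_eqI) (simp_all add: curried_mnt_monoidal)
next
  fix x y assume [simp]: "x \<in> Ob B" "y \<in> Ob B"
  show "ncomp ?\<sigma> (x \<otimes>\<^bsub>B\<^esub> y) \<cdot>\<^bsub>\<lbrakk>A, C\<rbrakk>\<^sub>0\<^esub> fun2 (ndom ?\<sigma>) x y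
      = fun2 (ncod ?\<sigma>) x y \<cdot>\<^bsub>\<lbrakk>A, C\<rbrakk>\<^sub>0\<^esub> (ncomp ?\<sigma> x \<odot>\<^bsub>\<lbrakk>A, C\<rbrakk>\<^sub>0\<^esub> ncomp ?\<sigma> y)"
    by (simp; rule AC.mnt_eqI) (simp_all add: curried_mnt_monoidal)
qed simp_all

end

text \<open>Both the unit and the tensor product of \<open>\<lbrakk>A, \<lbrakk>B, C\<rbrakk>\<^sub>0\<rbrakk>\<^sub>0\<close> are computed pointwise in both
  variables, so dualising preserves them strictly.\<close>

lemma dual_const [simp]: "dual_smf A B C (smf_const A \<lbrakk>B, C\<rbrakk>\<^sub>0) = smf_const B \<lbrakk>A, C\<rbrakk>\<^sub>0"
  by (rule dual_smf_eqI) simp_all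

lemma dual_tensor [simp]:
  assumes [simp]: "F \<in> Ob \<lbrakk>A, \<lbrakk>B, C\<rbrakk>\<^sub>0\<rbrakk>\<^sub>0" "G \<in> Ob \<lbrakk>A, \<lbrakk>B, C\<rbrakk>\<^sub>0\<rbrakk>\<^sub>0"
  shows "dual_smf A B C (smf_tensor F G) = smf_tensor (dual_smf A B C F) (dual_smf A B C G)"
  by (rule dual_smf_eqI) simp_all

lemma D_simps [simp]:
  "fdom (D A B C) = \<lbrakk>A, \<lbrakk>B, C\<rbrakk>\<^sub>0\<rbrakk>\<^sub>0" "fcod (D A B C) = \<lbrakk>B, \<lbrakk>A, C\<rbrakk>\<^sub>0\<rbrakk>\<^sub>0"
  "F \<in> Ob \<lbrakk>A, \<lbrakk>B, C\<rbrakk>\<^sub>0\<rbrakk>\<^sub>0 \<Longrightarrow> fob (D A B C) F = dual_smf A B C F"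
  "\<theta> \<in> Ar \<lbrakk>A, \<lbrakk>B, C\<rbrakk>\<^sub>0\<rbrakk>\<^sub>0 \<Longrightarrow> far (D A B C) \<theta> = dual_mnt A B C \<theta>"
  "fun0 (D A B C) = mnt_id (smf_const B \<lbrakk>A, C\<rbrakk>\<^sub>0)"
  "\<lbrakk>F \<in> Ob \<lbrakk>A, \<lbrakk>B, C\<rbrakk>\<^sub>0\<rbrakk>\<^sub>0; G \<in> Ob \<lbrakk>A, \<lbrakk>B, C\<rbrakk>\<^sub>0\<rbrakk>\<^sub>0\<rbrakk>
   \<Longrightarrow> fun2 (D A B C) F G = mnt_id (smf_tensor (dual_smf A B C F) (dual_smf A B C G))"
  by (simp_all add: D_def)

text \<open>The unit and multiplication of \<open>D\<close> are identities, so its axioms say that dualising preserves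
  composition, tensor products and the structural arrows; all of these are pointwise.\<close>

lemma D_in [simp]: "D A B C \<in> Ob \<lbrakk>\<lbrakk>A, \<lbrakk>B, C\<rbrakk>\<^sub>0\<rbrakk>\<^sub>0, \<lbrakk>B, \<lbrakk>A, C\<rbrakk>\<^sub>0\<rbrakk>\<^sub>0\<rbrakk>\<^sub>0"
proof -
  have ext: "fob (D A B C) \<in> extensional (Ob \<lbrakk>A, \<lbrakk>B, C\<rbrakk>\<^sub>0\<rbrakk>\<^sub>0)" "far (D A B C) \<in> extensional (Ar \<lbrakk>A, \<lbrakk>B, C\<rbrakk>\<^sub>0\<rbrakk>\<^sub>0)"
    "fun2 (D A B C) \<in> extensional (Ob \<lbrakk>A, \<lbrakk>B, C\<rbrakk>\<^sub>0\<rbrakk>\<^sub>0)"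
    "F \<in> Ob \<lbrakk>A, \<lbrakk>B, C\<rbrakk>\<^sub>0\<rbrakk>\<^sub>0 \<Longrightarrow> fun2 (D A B C) F \<in> extensional (Ob \<lbrakk>A, \<lbrakk>B, C\<rbrakk>\<^sub>0\<rbrakk>\<^sub>0)" for F
    by (simp_all add: D_def)
  show ?thesis
    by (rule hom.smfI; (simp add: ext)?; rule dual_mnt_eqI) simp_all
qed

lemma dual_dual:
  assumes [simp]: "F \<in> Ob \<lbrakk>A, \<lbrakk>B, C\<rbrakk>\<^sub>0\<rbrakk>\<^sub>0"
  shows "dual_smf B A C (dual_smf A B C F) = F"
proof -
  interpret BAC: smc_dual B A C by (rule swap)
  show ?thesis by (rule curried_smf_eqI) simp_all
qed

lemma D_D: "D B A C \<circ>\<^sub>F D A B C = smf_id \<lbrakk>A, \<lbrakk>B, C\<rbrakk>\<^sub>0\<rbrakk>\<^sub>0"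
proof -
  interpret BAC: smc_dual B A C by (rule swap)
  interpret DD: smc_comp "\<lbrakk>A, \<lbrakk>B, C\<rbrakk>\<^sub>0\<rbrakk>\<^sub>0" "\<lbrakk>B, \<lbrakk>A, C\<rbrakk>\<^sub>0\<rbrakk>\<^sub>0" "\<lbrakk>A, \<lbrakk>B, C\<rbrakk>\<^sub>0\<rbrakk>\<^sub>0"
    by unfold_locales
  note [simp] = A_BC.hom_sym_mon_category dual_dual
  show ?thesis
  proof (rule DD.AC.smf_eqI)
    fix \<theta> assume [simp]: "\<theta> \<in> Ar \<lbrakk>A, \<lbrakk>B, C\<rbrakk>\<^sub>0\<rbrakk>\<^sub>0"
    show "far (D B A C \<circ>\<^sub>F D A B C) \<theta> = far (smf_id \<lbrakk>A, \<lbrakk>B, C\<rbrakk>\<^sub>0\<rbrakk>\<^sub>0) \<theta>"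
      by (simp, rule curried_mnt_eqI) simp_all
  next
    show "fun0 (D B A C \<circ>\<^sub>F D A B C) = fun0 (smf_id \<lbrakk>A, \<lbrakk>B, C\<rbrakk>\<^sub>0\<rbrakk>\<^sub>0)"
      by (simp, rule curried_mnt_eqI) simp_all
  next
    fix F G assume [simp]: "F \<in> Ob \<lbrakk>A, \<lbrakk>B, C\<rbrakk>\<^sub>0\<rbrakk>\<^sub>0" "G \<in> Ob \<lbrakk>A, \<lbrakk>B, C\<rbrakk>\<^sub>0\<rbrakk>\<^sub>0"
    show "fun2 (D B A C \<circ>\<^sub>F D A B C) F G = fun2 (smf_id \<lbrakk>A, \<lbrakk>B, C\<rbrakk>\<^sub>0\<rbrakk>\<^sub>0) F G"
      by (simp, rule curried_mnt_eqI) simp_all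
  qed simp_all
qed

end

lemma inverse_smf_D:
  assumes "sym_mon_category A" "sym_mon_category B" "sym_mon_category C"
  shows "inverse_smf (D A B C) (D B A C)"
proof -
  interpret ABC: smc_dual A B C using assms by (simp add: smc_dual_def)
  interpret BAC: smc_dual B A C by (rule ABC.swap)
  show ?thesis
    using ABC.D_in BAC.D_in ABC.D_D BAC.D_D unfolding inverse_smf_def hom_Ob_iff by simp
qed

section \<open>Naturality of duality\<close>

locale smc_dual_map = ABC: smc_dual A B C + ABC': smc_dual A' B' C'
  for A :: "('oa, 'ma) smc" and B :: "('ob, 'mb) smc" and C :: "('oc, 'mc) smc"
    and A' :: "('oa', 'ma') smc" and B' :: "('ob', 'mb') smc" and C' :: "('oc', 'mc') smc"
begin

sublocale BB'_CC': smc_hom_map B' B C C' ..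
sublocale AA'_CC': smc_hom_map A' A C C' ..
sublocale ABC_map: smc_hom_map A' A "\<lbrakk>B, C\<rbrakk>\<^sub>0" "\<lbrakk>B', C'\<rbrakk>\<^sub>0" ..
sublocale BAC_map: smc_hom_map B' B "\<lbrakk>A, C\<rbrakk>\<^sub>0" "\<lbrakk>A', C'\<rbrakk>\<^sub>0" ..
sublocale D_first: smc_comp "\<lbrakk>A, \<lbrakk>B, C\<rbrakk>\<^sub>0\<rbrakk>\<^sub>0" "\<lbrakk>B, \<lbrakk>A, C\<rbrakk>\<^sub>0\<rbrakk>\<^sub>0" "\<lbrakk>B', \<lbrakk>A', C'\<rbrakk>\<^sub>0\<rbrakk>\<^sub>0" ..
sublocale D_last: smc_comp "\<lbrakk>A, \<lbrakk>B, C\<rbrakk>\<^sub>0\<rbrakk>\<^sub>0" "\<lbrakk>A', \<lbrakk>B', C'\<rbrakk>\<^sub>0\<rbrakk>\<^sub>0" "\<lbrakk>B', \<lbrakk>A', C'\<rbrakk>\<^sub>0\<rbrakk>\<^sub>0" ..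

lemmas [simp] = BB'_CC'.hom_smf_fun0_in BB'_CC'.hom_smf_fun2_in AA'_CC'.hom_smf_fun0_in AA'_CC'.hom_smf_fun2_in
  ABC_map.hom_smf_fun0_in ABC_map.hom_smf_fun2_in BAC_map.hom_smf_fun0_in BAC_map.hom_smf_fun2_in

context
  fixes F :: "('oa', 'ma', 'oa, 'ma) smf" and G :: "('ob', 'mb', 'ob, 'mb) smf" and H :: "('oc, 'mc, 'oc', 'mc') smf"
  assumes [simp]: "F \<in> Ob \<lbrakk>A', A\<rbrakk>\<^sub>0" "G \<in> Ob \<lbrakk>B', B\<rbrakk>\<^sub>0" "H \<in> Ob \<lbrakk>C, C'\<rbrakk>\<^sub>0"
begin

text \<open>Precomposition with \<open>F\<close> and \<open>G\<close> and postcomposition with \<open>H\<close> act on different arguments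
  of \<open>K\<close>, so both sides have the same data.\<close>

lemma dual_smf_natural:
  assumes [simp]: "K \<in> Ob \<lbrakk>A, \<lbrakk>B, C\<rbrakk>\<^sub>0\<rbrakk>\<^sub>0"
  shows "dual_smf A' B' C' (\<lbrakk>G, H\<rbrakk>\<^sub>1 \<circ>\<^sub>F K \<circ>\<^sub>F F) = \<lbrakk>F, H\<rbrakk>\<^sub>1 \<circ>\<^sub>F dual_smf A B C K \<circ>\<^sub>F G"
  by (rule ABC'.dual_smf_eqI) simp_all

lemma D_natural: "D A' B' C' \<circ>\<^sub>F \<lbrakk>F, \<lbrakk>G, H\<rbrakk>\<^sub>1\<rbrakk>\<^sub>1 = \<lbrakk>G, \<lbrakk>F, H\<rbrakk>\<^sub>1\<rbrakk>\<^sub>1 \<circ>\<^sub>F D A B C"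
proof (rule D_first.AC.smf_eqI)
  fix \<theta> assume [simp]: "\<theta> \<in> Ar \<lbrakk>A, \<lbrakk>B, C\<rbrakk>\<^sub>0\<rbrakk>\<^sub>0"
  show "far (D A' B' C' \<circ>\<^sub>F \<lbrakk>F, \<lbrakk>G, H\<rbrakk>\<^sub>1\<rbrakk>\<^sub>1) \<theta> = far (\<lbrakk>G, \<lbrakk>F, H\<rbrakk>\<^sub>1\<rbrakk>\<^sub>1 \<circ>\<^sub>F D A B C) \<theta>"
    by (simp, rule ABC'.dual_mnt_eqI) (simp_all add: dual_smf_natural)
next
  show "fun0 (D A' B' C' \<circ>\<^sub>F \<lbrakk>F, \<lbrakk>G, H\<rbrakk>\<^sub>1\<rbrakk>\<^sub>1) = fun0 (\<lbrakk>G, \<lbrakk>F, H\<rbrakk>\<^sub>1\<rbrakk>\<^sub>1 \<circ>\<^sub>F D A B C)"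
    by (simp, rule ABC'.dual_mnt_eqI) (simp_all add: dual_smf_natural)
next
  fix K L assume [simp]: "K \<in> Ob \<lbrakk>A, \<lbrakk>B, C\<rbrakk>\<^sub>0\<rbrakk>\<^sub>0" "L \<in> Ob \<lbrakk>A, \<lbrakk>B, C\<rbrakk>\<^sub>0\<rbrakk>\<^sub>0"
  show "fun2 (D A' B' C' \<circ>\<^sub>F \<lbrakk>F, \<lbrakk>G, H\<rbrakk>\<^sub>1\<rbrakk>\<^sub>1) K L = fun2 (\<lbrakk>G, \<lbrakk>F, H\<rbrakk>\<^sub>1\<rbrakk>\<^sub>1 \<circ>\<^sub>F D A B C) K L"
    by (simp, rule ABC'.dual_mnt_eqI) (simp_all add: dual_smf_natural)
qed (simp_all add: dual_smf_natural)

end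

text \<open>Naturality at 2-cells is naturality of the transformation \<open>K \<rho>\<^sub>a\<close> at the component \<open>\<sigma>\<^sub>b\<close>.\<close>

lemma D_natural2:
  fixes \<rho> :: "('oa', 'ma', 'oa, 'ma) mnt" and \<sigma> :: "('ob', 'mb', 'ob, 'mb) mnt" and \<tau> :: "('oc, 'mc, 'oc', 'mc') mnt"
  assumes [simp]: "\<rho> \<in> Ar \<lbrakk>A', A\<rbrakk>\<^sub>0" "\<sigma> \<in> Ar \<lbrakk>B', B\<rbrakk>\<^sub>0" "\<tau> \<in> Ar \<lbrakk>C, C'\<rbrakk>\<^sub>0"
  shows "mnt_id (D A' B' C') *\<^sub>h \<lbrakk>\<rho>, \<lbrakk>\<sigma>, \<tau>\<rbrakk>\<^sub>2\<rbrakk>\<^sub>2 = \<lbrakk>\<sigma>, \<lbrakk>\<rho>, \<tau>\<rbrakk>\<^sub>2\<rbrakk>\<^sub>2 *\<^sub>h mnt_id (D A B C)"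
proof (rule D_first.AC.mnt_eqI)
  fix K assume "K \<in> Ob \<lbrakk>A, \<lbrakk>B, C\<rbrakk>\<^sub>0\<rbrakk>\<^sub>0"
  then have K [simp]: "K \<in> Ob \<lbrakk>A, \<lbrakk>B, C\<rbrakk>\<^sub>0\<rbrakk>\<^sub>0" .
  have natural: "far (ndom \<tau>) (ncomp (far K (ncomp \<rho> a)) (fob (ncod \<sigma>) b)) \<cdot>\<^bsub>C'\<^esub> far (ndom \<tau>) (far (fob K (fob (ndom \<rho>) a)) (ncomp \<sigma> b))
      = far (ndom \<tau>) (far (fob K (fob (ncod \<rho>) a)) (ncomp \<sigma> b)) \<cdot>\<^bsub>C'\<^esub> far (ndom \<tau>) (ncomp (far K (ncomp \<rho> a)) (fob (ndom \<sigma>) b))"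
    if "a \<in> Ob A'" "b \<in> Ob B'" for a b
    using that ABC.BC.ncomp_natural[of "far K (ncomp \<rho> a)" "ncomp \<sigma> b"]
    by (simp flip: BB'_CC'.BD.far_comp)
  show "ncomp (mnt_id (D A' B' C') *\<^sub>h \<lbrakk>\<rho>, \<lbrakk>\<sigma>, \<tau>\<rbrakk>\<^sub>2\<rbrakk>\<^sub>2) K = ncomp (\<lbrakk>\<sigma>, \<lbrakk>\<rho>, \<tau>\<rbrakk>\<^sub>2\<rbrakk>\<^sub>2 *\<^sub>h mnt_id (D A B C)) K"
    by (simp, rule ABC'.dual_mnt_eqI) (simp_all add: dual_smf_natural natural)
qed (simp_all add: D_natural)

end

theorem proposition10p4:
  shows "two_natural (op1 (SMC :: ('oa, 'ma) smc_two_cat) \<times>\<^sub>2 op1 (SMC :: ('ob, 'mb) smc_two_cat)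
             \<times>\<^sub>2 (SMC :: ('oc, 'mc) smc_two_cat))
           hom_ABC hom_BAC (\<lambda>(A, B, C). D A B C)
         \<and> (\<forall>(A :: ('oa, 'ma) smc) (B :: ('ob, 'mb) smc) (C :: ('oc, 'mc) smc).
              sym_mon_category A \<longrightarrow> sym_mon_category B \<longrightarrow> sym_mon_category C
              \<longrightarrow> inverse_smf (D A B C) (D B A C))"
proof (intro conjI allI impI inverse_smf_D)
  let ?K = "op1 (SMC :: ('oa, 'ma) smc_two_cat) \<times>\<^sub>2 op1 (SMC :: ('ob, 'mb) smc_two_cat) \<times>\<^sub>2 (SMC :: ('oc, 'mc) smc_two_cat)"
  show "two_natural ?K hom_ABC hom_BAC (\<lambda>(A, B, C). D A B C)"
  proof (rule two_natural.intro[OF two_functor_hom_ABC two_functor_hom_BAC])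
    fix x assume "x \<in> cells0 ?K"
    moreover obtain A B C where x: "x = (A, B, C)" by (metis prod_cases3)
    ultimately interpret smc_dual A B C by (simp add: cells_SMC smc_dual_def)
    show "sym_mon_functor (case x of (A, B, C) \<Rightarrow> D A B C)"
      "fdom (case x of (A, B, C) \<Rightarrow> D A B C) = on0 hom_ABC x"
      "fcod (case x of (A, B, C) \<Rightarrow> D A B C) = on0 hom_BAC x"
      using D_in unfolding hom_Ob_iff by (simp_all add: x hom_ABC_def hom_BAC_def)
  next
    fix f x y assume "f \<in> Cells1 ?K x y"
    moreover obtain F G H A B C A' B' C' where f: "f = (F, G, H)" and x: "x = (A, B, C)" and y: "y = (A', B', C')"
      by (metis prod_cases3)
    ultimately have FGH: "F \<in> Ob \<lbrakk>A', A\<rbrakk>\<^sub>0" "G \<in> Ob \<lbrakk>B', B\<rbrakk>\<^sub>0" "H \<in> Ob \<lbrakk>C, C'\<rbrakk>\<^sub>0" by (simp_all add: cells_SMC)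
    then interpret smc_dual_map A B C A' B' C'
      using FGH[THEN smc_hom_of_functor] by (simp add: smc_dual_map_def smc_dual_def smc_hom_def)
    show "(case y of (A, B, C) \<Rightarrow> D A B C) \<circ>\<^sub>F on1 hom_ABC f = on1 hom_BAC f \<circ>\<^sub>F (case x of (A, B, C) \<Rightarrow> D A B C)"
      using D_natural[OF FGH] by (simp add: f x y hom_ABC_def hom_BAC_def)
    fix s g assume "s \<in> Cells2 ?K f g"
    moreover obtain \<rho> \<sigma> \<tau> F' G' H' where s: "s = (\<rho>, \<sigma>, \<tau>)" and "g = (F', G', H')" by (metis prod_cases3)
    ultimately have "\<rho> \<in> Ar \<lbrakk>A', A\<rbrakk>\<^sub>0" "\<sigma> \<in> Ar \<lbrakk>B', B\<rbrakk>\<^sub>0" "\<tau> \<in> Ar \<lbrakk>C, C'\<rbrakk>\<^sub>0"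
      using FGH by (auto simp: f dest: Cells2_SMC_typing)
    then show "mnt_id (case y of (A, B, C) \<Rightarrow> D A B C) *\<^sub>h on2 hom_ABC s
        = on2 hom_BAC s *\<^sub>h mnt_id (case x of (A, B, C) \<Rightarrow> D A B C)"
      using D_natural2[of \<rho> \<sigma> \<tau>] by (simp add: s x y hom_ABC_def hom_BAC_def)
  qed
qed

end
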